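(* Let $d,n,\gamma_0,\gamma_1,\dots,\gamma_d$ be non-negative integers with $d\ge 2$ and $\gamma_0+\gamma_1+\dots+\gamma_d=n+d$, and put $s=-d+\sum_{j=0}^d\gamma_j$. Then the number of rooted $d$-dimensional Fu\ss--Catalan complexes $(\Sigma,\Delta_* )$ of index $n$ which, in their unique proper colouring by the colours $c_0,c_1,\dots,c_d$ in which the $i$-th vertex of $\Delta_*$ has colour $c_i$ for $i=1,\dots,d$, have exactly $\gamma_i$ vertices of colour $c_i$ for each $i=0,1,\dots,d$, equals $$s^{d-1}\,\frac{\gamma_0}{s-\gamma_0+1}\binom{s-\gamma_0+1}{\gamma_0}\prod_{j=1}^{d}\frac{1}{s-\gamma_j+1}\binom{s-\gamma_j+1}{\gamma_j-1}.$$ When $\gamma_0=0$ this is to be interpreted as the limit $\gamma_0\to 0$, i.e. the number is $1$ if $(\gamma_0,\gamma_1,\dots,\gamma_d)=(0,1,1,\dots,1)$ and $0$ otherwise.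
   Context: Let $d\ge2$. A $d$-dimensional Fu\ss--Catalan complex of index $n\ge1$ is a simplicial complex $\Sigma$ such that (i) $\Sigma$ is a $d$-dimensional simplicial complex homeomorphic to a closed $d$-dimensional ball and having exactly $n$ simplices of maximal dimension $d$; (ii) every simplex of $\Sigma$ of dimension at most $d-2$ is contained in the boundary $\partial\Sigma$ (a $(d-1)$-sphere). Such a complex is rooted if a $(d-1)$-simplex $\Delta_*$ of $\partial\Sigma$ is marked and its vertices are totally ordered; it is denoted $(\Sigma,\Delta_* )$. By convention, the unique rooted $d$-dimensional Fu\ss--Catalan complex of index $0$ is $(\Delta_*,\Delta_* )$ with $\Delta_*$ a $(d-1)$-simplex with totally ordered vertices. Complexes are counted up to combinatorial isomorphism preserving the marked simplex and the order of its vertices (e.g. for $d=2$ these are exactly the triangulations of a rooted convex $(n+2)$-gon, and the total number of index $n$ is $\frac1n\binom{dn}{n-1}$). A proper colouring of a simplicial complex is a map from its vertices to a set of colours giving different colours to the two endpoints of every edge. Every rooted $d$-dimensional Fu\ss--Catalan complex has a unique proper colouring by the $d+1$ colours $c_0<c_1<\dots<c_d$ such that the $i$-th vertex of $\Delta_*$ has colour $c_i$, $i=1,\dots,d$. *)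

theory Defs
  imports "HOL-Analysis.Analysis"
begin

text \<open>
  Simplicial complexes are finite abstract complexes: downward closed families of nonempty finite
  sets, a simplex of dimension \<open>k\<close> being a member with \<open>k + 1\<close> elements. (The complexes of
  \<open>HOL-Analysis.Polytope\<close> are embedded in a fixed Euclidean space, whereas here the dimension is a
  variable and complexes only matter up to isomorphism.)
\<close>

definition abstract_complex :: "'v set set \<Rightarrow> bool" where
  "abstract_complex K \<longleftrightarrow>
     finite K \<and> (\<forall>\<sigma>\<in>K. finite \<sigma> \<and> \<sigma> \<noteq> {}) \<and> (\<forall>\<sigma>\<in>K. \<forall>\<tau>\<subseteq>\<sigma>. \<tau> \<noteq> {} \<longrightarrow> \<tau> \<in> K)"

definition vertices :: "'v set set \<Rightarrow> 'v set" where
  "vertices K = \<Union>K"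

text \<open>
  The points of the geometric realization are the barycentric coordinate functions whose support is
  a simplex; as the complex is finite, the topology of pointwise convergence is the usual one.
\<close>

definition support :: "('v \<Rightarrow> real) \<Rightarrow> 'v set" where
  "support x = {v. x v \<noteq> 0}"

definition realization :: "'v set set \<Rightarrow> ('v \<Rightarrow> real) topology" where
  "realization K = subtopology (powertop_real UNIV)
     {x. (\<forall>v. 0 \<le> x v) \<and> support x \<in> K \<and> (\<Sum>v\<in>support x. x v) = 1}"

definition closed_ball :: "nat \<Rightarrow> (nat \<Rightarrow> real) topology" where
  "closed_ball d = subtopology (Euclidean_space d) {x. (\<Sum>i<d. x i ^ 2) \<le> 1}"

text \<open>
  The boundary of a complex homeomorphic to the \<open>d\<close>-ball (\<open>d \<ge> 1\<close>) is the set of points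
  corresponding to the unit sphere. By invariance of domain it does not depend on the homeomorphism.
\<close>

definition boundary_points :: "nat \<Rightarrow> 'v set set \<Rightarrow> ('v \<Rightarrow> real) set" where
  "boundary_points d K = {x \<in> topspace (realization K).
     \<exists>h. homeomorphic_map (realization K) (closed_ball d) h \<and> h x \<in> topspace (nsphere (d - 1))}"

definition in_boundary :: "nat \<Rightarrow> 'v set set \<Rightarrow> 'v set \<Rightarrow> bool" where
  "in_boundary d K \<sigma> \<longleftrightarrow>
     \<sigma> \<in> K \<and> {x \<in> topspace (realization K). support x \<subseteq> \<sigma>} \<subseteq> boundary_points d K"

text \<open>In the last clause, \<open>card \<sigma> \<le> d - 1\<close> says that the dimension of \<open>\<sigma>\<close> is at most \<open>d - 2\<close>.\<close>

definition fuss_catalan_complex :: "nat \<Rightarrow> nat \<Rightarrow> 'v set set \<Rightarrow> bool" where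
  "fuss_catalan_complex d n K \<longleftrightarrow>
     abstract_complex K \<and>
     (\<forall>\<sigma>\<in>K. card \<sigma> \<le> d + 1) \<and>
     realization K homeomorphic_space closed_ball d \<and>
     card {\<sigma>\<in>K. card \<sigma> = d + 1} = n \<and>
     (\<forall>\<sigma>\<in>K. card \<sigma> \<le> d - 1 \<longrightarrow> in_boundary d K \<sigma>)"

text \<open>
  The root simplex together with the total order on its vertices is given by the list of its
  vertices. The first case is the convention for index 0.
\<close>

definition rooted_fuss_catalan :: "nat \<Rightarrow> nat \<Rightarrow> 'v set set \<times> 'v list \<Rightarrow> bool" where
  "rooted_fuss_catalan d n = (\<lambda>(K, r).
     distinct r \<and> length r = d \<and>
     (if n = 0 then K = {\<sigma>. \<sigma> \<subseteq> set r \<and> \<sigma> \<noteq> {}}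
      else fuss_catalan_complex d n K \<and> in_boundary d K (set r)))"

definition rooted_iso :: "'v set set \<times> 'v list \<Rightarrow> 'w set set \<times> 'w list \<Rightarrow> bool" where
  "rooted_iso = (\<lambda>(K, r) (L, q).
     \<exists>f. bij_betw f (vertices K) (vertices L) \<and> (\<lambda>\<sigma>. f ` \<sigma>) ` K = L \<and> map f r = q)"

definition proper_colouring :: "'v set set \<Rightarrow> 'c set \<Rightarrow> ('v \<Rightarrow> 'c) \<Rightarrow> bool" where
  "proper_colouring K C c \<longleftrightarrow>
     c \<in> vertices K \<rightarrow>\<^sub>E C \<and> (\<forall>u v. {u, v} \<in> K \<and> u \<noteq> v \<longrightarrow> c u \<noteq> c v)"

text \<open>
  The colour \<open>c\<^sub>i\<close> is the number \<open>i\<close>. Lists are indexed from 0, so the \<open>i\<close>-th vertex of the root is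
  \<open>r ! (i - 1)\<close>.
\<close>

definition root_colouring :: "nat \<Rightarrow> 'v set set \<times> 'v list \<Rightarrow> 'v \<Rightarrow> nat" where
  "root_colouring d = (\<lambda>(K, r).
     THE c. proper_colouring K {0..d} c \<and> (\<forall>i\<in>{1..d}. c (r ! (i - 1)) = i))"

text \<open>Every finite complex is isomorphic to one whose vertices are natural numbers.\<close>

definition coloured_fuss_catalan ::
    "nat \<Rightarrow> nat \<Rightarrow> (nat \<Rightarrow> nat) \<Rightarrow> (nat set set \<times> nat list) set" where
  "coloured_fuss_catalan d n \<gamma> = {P. rooted_fuss_catalan d n P \<and>
     (\<forall>i\<in>{0..d}. card {v \<in> vertices (fst P). root_colouring d P v = i} = \<gamma> i)}"

definition coloured_fuss_catalan_classes ::
    "nat \<Rightarrow> nat \<Rightarrow> (nat \<Rightarrow> nat) \<Rightarrow> (nat set set \<times> nat list) set set" where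
  "coloured_fuss_catalan_classes d n \<gamma> =
     coloured_fuss_catalan d n \<gamma> //
       {(P, Q). P \<in> coloured_fuss_catalan d n \<gamma> \<and> Q \<in> coloured_fuss_catalan d n \<gamma> \<and> rooted_iso P Q}"

definition binom :: "real \<Rightarrow> int \<Rightarrow> real" where
  "binom x k = (if k < 0 then 0 else x gchoose nat k)"

end

theory Submission
  imports Defs "HOL-Homology.Homology"
begin

text \<open>
  A Fuss-Catalan complex is a tree of facets: its interior is an open ball made of the open facets
  and of open ridges, so by invariance of domain a ridge meeting the interior lies in two facets
  and is crossed by the dual graph; connectedness of the interior makes the dual graph connected,
  local connectedness near a boundary vertex makes the facets around this vertex connected, and
  contractibility of the interior (a map to the circle which turns once across a ridge has no
  monodromy) shows that each interior ridge separates. Hence the facets can be added one by one,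
  each across a free ridge with a new vertex, and the complex is determined by the tree of the
  colours of the new vertices. Conversely, attaching a simplex along a boundary facet changes a
  ball only by a homeomorphism. The trees with prescribed colour counts are then counted by a
  recursion on forests, whose closed solution is what Lagrange inversion predicts.
\<close>

section \<open>Counting coloured trees\<close>

text \<open>Dual connectedness alone does not give this: the apex might close up with an older
  facet. It follows from the local statement at the apex combined with separation, since facets
  around the apex and older facets would together form a detour around the ridge just crossed.
  Boundary simplices are given by arbitrary homeomorphisms, while the interior is taken for one
  fixed homeomorphism; invariance of domain applied to the change of homeomorphism reconciles the
  two. In the count, let P be the product of all 1 + F_i and t_j = x_j * P. Then 1 + F_j = phi(t_j)
  with phi * (phi - 1) = t. The product in \<open>forest_number\<close> is the coefficient of all
  phi(t_j) ^ (a_j + n); the other factor is the Jacobian of Lagrange inversion, where t_j times the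
  logarithmic derivative of phi(t_j) contributes m_j / (a_j + n). No power series are used
  afterwards: the numbers are checked against the recursion that deletes a root. Deleting a root
  leaves several trees, so the recursion needs arbitrary multiplicities a_j.\<close>

text \<open>
  The coefficient of \<open>t ^ k\<close> in \<open>((1 + sqrt (1 + 4 * t)) / 2) powr x\<close>, written without the
  denominator \<open>x - k\<close>.
\<close>

definition gbin :: "real \<Rightarrow> nat \<Rightarrow> real" where
  "gbin x k = (case k of 0 \<Rightarrow> 1 | Suc k' \<Rightarrow> (x - real k gchoose k) + (x - real k - 1 gchoose k'))"

lemma gbin_0 [simp]: "gbin x 0 = 1"
  by (simp add: gbin_def)

text \<open>The base phi of the power satisfies phi ^ 2 = phi + t. Multiplying by phi powr (x - 2)
  and comparing coefficients gives the recursion, which is verified here with Pascal's rule.\<close>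

lemma gbin_rec: "gbin x (Suc k) = gbin (x - 1) (Suc k) + gbin (x - 2) k"
proof (cases k)
  case 0
  then show ?thesis by (simp add: gbin_def)
next
  case (Suc k')
  have p1: "(x - real k - 1 gchoose Suc k) = (x - real k - 2 gchoose k) + (x - real k - 2 gchoose Suc k)"
    using gbinomial_Suc_Suc[of "x - real k - 2" k] by (simp add: algebra_simps)
  have p2: "(x - real k - 2 gchoose Suc k') = (x - real k - 3 gchoose k') + (x - real k - 3 gchoose Suc k')"
    using gbinomial_Suc_Suc[of "x - real k - 3" k'] by (simp add: algebra_simps)
  have a: "gbin x (Suc k) = (x - real k - 1 gchoose Suc k) + (x - real k - 2 gchoose k)"
    by (simp add: gbin_def algebra_simps)
  have b: "gbin (x - 1) (Suc k) = (x - real k - 2 gchoose Suc k) + (x - real k - 3 gchoose k)"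
    by (simp add: gbin_def algebra_simps)
  have c: "gbin (x - 2) k = (x - real k - 2 gchoose k) + (x - real k - 3 gchoose k')"
    unfolding Suc by (simp add: gbin_def algebra_simps)
  show ?thesis
    unfolding a b c using p1 p2 Suc by simp
qed

text \<open>This is the usual value x / (x - k) times the binomial coefficient of x - k over k, with
  the denominator moved to the other side by absorption. The factor 1 - k / x is what one variable
  alone contributes to the Jacobian factor of \<open>forest_number\<close>.\<close>

lemma gbin_mult:
  assumes "x \<noteq> 0 \<or> k = 0"
  shows "gbin x k * (1 - real k / x) = (x - real k gchoose k)"
proof (cases k)
  case (Suc k')
  define a where "a = x - real k"
  have ab: "real k * (a gchoose k) = a * (a - 1 gchoose k')"
    using gbinomial_absorption[of k' a] Suc by simp
  have x: "x \<noteq> 0" using assms Suc by simp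
  have "gbin x k * (x - real k) = a * (a gchoose k) + a * (a - 1 gchoose k')"
    using Suc by (simp add: gbin_def a_def algebra_simps)
  also have "\<dots> = x * (a gchoose k)"
    unfolding ab[symmetric] by (simp add: a_def algebra_simps)
  finally have "gbin x k * (x - real k) = x * (a gchoose k)" .
  then show ?thesis using x unfolding a_def by (simp add: field_simps)
qed simp

text \<open>
  The coefficient of \<open>x\<^sub>0 ^ m\<^sub>0 \<dots> x\<^sub>d ^ m\<^sub>d\<close> in the product of the powers \<open>(1 + F\<^sub>j) ^ a\<^sub>j\<close>, where the series \<open>F\<^sub>j\<close>
  count trees whose root has type \<open>j\<close>. As \<open>F\<^sub>j * (1 + F\<^sub>j)\<close> is \<open>x\<^sub>j\<close> times the product of all
  \<open>1 + F\<^sub>i\<close>, Lagrange inversion gives the formula.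
\<close>

definition forest_number :: "nat \<Rightarrow> (nat \<Rightarrow> nat) \<Rightarrow> (nat \<Rightarrow> nat) \<Rightarrow> real" where
  "forest_number d a m = (let n = sum m {..d} in
     (\<Prod>j\<le>d. gbin (real (a j + n)) (m j)) * (1 - (\<Sum>j\<le>d. real (m j) / real (a j + n))))"

text \<open>The recursion acts on one variable i, whereas a_j + n keeps its value for every j
  \<noteq> i. With the i-th variable isolated, the number is linear in the two quantities
  \<open>gbin\<close> and \<open>gbin\<close> times (1 - m_i / (a_i + n)), which obey the same
  recursion.\<close>

lemma forest_number_split:
  assumes "i \<le> d"
  shows "forest_number d a m =
     (\<Prod>j\<in>{..d} - {i}. gbin (real (a j + sum m {..d})) (m j)) *
     (gbin (real (a i + sum m {..d})) (m i) * (1 - real (m i) / real (a i + sum m {..d})) -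
      gbin (real (a i + sum m {..d})) (m i) *
      (\<Sum>j\<in>{..d} - {i}. real (m j) / real (a j + sum m {..d})))"
proof -
  define n where "n = sum m {..d}"
  have i: "i \<in> {..d}" "finite {..d}" using assms by auto
  have 1: "(\<Prod>j\<le>d. gbin (real (a j + n)) (m j)) =
      gbin (real (a i + n)) (m i) * (\<Prod>j\<in>{..d} - {i}. gbin (real (a j + n)) (m j))"
    by (rule prod.remove[OF i(2,1)])
  have 2: "(\<Sum>j\<le>d. real (m j) / real (a j + n)) =
      real (m i) / real (a i + n) + (\<Sum>j\<in>{..d} - {i}. real (m j) / real (a j + n))"
    by (rule sum.remove[OF i(2,1)])
  have "g * P * (1 - (t + U)) = P * (g * (1 - t) - g * U)" for g P t U :: real
    by (simp add: algebra_simps)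
  then show ?thesis
    unfolding forest_number_def Let_def n_def[symmetric] 1 2 by blast
qed

text \<open>For an empty list the quotients m_j / n add up to 1 as soon as n > 0, so the Jacobian
  factor vanishes.\<close>

lemma forest_number_0:
  "forest_number d (\<lambda>_. 0) m = (if \<forall>k\<le>d. m k = 0 then 1 else 0)"
proof (cases "\<forall>k\<le>d. m k = 0")
  case True
  then show ?thesis by (simp add: forest_number_def)
next
  case False
  define n where "n = sum m {..d}"
  from False have "n \<noteq> 0" unfolding n_def by auto
  moreover have "(\<Sum>j\<le>d. real (m j) / real n) = real n / real n"
    unfolding sum_divide_distrib[symmetric] by (simp add: n_def)
  ultimately show ?thesis using False unfolding forest_number_def Let_def n_def[symmetric] by simp
qed

text \<open>Without nodes of type i an additional tree of type i is empty; in the formula, a_i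
  disappears because \<open>gbin\<close> is 1 and the quotient is 0 at m_i = 0.\<close>

lemma forest_number_leaf:
  assumes i: "i \<le> d" and "m i = 0"
  shows "forest_number d (a(i := Suc (a i))) m = forest_number d a m"
proof -
  have "(\<Sum>j\<in>{..d} - {i}. real (m j) / real ((a(i := Suc (a i))) j + sum m {..d})) =
        (\<Sum>j\<in>{..d} - {i}. real (m j) / real (a j + sum m {..d}))"
    by (rule sum.cong) auto
  moreover have "(\<Prod>j\<in>{..d} - {i}. gbin (real ((a(i := Suc (a i))) j + sum m {..d})) (m j)) =
        (\<Prod>j\<in>{..d} - {i}. gbin (real (a j + sum m {..d})) (m j))"
    by (rule prod.cong) auto
  ultimately show ?thesis
    unfolding forest_number_split[OF i] using assms(2) by simp
qed

text \<open>The additional tree of type i is empty or has a root, which gives way to one tree of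
  each type j \<noteq> i. The values of a_j + n agree in all three terms for j \<noteq> i, and for i
  they are \<beta>, \<beta> - 1 and \<beta> - 2. What remains is \<open>gbin_rec\<close> together
  with Pascal's rule.\<close>

lemma forest_number_node:
  assumes i: "i \<le> d" and m: "m i = Suc k"
  shows "forest_number d (a(i := Suc (a i))) m =
    forest_number d a m + forest_number d (\<lambda>j. if j = i then a i else Suc (a j)) (m(i := k))"
proof -
  define n where "n = sum m {..d}"
  have ii: "i \<in> {..d}" "finite {..d}" using assms by auto
  have n: "n = Suc (sum (m(i := k)) {..d})"
    unfolding n_def sum.remove[OF ii(2,1), of m] sum.remove[OF ii(2,1), of "m(i := k)"] m
    by simp
  define \<beta> where "\<beta> = real (a i + n) + 1"
  define P where "P = (\<Prod>j\<in>{..d} - {i}. gbin (real (a j + n)) (m j))"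
  define U where "U = (\<Sum>j\<in>{..d} - {i}. real (m j) / real (a j + n))"
  define C where "C x k = (x - real k gchoose k)" for x k
  have n1: "n \<ge> 1" using n by simp
  \<comment> \<open>For a i = 0 and n = 1 the number \<beta> - 2 is 0; then k = 0 as well, and
    \<open>gbin_mult\<close> holds with 0 / 0 = 0.\<close>
  have bz: "\<beta> - 2 \<noteq> 0 \<or> k = 0"
  proof (rule disjCI)
    assume "k \<noteq> 0"
    moreover have "n \<ge> Suc k" unfolding n_def using m sum.remove[OF ii(2,1), of m] by simp
    ultimately show "\<beta> - 2 \<noteq> 0" unfolding \<beta>_def by simp
  qed
  have 1: "forest_number d (a(i := Suc (a i))) m = P * (C \<beta> (Suc k) - gbin \<beta> (Suc k) * U)"
  proof -
    have "P = (\<Prod>j\<in>{..d} - {i}. gbin (real ((a(i := Suc (a i))) j + n)) (m j))"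
      unfolding P_def by (rule prod.cong) auto
    moreover have "U = (\<Sum>j\<in>{..d} - {i}. real (m j) / real ((a(i := Suc (a i))) j + n))"
      unfolding U_def by (rule sum.cong) auto
    moreover have "real ((a(i := Suc (a i))) i + n) = \<beta>" unfolding \<beta>_def by simp
    moreover have "gbin \<beta> (Suc k) * (1 - real (Suc k) / \<beta>) = C \<beta> (Suc k)"
      unfolding C_def by (rule gbin_mult) (simp add: \<beta>_def)
    ultimately show ?thesis
      unfolding forest_number_split[OF i] n_def[symmetric] m by (simp del: of_nat_Suc)
  qed
  have 2: "forest_number d a m = P * (C (\<beta> - 1) (Suc k) - gbin (\<beta> - 1) (Suc k) * U)"
  proof -
    have "gbin (\<beta> - 1) (Suc k) * (1 - real (Suc k) / (\<beta> - 1)) = C (\<beta> - 1) (Suc k)"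
      unfolding C_def by (rule gbin_mult) (use n1 in \<open>simp add: \<beta>_def\<close>)
    moreover have "real (a i + n) = \<beta> - 1" unfolding \<beta>_def by simp
    ultimately show ?thesis
      unfolding forest_number_split[OF i] n_def[symmetric] m P_def[symmetric] U_def[symmetric]
      by (simp del: of_nat_Suc of_nat_add)
  qed
  have 3: "forest_number d (\<lambda>j. if j = i then a i else Suc (a j)) (m(i := k)) =
     P * (C (\<beta> - 2) k - gbin (\<beta> - 2) k * U)"
  proof -
    define n' where "n' = sum (m(i := k)) {..d}"
    have nn: "n = Suc n'" using n n'_def by simp
    have "P = (\<Prod>j\<in>{..d} - {i}. gbin (real ((if j = i then a i else Suc (a j)) + n')) ((m(i := k)) j))"
      unfolding P_def nn by (rule prod.cong) auto
    moreover have "U = (\<Sum>j\<in>{..d} - {i}. real ((m(i := k)) j) / real ((if j = i then a i else Suc (a j)) + n'))"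
      unfolding U_def nn by (rule sum.cong) auto
    moreover have "real (a i + n') = \<beta> - 2" unfolding \<beta>_def nn by simp
    moreover have "gbin (\<beta> - 2) k * (1 - real k / (\<beta> - 2)) = C (\<beta> - 2) k"
      unfolding C_def by (rule gbin_mult) (use bz in simp)
    ultimately show ?thesis
      unfolding forest_number_split[OF i] n'_def[symmetric] by simp
  qed
  have "C \<beta> (Suc k) = C (\<beta> - 1) (Suc k) + C (\<beta> - 2) k"
    using gbinomial_Suc_Suc[of "\<beta> - 2 - real k" k] unfolding C_def by (simp add: algebra_simps)
  then show ?thesis unfolding 1 2 3 gbin_rec[of \<beta>] by (simp add: algebra_simps)
qed

text \<open>
  A node of a tree is the word of the types met on the path from the root to it; a child never
  has the type of its parent, and siblings have different types.
\<close>

definition trees :: "nat \<Rightarrow> nat \<Rightarrow> nat list set set" where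
  "trees d i = {T. finite T \<and>
     (\<forall>w\<in>T. w \<noteq> [] \<and> hd w = i \<and> distinct_adj w \<and> set w \<subseteq> {..d}) \<and>
     (\<forall>w j. w @ [j] \<in> T \<and> w \<noteq> [] \<longrightarrow> w \<in> T)}"

definition type_count :: "nat list set \<Rightarrow> nat \<Rightarrow> nat" where
  "type_count T k = card {w \<in> T. last w = k}"

text \<open>Entries may be empty trees, which is why a list of types corresponds to a product of
  series 1 + F_i and not of series F_i.\<close>

definition forests :: "nat \<Rightarrow> nat list \<Rightarrow> (nat \<Rightarrow> nat) \<Rightarrow> nat list set list set" where
  "forests d l m = {Ts. list_all2 (\<lambda>T i. T \<in> trees d i) Ts l \<and>
     (\<forall>k\<le>d. (\<Sum>T\<leftarrow>Ts. type_count T k) = m k)}"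

definition children :: "nat \<Rightarrow> nat \<Rightarrow> nat list" where
  "children d i = filter (\<lambda>j. j \<noteq> i) [0..<Suc d]"

definition join_trees :: "nat \<Rightarrow> nat list set list \<Rightarrow> nat list set" where
  "join_trees i Us = insert [i] (\<Union>U\<in>set Us. (#) i ` U)"

definition subtree :: "nat \<Rightarrow> nat list set \<Rightarrow> nat \<Rightarrow> nat list set" where
  "subtree i T j = {w. w \<noteq> [] \<and> hd w = j \<and> i # w \<in> T}"

section \<open>Decomposition of a tree into its root and the subtrees of its children\<close>

lemma treesD:
  assumes "T \<in> trees d i"
  shows tree_finite: "finite T"
    and tree_word: "w \<in> T \<Longrightarrow> w \<noteq> [] \<and> hd w = i \<and> distinct_adj w \<and> set w \<subseteq> {..d}"
    and tree_prefix: "w @ [j] \<in> T \<Longrightarrow> w \<noteq> [] \<Longrightarrow> w \<in> T"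
  using assms unfolding trees_def by blast+

lemma empty_in_trees [simp]: "{} \<in> trees d i"
  by (simp add: trees_def)

lemma type_count_empty [simp]: "type_count {} k = 0"
  by (simp add: type_count_def)

lemma tree_nonempty_root:
  assumes "T \<in> trees d i" "T \<noteq> {}"
  shows "[i] \<in> T"
proof -
  have "[i] \<in> T" if "w \<in> T" for w
    using that
  proof (induction w rule: rev_induct)
    case Nil
    then show ?case using tree_word[OF assms(1)] by blast
  next
    case (snoc x xs)
    show ?case
    proof (cases "xs = []")
      case True
      then show ?thesis using snoc.prems tree_word[OF assms(1) snoc.prems] by simp
    next
      case False
      then show ?thesis using snoc tree_prefix[OF assms(1)] by blast
    qed
  qed
  then show ?thesis using assms by blast
qed

lemma subtree_in_trees:
  assumes "T \<in> trees d i"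
  shows "subtree i T j \<in> trees d j"
  unfolding trees_def
proof (intro CollectI conjI allI ballI impI)
  have "(#) i ` subtree i T j \<subseteq> T" by (auto simp: subtree_def)
  then have "finite ((#) i ` subtree i T j)" using tree_finite[OF assms] finite_subset by blast
  then show "finite (subtree i T j)" by (rule finite_imageD) simp
next
  fix w assume w: "w \<in> subtree i T j"
  then show "w \<noteq> []" "hd w = j" by (auto simp: subtree_def)
  from w have "i # w \<in> T" by (auto simp: subtree_def)
  then have "distinct_adj (i # w)" "set (i # w) \<subseteq> {..d}" using tree_word[OF assms] by blast+
  then show "distinct_adj w" "set w \<subseteq> {..d}" by (auto dest: distinct_adj_ConsD)
next
  fix w x assume "w @ [x] \<in> subtree i T j \<and> w \<noteq> []"
  then have "(i # w) @ [x] \<in> T" "w \<noteq> []" "hd w = j" by (auto simp: subtree_def)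
  moreover from this have "i # w \<in> T" using tree_prefix[OF assms, of "i # w" x] by simp
  ultimately show "w \<in> subtree i T j" by (auto simp: subtree_def)
qed

lemma distinct_children: "distinct (children d i)"
  by (simp add: children_def)

lemma set_children: "set (children d i) = {..d} - {i}"
  by (auto simp: children_def)

lemma join_trees_in_trees:
  assumes "list_all2 (\<lambda>T i. T \<in> trees d i) Us (children d i)" and i: "i \<le> d"
  shows "join_trees i Us \<in> trees d i"
proof -
  have U: "\<exists>j\<in>{..d} - {i}. U \<in> trees d j" if "U \<in> set Us" for U
    using that assms(1) set_children[of d i] by (metis in_set_conv_nth list_all2_conv_all_nth)
  show ?thesis
    unfolding trees_def
  proof (intro CollectI conjI allI ballI impI)
    show "finite (join_trees i Us)"
      unfolding join_trees_def using U tree_finite by fastforce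
  next
    fix w assume w: "w \<in> join_trees i Us"
    then show "w \<noteq> []" "hd w = i" by (auto simp: join_trees_def)
    show "distinct_adj w" "set w \<subseteq> {..d}"
    proof -
      consider "w = [i]" | U v where "U \<in> set Us" "v \<in> U" "w = i # v"
        using w by (auto simp: join_trees_def)
      then have "distinct_adj w \<and> set w \<subseteq> {..d}"
      proof cases
        case 2
        then obtain j where "j \<in> {..d} - {i}" "U \<in> trees d j" using U by blast
        then show ?thesis using tree_word[of U d j v] 2 i by (auto simp: distinct_adj_Cons)
      qed (use i in simp)
      then show "distinct_adj w" "set w \<subseteq> {..d}" by auto
    qed
  next
    fix w x assume a: "w @ [x] \<in> join_trees i Us \<and> w \<noteq> []"
    then obtain U w' where U': "U \<in> set Us" "w' \<in> U" "w @ [x] = i # w'"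
      by (auto simp: join_trees_def)
    with a obtain v where v: "w = i # v" "w' = v @ [x]" by (cases w) auto
    show "w \<in> join_trees i Us"
    proof (cases "v = []")
      case False
      with U' v U[of U] have "v \<in> U" using tree_prefix by blast
      then show ?thesis using U' v by (auto simp: join_trees_def)
    qed (simp add: v join_trees_def)
  qed
qed

text \<open>Trees with different root types are disjoint as sets of words, because the first letters
  differ.\<close>

lemma type_count_disjoint_sum:
  assumes "list_all2 (\<lambda>T i. T \<in> trees d i) Us c" "distinct c"
  shows "card {w \<in> \<Union>(set Us). last w = k} = (\<Sum>U\<leftarrow>Us. type_count U k)"
  using assms
proof (induction rule: list_all2_induct)
  case (Cons U Us j c)
  have fin: "finite U" "finite (\<Union>(set Us))"
  proof -
    have "finite U'" if "U' \<in> set Us" for U'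
      using that Cons.hyps(2) tree_finite by (metis in_set_conv_nth list_all2_conv_all_nth)
    then show "finite U" "finite (\<Union>(set Us))" using tree_finite[OF Cons.hyps(1)] by auto
  qed
  have "hd w \<in> set c" if "w \<in> \<Union>(set Us)" for w
  proof -
    obtain n where n: "n < length Us" "w \<in> Us ! n" using \<open>w \<in> \<Union>(set Us)\<close> by (auto simp: in_set_conv_nth)
    then have "Us ! n \<in> trees d (c ! n)" "n < length c" using Cons.hyps(2) by (auto simp: list_all2_conv_all_nth)
    then show ?thesis using tree_word n by (metis nth_mem)
  qed
  moreover have "hd w = j" if "w \<in> U" for w using tree_word[OF Cons.hyps(1) that] by simp
  ultimately have "U \<inter> \<Union>(set Us) = {}" using Cons.prems by fastforce
  moreover have "{w \<in> \<Union>(set (U # Us)). last w = k} = {w \<in> U. last w = k} \<union> {w \<in> \<Union>(set Us). last w = k}"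
    by auto
  ultimately have "card {w \<in> \<Union>(set (U # Us)). last w = k} =
     card {w \<in> U. last w = k} + card {w \<in> \<Union>(set Us). last w = k}"
    using fin by (simp only:) (rule card_Un_disjoint; auto intro: finite_subset[of _ "\<Union>(set Us)"])
  then show ?case using Cons by (simp add: type_count_def)
qed simp

text \<open>Prepending i to a nonempty word keeps its last letter, so the only new contribution is
  the root [i].\<close>

lemma type_count_join_trees:
  assumes "list_all2 (\<lambda>T i. T \<in> trees d i) Us (children d i)"
  shows "type_count (join_trees i Us) k = (if k = i then 1 else 0) + (\<Sum>U\<leftarrow>Us. type_count U k)"
proof -
  have U: "U \<in> trees d (hd w) \<and> w \<noteq> []" if "U \<in> set Us" "w \<in> U" for U w
  proof -
    obtain n where n: "n < length Us" "U = Us ! n" using \<open>U \<in> set Us\<close> by (auto simp: in_set_conv_nth)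
    then have t: "U \<in> trees d (children d i ! n)" using assms by (auto simp: list_all2_conv_all_nth)
    show ?thesis using t tree_word[OF t \<open>w \<in> U\<close>] by simp
  qed
  have fin: "finite (\<Union>(set Us))"
  proof (intro finite_Union ballI)
    fix U assume "U \<in> set Us"
    then show "finite U" using U[of U] tree_finite by (cases "U = {}") auto
  qed simp
  have eq: "{w \<in> join_trees i Us. last w = k} =
     (if k = i then {[i]} else {}) \<union> (#) i ` {w \<in> \<Union>(set Us). last w = k}"
  proof -
    have "w \<noteq> []" if "w \<in> \<Union>(set Us)" for w using that U by blast
    then have "{w \<in> \<Union>(set Us). last (i # w) = k} = {w \<in> \<Union>(set Us). last w = k}" by auto
    moreover have "{w \<in> join_trees i Us. last w = k} =
      (if k = i then {[i]} else {}) \<union> (#) i ` {w \<in> \<Union>(set Us). last (i # w) = k}"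
      unfolding join_trees_def by (auto simp del: last.simps) (simp_all add: last.simps)
    ultimately show ?thesis by simp
  qed
  have "card ((#) i ` {w \<in> \<Union>(set Us). last w = k}) = (\<Sum>U\<leftarrow>Us. type_count U k)"
    unfolding type_count_disjoint_sum[OF assms distinct_children, symmetric]
    by (rule card_image) simp
  moreover have "[i] \<notin> (#) i ` {w \<in> \<Union>(set Us). last w = k}" using U by auto
  moreover have "finite ((#) i ` {w \<in> \<Union>(set Us). last w = k})"
    by (rule finite_imageI, rule finite_subset[OF _ fin]) blast
  ultimately show ?thesis unfolding type_count_def[of "join_trees i Us"] eq by auto
qed

lemma join_subtrees:
  assumes "T \<in> trees d i" "T \<noteq> {}"
  shows "join_trees i (map (subtree i T) (children d i)) = T"
proof (intro equalityI subsetI)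
  fix w assume "w \<in> join_trees i (map (subtree i T) (children d i))"
  then show "w \<in> T" using tree_nonempty_root[OF assms] by (auto simp: join_trees_def subtree_def)
next
  fix w assume w: "w \<in> T"
  then have P: "w \<noteq> []" "hd w = i" "distinct_adj w" "set w \<subseteq> {..d}" using tree_word[OF assms(1) w] by blast+
  then obtain v where v: "w = i # v" by (cases w) auto
  show "w \<in> join_trees i (map (subtree i T) (children d i))"
  proof (cases "v = []")
    case False
    then have "hd v \<in> {..d} - {i}" using P v by (cases v) auto
    then show ?thesis using v w False
      by (auto simp: join_trees_def subtree_def set_children)
  qed (simp add: v join_trees_def)
qed

lemma subtree_join_trees:
  assumes "list_all2 (\<lambda>T i. T \<in> trees d i) Us (children d i)"
  shows "map (subtree i (join_trees i Us)) (children d i) = Us"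
proof (rule nth_equalityI)
  show len: "length (map (subtree i (join_trees i Us)) (children d i)) = length Us"
    using assms by (simp add: list_all2_lengthD)
  fix n assume "n < length (map (subtree i (join_trees i Us)) (children d i))"
  then have n: "n < length (children d i)" "n < length Us" using len by auto
  have hd: "w \<noteq> [] \<and> hd w = children d i ! n'" if "w \<in> Us ! n'" "n' < length Us" for w n'
    using tree_word that assms unfolding list_all2_conv_all_nth by metis
  have "subtree i (join_trees i Us) (children d i ! n) = Us ! n"
  proof (intro equalityI subsetI)
    fix w assume "w \<in> subtree i (join_trees i Us) (children d i ! n)"
    then have w: "w \<noteq> []" "hd w = children d i ! n" "i # w \<in> join_trees i Us" by (auto simp: subtree_def)
    then obtain n' where n': "n' < length Us" "w \<in> Us ! n'"
      by (auto simp: join_trees_def in_set_conv_nth)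
    then have "children d i ! n' = children d i ! n" using hd w by metis
    then have "n' = n" using distinct_children n n' len by (metis length_map nth_eq_iff_index_eq)
    then show "w \<in> Us ! n" using n' by simp
  next
    fix w assume "w \<in> Us ! n"
    then show "w \<in> subtree i (join_trees i Us) (children d i ! n)"
      using hd n by (auto simp: subtree_def join_trees_def)
  qed
  then show "map (subtree i (join_trees i Us)) (children d i) ! n = Us ! n" using n by simp
qed

text \<open>The root of the first tree is deleted and its subtrees, one possibly empty tree for each
  type other than i, take its place. This is the combinatorial counterpart of the second summand of
  \<open>forest_number_node\<close>.\<close>

lemma forests_Cons_nonempty_bij:
  assumes i: "i \<le> d" and m: "m i = Suc k"
  shows "bij_betw (\<lambda>Xs. join_trees i (take (length (children d i)) Xs) # drop (length (children d i)) Xs)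
    (forests d (children d i @ l) (m(i := k))) {Ts \<in> forests d (i # l) m. hd Ts \<noteq> {}}"
    (is "bij_betw ?f ?A ?B")
proof (rule bij_betw_byWitness[where f' = "\<lambda>Ts. map (subtree i (hd Ts)) (children d i) @ tl Ts"])
  let ?c = "length (children d i)"
  have tk: "list_all2 (\<lambda>T i. T \<in> trees d i) (take ?c Xs) (children d i) \<and>
     list_all2 (\<lambda>T i. T \<in> trees d i) (drop ?c Xs) l" if "Xs \<in> ?A" for Xs
  proof -
    have *: "list_all2 (\<lambda>T i. T \<in> trees d i) Xs (children d i @ l)"
      using that by (auto simp: forests_def)
    show ?thesis using list_all2_takeI[OF *, of ?c] list_all2_dropI[OF *, of ?c] by simp
  qed
  show "\<forall>Xs\<in>?A. map (subtree i (hd (?f Xs))) (children d i) @ tl (?f Xs) = Xs"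
  proof
    fix Xs assume "Xs \<in> ?A"
    then have "map (subtree i (join_trees i (take ?c Xs))) (children d i) = take ?c Xs"
      by (intro subtree_join_trees) (use tk in blast)
    then show "map (subtree i (hd (?f Xs))) (children d i) @ tl (?f Xs) = Xs" by simp
  qed
  show "\<forall>Ts\<in>?B. ?f (map (subtree i (hd Ts)) (children d i) @ tl Ts) = Ts"
  proof
    fix Ts assume a: "Ts \<in> ?B"
    then obtain T Ts' where Ts: "Ts = T # Ts'" "T \<in> trees d i" "T \<noteq> {}"
      by (cases Ts) (auto simp: forests_def)
    then show "?f (map (subtree i (hd Ts)) (children d i) @ tl Ts) = Ts"
      using join_subtrees by simp
  qed
  show "?f ` ?A \<subseteq> ?B"
  proof (rule image_subsetI)
    fix Xs assume X: "Xs \<in> ?A"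
    have s: "(\<Sum>T\<leftarrow>take ?c Xs. type_count T x) + (\<Sum>T\<leftarrow>drop ?c Xs. type_count T x) = (m(i := k)) x"
      if "x \<le> d" for x
    proof -
      have "(\<Sum>T\<leftarrow>take ?c Xs @ drop ?c Xs. type_count T x) = (m(i := k)) x"
        using that X unfolding append_take_drop_id by (auto simp: forests_def)
      then show ?thesis by (simp only: map_append sum_list_append)
    qed
    have "type_count (join_trees i (take ?c Xs)) x + (\<Sum>T\<leftarrow>drop ?c Xs. type_count T x) = m x"
      if "x \<le> d" for x
      using s[OF that] m tk[OF X] by (auto simp: type_count_join_trees split: if_splits)
    moreover have "join_trees i (take ?c Xs) \<noteq> {}" by (simp add: join_trees_def)
    ultimately show "?f Xs \<in> ?B"
      using tk[OF X] join_trees_in_trees[OF _ i] unfolding forests_def by simp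
  qed
  show "(\<lambda>Ts. map (subtree i (hd Ts)) (children d i) @ tl Ts) ` ?B \<subseteq> ?A"
  proof (rule image_subsetI)
    fix Ts assume a: "Ts \<in> ?B"
    then obtain T Ts' where Ts: "Ts = T # Ts'" "T \<in> trees d i" "T \<noteq> {}"
        "list_all2 (\<lambda>T i. T \<in> trees d i) Ts' l"
      by (cases Ts) (auto simp: forests_def)
    have l: "list_all2 (\<lambda>T i. T \<in> trees d i) (map (subtree i T) (children d i)) (children d i)"
      using subtree_in_trees[OF Ts(2)] by (auto simp: list_all2_conv_all_nth)
    have s: "type_count T x + (\<Sum>T\<leftarrow>Ts'. type_count T x) = m x" if "x \<le> d" for x
      using a that Ts by (auto simp: forests_def)
    have "(\<Sum>U\<leftarrow>map (subtree i T) (children d i). type_count U x) + (\<Sum>T\<leftarrow>Ts'. type_count T x) = (m(i := k)) x"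
      if "x \<le> d" for x
      using s[OF that] m type_count_join_trees[OF l, of x] unfolding join_subtrees[OF Ts(2,3)]
      by (auto split: if_splits)
    then show "map (subtree i (hd Ts)) (children d i) @ tl Ts \<in> ?A"
      using Ts l unfolding forests_def by (simp add: list_all2_appendI o_def)
  qed
qed

lemma forests_Cons_leaf_bij:
  "bij_betw ((#) {}) (forests d l m) {Ts \<in> forests d (i # l) m. hd Ts = {}}"
proof (rule bij_betwI')
  fix y assume y: "y \<in> {Ts \<in> forests d (i # l) m. hd Ts = {}}"
  then show "\<exists>x\<in>forests d l m. y = {} # x"
    by (cases y) (auto simp: forests_def)
qed (auto simp: forests_def)

section \<open>Enumeration of forests and of trees by their colour counts\<close>

lemma count_list_distinct: "distinct xs \<Longrightarrow> count_list xs x = (if x \<in> set xs then 1 else 0)"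
  by (induction xs) auto

lemma forests_nil: "forests d [] m = (if \<forall>k\<le>d. m k = 0 then {[]} else {})"
  by (auto simp: forests_def)

text \<open>Deleting a root lowers the number of nodes but makes the list longer; discarding an
  empty tree shortens the list and keeps the nodes. Hence the outer induction on the number of nodes
  and the inner one on the list. Only the multiplicities of the types matter, so
  \<open>count_list l\<close> plays the role of the exponents.\<close>

lemma card_forests:
  assumes "set l \<subseteq> {..d}"
  shows "finite (forests d l m) \<and> real (card (forests d l m)) = forest_number d (count_list l) m"
  using assms
proof (induction "sum m {..d}" arbitrary: m l rule: less_induct)
  case less
  note IH = less.hyps
  show ?case
    using less.prems
  proof (induction l)
    case Nil
    have "count_list [] = (\<lambda>_::nat. 0::nat)" by auto
    then show ?case by (simp add: forests_nil forest_number_0)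
  next
    case (Cons i l)
    then have i: "i \<le> d" and l: "finite (forests d l m)" "real (card (forests d l m)) = forest_number d (count_list l) m"
      by auto
    let ?E = "{Ts \<in> forests d (i # l) m. hd Ts = {}}"
    let ?N = "{Ts \<in> forests d (i # l) m. hd Ts \<noteq> {}}"
    have E: "finite ?E" "real (card ?E) = forest_number d (count_list l) m"
      using bij_betw_finite[OF forests_Cons_leaf_bij[of d l m i]]
        bij_betw_same_card[OF forests_Cons_leaf_bij[of d l m i]] l by simp_all
    have split: "forests d (i # l) m = ?E \<union> ?N" "?E \<inter> ?N = {}" by auto
    have cl: "count_list (i # l) = (count_list l)(i := Suc (count_list l i))" by auto
    show ?case
    proof (cases "m i")
      case 0
      have "?N = {}"
      proof (rule ccontr)
        assume "?N \<noteq> {}"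
        then obtain Ts where Ts: "Ts \<in> ?N" by blast
        then obtain T Ts' where T: "Ts = T # Ts'" "T \<in> trees d i" "T \<noteq> {}" by (cases Ts) (auto simp: forests_def)
        then have "[i] \<in> {w \<in> T. last w = i}" using tree_nonempty_root by auto
        moreover have "finite T" using T tree_finite by blast
        ultimately have "type_count T i \<noteq> 0" unfolding type_count_def by (metis (no_types, lifting) card_0_eq empty_iff finite_subset mem_Collect_eq subsetI)
        then show False using Ts T 0 i by (auto simp: forests_def)
      qed
      then have "forests d (i # l) m = ?E" by blast
      moreover have "finite F \<and> real (card F) = forest_number d (count_list (i # l)) m" if "F = ?E" for F
        unfolding that cl forest_number_leaf[where m = m and a = "count_list l", OF i 0] using E by blast
      ultimately show ?thesis by blast
    next
      case (Suc k)
      have lt: "sum (m(i := k)) {..d} < sum m {..d}"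
      proof (rule sum_strict_mono_ex1)
        show "\<exists>a\<in>{..d}. (m(i := k)) a < m a" using i Suc by (intro bexI[of _ i]) auto
      qed (use Suc in auto)
      have "set (children d i @ l) \<subseteq> {..d}" using Cons.prems by (auto simp: set_children)
      from IH[OF lt this] have *: "finite (forests d (children d i @ l) (m(i := k)))"
        "real (card (forests d (children d i @ l) (m(i := k)))) = forest_number d (count_list (children d i @ l)) (m(i := k))"
        by auto
      have "forest_number d (count_list (children d i @ l)) (m(i := k)) =
            forest_number d (\<lambda>j. if j = i then count_list l i else Suc (count_list l j)) (m(i := k))"
      proof -
        have "count_list (children d i @ l) j = (if j = i then count_list l i else Suc (count_list l j))" if "j \<le> d" for j
          using that distinct_children[of d i] set_children[of d i]
          by (auto simp: count_list_distinct)
        then show ?thesis unfolding forest_number_def Let_def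
          by (intro arg_cong2[of _ _ _ _ "(*)"] arg_cong2[of _ _ _ _ "(-)"] prod.cong sum.cong) auto
      qed
      then have N: "finite ?N" "real (card ?N) = forest_number d (\<lambda>j. if j = i then count_list l i else Suc (count_list l j)) (m(i := k))"
        using bij_betw_finite[OF forests_Cons_nonempty_bij[where l = l and m = m, OF i Suc]] *
          bij_betw_same_card[OF forests_Cons_nonempty_bij[where l = l and m = m, OF i Suc]] by simp_all
      have "card (forests d (i # l) m) = card ?E + card ?N"
        by (subst split(1)) (intro card_Un_disjoint E N split)
      moreover have "finite (forests d (i # l) m)" by (subst split(1)) (simp only: finite_Un E N)
      ultimately show ?thesis
        unfolding cl forest_number_node[where m = m and a = "count_list l", OF i Suc] E(2)[symmetric] N(2)[symmetric]
        by (simp only: of_nat_add)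
    qed
  qed
qed

lemma card_trees:
  assumes "i \<le> d"
  shows "finite {T \<in> trees d i. \<forall>k\<le>d. type_count T k = m k}"
    and "real (card {T \<in> trees d i. \<forall>k\<le>d. type_count T k = m k}) = forest_number d (count_list [i]) m"
proof -
  have "forests d [i] m = (\<lambda>T. [T]) ` {T \<in> trees d i. \<forall>k\<le>d. type_count T k = m k}"
    unfolding forests_def list_all2_Cons2 by force
  moreover have "inj (\<lambda>T::nat list set. [T])" by (simp add: inj_on_def)
  ultimately show "finite {T \<in> trees d i. \<forall>k\<le>d. type_count T k = m k}"
    and "real (card {T \<in> trees d i. \<forall>k\<le>d. type_count T k = m k}) = forest_number d (count_list [i]) m"
    using card_forests[of "[i]" d m] assms
    by (auto simp: finite_image_iff card_image inj_on_subset)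
qed

section \<open>Closed form for a single tree with root of type 0\<close>

lemma gbin_eq:
  assumes "x \<noteq> 0" "x \<noteq> real k"
  shows "gbin x k = x / (x - real k) * (x - real k gchoose k)"
  using gbin_mult[of x k] assms by (simp add: field_simps)

text \<open>Here a_0 = 1 and the other a_j are 0, and the Jacobian factor collapses: 1 - m_0 / (n +
  1) - (n - m_0) / n = m_0 / (n * (n + 1)).\<close>

lemma forest_number_root:
  assumes n: "n = sum m {..d}" "n > 0"
  shows "forest_number d (count_list [0]) m =
    real (m 0) / (real n * (real n + 1)) * gbin (real n + 1) (m 0) * (\<Prod>j=1..d. gbin (real n) (m j))"
proof -
  have s: "{..d} - {0} = {1..d}" by auto
  have "(\<Prod>j\<in>{1..d}. gbin (real (count_list [0] j + n)) (m j)) = (\<Prod>j=1..d. gbin (real n) (m j))"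
    by (rule prod.cong) auto
  moreover have "(\<Sum>j=1..d. real (m j) / real (count_list [0] j + n)) = (\<Sum>j=1..d. real (m j)) / real n"
    unfolding sum_divide_distrib by (rule sum.cong) auto
  moreover have "(\<Sum>j=1..d. real (m j)) = real n - real (m 0)"
    using n sum.remove[of "{..d}" 0 m] unfolding s by simp
  moreover have "real (count_list [0] 0 + n) = real n + 1" by simp
  ultimately have "forest_number d (count_list [0]) m = (\<Prod>j=1..d. gbin (real n) (m j)) *
     (gbin (real n + 1) (m 0) * (1 - real (m 0) / (real n + 1)) -
      gbin (real n + 1) (m 0) * ((real n - real (m 0)) / real n))"
    unfolding forest_number_split[OF le0] n(1)[symmetric] s by (simp add: add.commute)
  also have "\<dots> = (\<Prod>j=1..d. gbin (real n) (m j)) * (gbin (real n + 1) (m 0) *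
      ((1 - real (m 0) / (real n + 1)) - (real n - real (m 0)) / real n))"
    by (simp add: algebra_simps)
  also have "(1 - real (m 0) / (real n + 1)) - (real n - real (m 0)) / real n = real (m 0) / (real n * (real n + 1))"
    using n(2) by (simp add: field_simps)
  finally show ?thesis by (simp add: mult_ac del: count_list.simps)
qed

section \<open>The complex of a tree of words\<close>

text \<open>
  A word of a tree stands for a facet of the complex, its last letter being the colour of the
  vertex that this facet adds to its parent. This vertex is named by the word itself, and the
  vertex of colour \<open>i \<ge> 1\<close> of the root by \<open>[i]\<close>, which is not a word of the tree because those
  start with the letter 0. Thus \<open>node w i\<close> is the vertex of colour \<open>i\<close> of the facet \<open>w\<close>.
\<close>

definition node :: "nat list \<Rightarrow> nat \<Rightarrow> nat list" where
  "node w i = (if i \<in> set w then rev (dropWhile (\<lambda>x. x \<noteq> i) (rev w)) else [i])"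

lemma node_Nil [simp]: "node [] i = [i]"
  by (simp add: node_def)

lemma node_snoc: "node (w @ [j]) i = (if i = j then w @ [j] else node w i)"
  by (simp add: node_def)

lemma node_last: "w \<noteq> [] \<Longrightarrow> node w (last w) = w"
  by (cases w rule: rev_cases) (auto simp: node_snoc)

lemma last_node [simp]: "last (node w i) = i"
  by (induction w rule: rev_induct) (auto simp: node_snoc)

lemma node_neq_Nil [simp]: "node w i \<noteq> []"
  by (induction w rule: rev_induct) (auto simp: node_snoc)

lemma node_not_in_set: "i \<notin> set w \<Longrightarrow> node w i = [i]"
  by (simp add: node_def)

lemma node_prefix: "i \<in> set w \<Longrightarrow> \<exists>x. w = node w i @ x"
proof (induction w rule: rev_induct)
  case (snoc x xs)
  then show ?case by (auto simp: node_snoc) (metis append_assoc)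
qed simp

section \<open>Simplices spanned by words\<close>

definition word_simplex :: "nat \<Rightarrow> nat list \<Rightarrow> nat set" where
  "word_simplex d w = (\<lambda>i. to_nat (node w i)) ` {..d}"

definition root_list :: "nat \<Rightarrow> nat list" where
  "root_list d = map (\<lambda>i. to_nat [i]) [1..<Suc d]"

text \<open>The faces of the root are listed separately so that the empty tree yields the complex of
  index 0.\<close>

definition tree_complex :: "nat \<Rightarrow> nat list set \<Rightarrow> nat set set" where
  "tree_complex d T = {\<sigma>. \<sigma> \<noteq> {} \<and> (\<sigma> \<subseteq> set (root_list d) \<or> (\<exists>w\<in>T. \<sigma> \<subseteq> word_simplex d w))}"

lemma set_root_list: "set (root_list d) = (\<lambda>i. to_nat [i]) ` {1..d}"
  by (auto simp: root_list_def)

lemma root_list_nth: "i < d \<Longrightarrow> root_list d ! i = to_nat [Suc i]"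
  by (simp add: root_list_def del: upt_Suc)

lemma length_root_list [simp]: "length (root_list d) = d"
  by (simp add: root_list_def)

lemma distinct_root_list [simp]: "distinct (root_list d)"
  by (simp add: root_list_def distinct_map inj_on_def)

lemma root_labelling:
  assumes "distinct r" "length r = d"
  shows "\<exists>g. map g r = root_list d"
proof
  show "map (\<lambda>x. the (map_of (zip r (root_list d)) x)) r = root_list d"
    using assms by (intro nth_equalityI) (auto simp: map_of_zip_nth)
qed

lemma card_word_simplex [simp]: "card (word_simplex d w) = Suc d"
proof -
  have "inj_on (\<lambda>i. to_nat (node w i)) {..d}"
    by (rule inj_onI) (metis last_node to_nat_split)
  then show ?thesis by (simp add: word_simplex_def card_image)
qed

lemma finite_word_simplex [simp]: "finite (word_simplex d w)"
  by (simp add: word_simplex_def)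

lemma node_in_word_simplex:
  "to_nat (node w i) \<in> word_simplex d w' \<longleftrightarrow> i \<le> d \<and> node w' i = node w i"
proof
  assume "to_nat (node w i) \<in> word_simplex d w'"
  then obtain k where "k \<le> d" "node w i = node w' k" by (auto simp: word_simplex_def)
  then show "i \<le> d \<and> node w' i = node w i" by (metis last_node)
qed (auto simp: word_simplex_def image_iff intro!: bexI[of _ i])

lemma word_simplex_snoc:
  assumes "j \<le> d"
  shows "word_simplex d (w @ [j]) = insert (to_nat (w @ [j])) (word_simplex d w - {to_nat (node w j)})"
proof -
  have "{..d} = insert j ({..d} - {j})" using assms by auto
  then have "word_simplex d (w @ [j]) =
      insert (to_nat (w @ [j])) ((\<lambda>i. to_nat (node w i)) ` ({..d} - {j}))"
    unfolding word_simplex_def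
    by (metis (no_types, lifting) Diff_iff image_cong image_insert insertI1 node_snoc)
  also have "(\<lambda>i. to_nat (node w i)) ` ({..d} - {j}) = word_simplex d w - {to_nat (node w j)}"
    unfolding word_simplex_def by (auto simp: image_iff) (metis last_node)
  finally show ?thesis .
qed

text \<open>The vertex added last by w has a colour other than j, so it also belongs to w', and this
  makes w a prefix of w'. If w' does not end in j, the roles can be exchanged and the words are
  equal; if it does, the argument applies to w' without its last letter.\<close>

lemma node_agree:
  assumes w: "w \<noteq> []" "hd w = 0" "last w \<noteq> j" "set w \<subseteq> {..d}"
    and w': "w' \<noteq> []" "hd w' = 0" "distinct_adj w'" "set w' \<subseteq> {..d}"
    and agree: "\<And>i. i \<le> d \<Longrightarrow> i \<noteq> j \<Longrightarrow> node w' i = node w i"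
  shows "w' = w \<or> w' = w @ [j]"
proof -
  have l: "last w \<le> d" using w last_in_set by fastforce
  have 0: "0 \<in> set v" if "v \<noteq> []" "hd v = 0" for v :: "nat list" using that hd_in_set by metis
  \<comment> \<open>Mutual prefixes. The exceptional case, where the last letter of one word does
    not occur in the other, would make the first word [0], but every word here contains the letter
    0.\<close>
  have A: "v = w"
    if v: "v \<noteq> []" "hd v = 0" "last v \<noteq> j" "set v \<subseteq> {..d}"
      and ag: "\<And>i. i \<le> d \<Longrightarrow> i \<noteq> j \<Longrightarrow> node v i = node w i" for v
  proof -
    have lv: "last v \<le> d" using v last_in_set by fastforce
    have 1: "node v (last w) = w" using ag[OF l w(3)] node_last w by simp
    have 2: "node w (last v) = v" using ag[OF lv v(3)] node_last v by simp
    have "\<exists>x. v = w @ x"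
    proof (cases "last w \<in> set v")
      case True
      then show ?thesis using node_prefix 1 by metis
    next
      case False
      then have "w = [last w]" using 1 node_not_in_set by metis
      then have "last w = 0" using w(2) by (metis list.sel(1))
      then show ?thesis using False 0 v by auto
    qed
    moreover have "\<exists>x. w = v @ x"
    proof (cases "last v \<in> set w")
      case True
      then show ?thesis using node_prefix 2 by metis
    next
      case False
      then have "v = [last v]" using 2 node_not_in_set by metis
      then have "last v = 0" using v(2) by (metis list.sel(1))
      then show ?thesis using False 0 w by auto
    qed
    ultimately show ?thesis by (metis append.right_neutral append_eq_append_conv2 append_self_conv same_append_eq append_assoc append_is_Nil_conv)
  qed
  show ?thesis
  proof (cases "last w' = j")
    case True
    then obtain y where y: "w' = y @ [j]" using w'(1) by (metis append_butlast_last_id)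
    show ?thesis
    proof (cases "y = []")
      case True
      then have "j = 0" using y w' by simp
      have "node w' (last w) = w" using agree[OF l w(3)] node_last w by simp
      then have "w = [last w]" using True y w(3) node_snoc[of "[]" j] by simp
      then show ?thesis using w(2,3) \<open>j = 0\<close> by (metis list.sel(1))
    next
      case False
      have "y = w"
      proof (rule A)
        show "y \<noteq> []" by fact
        show "hd y = 0" using w'(2) y False by simp
        show "last y \<noteq> j" using w'(3) y False by (simp add: distinct_adj_append_iff)
        show "set y \<subseteq> {..d}" using w' y by simp
        show "node y i = node w i" if "i \<le> d" "i \<noteq> j" for i
          using agree[OF that] that y by (simp add: node_snoc)
      qed
      then show ?thesis using y by simp
    qed
  next
    case False
    then show ?thesis using A[of w'] w' agree by blast
  qed
qed

section \<open>Facets, vertices and the colouring of the complex of one tree\<close>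

definition colouring_from_root :: "nat \<Rightarrow> 'v set set \<times> 'v list \<Rightarrow> ('v \<Rightarrow> nat) \<Rightarrow> bool" where
  "colouring_from_root d P c \<longleftrightarrow>
     proper_colouring (fst P) {0..d} c \<and> (\<forall>i\<in>{1..d}. c (snd P ! (i - 1)) = i)"

definition word_colour :: "nat \<Rightarrow> nat" where
  "word_colour v = last (from_nat v :: nat list)"

lemma word_colour_to_nat [simp]: "word_colour (to_nat w) = last w"
  by (simp add: word_colour_def)

context
  fixes d :: nat and T :: "nat list set"
  assumes T: "T \<in> trees d 0"
begin

lemma wordD: "w \<in> T \<Longrightarrow> w \<noteq> []" "w \<in> T \<Longrightarrow> hd w = 0" "w \<in> T \<Longrightarrow> distinct_adj w"
  "w \<in> T \<Longrightarrow> set w \<subseteq> {..d}" "w \<in> T \<Longrightarrow> last w \<le> d"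
  using tree_word[OF T] last_in_set by blast+

lemma prefix_in_tree: "w @ x \<in> T \<Longrightarrow> w \<noteq> [] \<Longrightarrow> w \<in> T"
proof (induction x rule: rev_induct)
  case (snoc a x)
  then have "(w @ x) @ [a] \<in> T" by simp
  then show ?case using tree_prefix[OF T] snoc by blast
qed simp

lemma node_in_tree:
  assumes "w \<in> T \<or> w = []" "i \<le> d" "i \<noteq> 0 \<or> w \<noteq> []"
  shows "node w i \<in> T \<or> (node w i = [i] \<and> i \<noteq> 0)"
proof (cases "i \<in> set w")
  case True
  then have "w \<in> T" using assms by auto
  then show ?thesis using node_prefix[OF True] prefix_in_tree by (metis node_neq_Nil)
next
  case False
  moreover have "i \<noteq> 0" using assms False wordD by (metis hd_in_set)
  ultimately show ?thesis by (simp add: node_not_in_set)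
qed

text \<open>Geometric form of \<open>node_agree\<close>: a ridge of w other than the one opposite to
  its newest vertex can be shared only with a child of w.\<close>

lemma facet_words:
  assumes "w \<in> T" "v \<in> T" "j \<le> d" "j \<noteq> last w"
    and sub: "word_simplex d w - {to_nat (node w j)} \<subseteq> word_simplex d v"
  shows "v = w \<or> v = w @ [j]"
proof (rule node_agree)
  show "node v i = node w i" if "i \<le> d" "i \<noteq> j" for i
  proof -
    have "to_nat (node w i) \<in> word_simplex d w - {to_nat (node w j)}"
      using that node_in_word_simplex by simp (metis last_node)
    then show ?thesis using sub node_in_word_simplex by blast
  qed
qed (use assms wordD in auto)

text \<open>A letter i \<ge> 1 in v would replace the root vertex [i] by a word starting with 0. So
  v has only zeros, and distinctness of adjacent letters leaves a single one.\<close>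

lemma root_words:
  assumes "v \<in> T" "set (root_list d) \<subseteq> word_simplex d v"
  shows "v = [0]"
proof -
  have "i \<notin> set v" if i: "1 \<le> i" "i \<le> d" for i
  proof
    assume "i \<in> set v"
    have "to_nat (node [] i) \<in> word_simplex d v" using assms i by (auto simp: set_root_list)
    then have "node v i = [i]" using node_in_word_simplex by (metis node_Nil)
    then have "hd v = i" using node_prefix[OF \<open>i \<in> set v\<close>] by (metis append_Cons list.sel(1))
    then show False using wordD[OF assms(1)] i by simp
  qed
  then have s: "set v \<subseteq> {0}"
    using wordD(4)[OF assms(1)] by (metis One_nat_def Suc_leI atMost_iff insertI1 neq0_conv subsetD subsetI)
  obtain y where y: "v = 0 # y" using wordD[OF assms(1)] by (cases v) auto
  then have "y = []" using s wordD(3)[OF assms(1)] by (cases y) auto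
  then show ?thesis using y by simp
qed

text \<open>The vertex added last by either facet lies in the other one, so each word is a prefix of
  the other.\<close>

lemma word_simplex_inj:
  assumes "v \<in> T" "w \<in> T" "word_simplex d v = word_simplex d w"
  shows "v = w"
proof -
  have A: "\<exists>x. w = v @ x" if vw: "v \<in> T" "w \<in> T" "word_simplex d v = word_simplex d w" for v w
  proof -
    have "to_nat (node v (last v)) \<in> word_simplex d w"
      using vw wordD(5)[OF vw(1)] node_in_word_simplex by blast
    then have 1: "node w (last v) = v" using node_in_word_simplex node_last wordD vw by metis
    show ?thesis
    proof (cases "last v \<in> set w")
      case True
      then show ?thesis using node_prefix 1 by metis
    next
      case False
      then have "v = [last v]" using 1 node_not_in_set by metis
      then have "last v = 0" using wordD(2)[OF vw(1)] by (metis list.sel(1))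
      then show ?thesis using False wordD[OF vw(2)] hd_in_set by metis
    qed
  qed
  obtain x where x: "w = v @ x" using A[OF assms] by blast
  obtain x' where "v = w @ x'" using A[OF assms(2,1)] assms(3) by auto
  then show ?thesis using x by simp
qed

lemma word_in_simplex:
  assumes "w \<in> T" "v \<in> T" "to_nat w \<in> word_simplex d v"
  shows "\<exists>x. v = w @ x"
proof -
  have 1: "node v (last w) = w" using node_in_word_simplex node_last wordD(1) assms by metis
  show ?thesis
  proof (cases "last w \<in> set v")
    case True
    then show ?thesis using node_prefix 1 by metis
  next
    case False
    then have "w = [last w]" using 1 node_not_in_set by metis
    then have "last w = 0" using wordD(2)[OF assms(1)] by (metis list.sel(1))
    then show ?thesis using False wordD[OF assms(2)] hd_in_set by metis
  qed
qed

lemma root_subset_simplex: "set (root_list d) \<subseteq> word_simplex d [0]"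
  by (auto simp: set_root_list word_simplex_def node_def)

lemma finite_tree_complex: "finite (tree_complex d T)"
proof -
  have "tree_complex d T \<subseteq> Pow (set (root_list d) \<union> (\<Union>w\<in>T. word_simplex d w))"
    by (auto simp: tree_complex_def)
  moreover have "finite (Pow (set (root_list d) \<union> (\<Union>w\<in>T. word_simplex d w)))"
    using tree_finite[OF T] by simp
  ultimately show ?thesis by (rule finite_subset)
qed

lemma abstract_tree_complex: "abstract_complex (tree_complex d T)"
  unfolding abstract_complex_def
proof (intro conjI ballI allI impI finite_tree_complex)
  fix \<sigma> assume "\<sigma> \<in> tree_complex d T"
  then show "finite \<sigma>" "\<sigma> \<noteq> {}"
    unfolding tree_complex_def using finite_subset finite_word_simplex by blast+
  fix \<tau> assume "\<tau> \<subseteq> \<sigma>" "\<tau> \<noteq> {}"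
  then show "\<tau> \<in> tree_complex d T" using \<open>\<sigma> \<in> tree_complex d T\<close> by (auto simp: tree_complex_def) 
qed

lemma tree_complex_facets: "{\<sigma> \<in> tree_complex d T. card \<sigma> = d + 1} = word_simplex d ` T"
proof (intro equalityI subsetI)
  fix \<sigma> assume "\<sigma> \<in> {\<sigma> \<in> tree_complex d T. card \<sigma> = d + 1}"
  then have s: "\<sigma> \<in> tree_complex d T" "card \<sigma> = Suc d" by auto
  have "card (set (root_list d)) = d" by (simp add: distinct_card)
  then have "\<not> \<sigma> \<subseteq> set (root_list d)" using s card_mono[of "set (root_list d)" \<sigma>] by auto
  then obtain w where w: "w \<in> T" "\<sigma> \<subseteq> word_simplex d w" using s by (auto simp: tree_complex_def)
  then have "\<sigma> = word_simplex d w" using s by (intro card_subset_eq) auto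
  then show "\<sigma> \<in> word_simplex d ` T" using w by auto
next
  fix \<sigma> assume "\<sigma> \<in> word_simplex d ` T"
  then obtain w where w: "w \<in> T" "\<sigma> = word_simplex d w" by blast
  then have "card \<sigma> = d + 1" by simp
  moreover from this have "\<sigma> \<noteq> {}" by force
  ultimately show "\<sigma> \<in> {\<sigma> \<in> tree_complex d T. card \<sigma> = d + 1}"
    unfolding tree_complex_def using w by blast
qed

lemma card_tree_complex_facets: "card {\<sigma> \<in> tree_complex d T. card \<sigma> = d + 1} = card T"
  unfolding tree_complex_facets by (rule card_image) (auto intro!: inj_onI word_simplex_inj)

lemma tree_complex_nonempty_eq:
  assumes "T \<noteq> {}"
  shows "tree_complex d T = {\<sigma>. \<sigma> \<noteq> {} \<and> (\<exists>w\<in>T. \<sigma> \<subseteq> word_simplex d w)}"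
  using tree_nonempty_root[OF T assms] root_subset_simplex unfolding tree_complex_def by blast

lemma vertices_tree_complex:
  "vertices (tree_complex d T) = to_nat ` (T \<union> (\<lambda>i. [i]) ` {1..d})"
proof (intro equalityI subsetI)
  fix v assume "v \<in> vertices (tree_complex d T)"
  then consider "v \<in> set (root_list d)" | w where "w \<in> T" "v \<in> word_simplex d w"
    by (auto simp: vertices_def tree_complex_def)
  then show "v \<in> to_nat ` (T \<union> (\<lambda>i. [i]) ` {1..d})"
  proof cases
    case 2
    then obtain i where i: "i \<le> d" "v = to_nat (node w i)" by (auto simp: word_simplex_def)
    then show ?thesis using node_in_tree[of w i] 2 wordD(1)[of w] by force
  qed (auto simp: set_root_list)
next
  fix v assume "v \<in> to_nat ` (T \<union> (\<lambda>i. [i]) ` {1..d})"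
  then consider w where "w \<in> T" "v = to_nat w" | i where "1 \<le> i" "i \<le> d" "v = to_nat [i]" by auto
  then show "v \<in> vertices (tree_complex d T)"
  proof cases
    case 1
    then have "v \<in> word_simplex d w"
      using node_in_word_simplex[of w "last w" d w] wordD by (simp add: node_last)
    then show ?thesis using 1 unfolding vertices_def tree_complex_def by auto
  next
    case 2
    then have "v \<in> set (root_list d)" by (auto simp: set_root_list)
    then show ?thesis unfolding vertices_def tree_complex_def by auto
  qed
qed


text \<open>Each added vertex spans a simplex with vertices that already carry the d other colours,
  so properness leaves one colour for it. The induction along the word starts at the root, whose
  colours are prescribed.\<close>

lemma colour_of_node:
  assumes c: "colouring_from_root d (tree_complex d T, root_list d) c"
  shows "w \<in> T \<or> w = [] \<Longrightarrow> i \<le> d \<Longrightarrow> i \<noteq> 0 \<or> w \<noteq> [] \<Longrightarrow> c (to_nat (node w i)) = i"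
proof (induction w arbitrary: i rule: rev_induct)
  case Nil
  then have "c (root_list d ! (i - 1)) = i" using c unfolding colouring_from_root_def by auto
  then show ?case using Nil by (simp add: root_list_nth)
next
  case (snoc j y)
  have w: "y @ [j] \<in> T" using snoc.prems by auto
  have "y \<in> T \<or> y = []" using prefix_in_tree[OF w] by blast
  note IH = snoc.IH[OF this]
  have j: "j \<le> d" using wordD(5)[OF w] by simp
  have j0: "y = [] \<Longrightarrow> j = 0" using wordD(2)[OF w] by simp
  have other: "c (to_nat (node (y @ [j]) k)) = k" if "k \<le> d" "k \<noteq> j" for k
    using IH[OF that(1)] that j0 by (auto simp: node_snoc)
  have ws: "{to_nat (node (y @ [j]) j), to_nat (node (y @ [j]) k)} \<in> tree_complex d T" if "k \<le> d" for k
    using w that j unfolding tree_complex_def word_simplex_def by blast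
  have col: "c (to_nat (node (y @ [j]) j)) = j"
  proof -
    let ?v = "to_nat (node (y @ [j]) j)"
    have "?v \<in> vertices (tree_complex d T)" using ws[OF j] unfolding vertices_def by blast
    then have "c ?v \<le> d" using c unfolding colouring_from_root_def proper_colouring_def by (auto simp: PiE_def Pi_def)
    moreover have "c ?v \<noteq> k" if "k \<le> d" "k \<noteq> j" for k
    proof -
      have "?v \<noteq> to_nat (node (y @ [j]) k)" using that by (metis last_node to_nat_split)
      then have "c ?v \<noteq> c (to_nat (node (y @ [j]) k))"
        using ws[OF that(1)] c unfolding colouring_from_root_def proper_colouring_def fst_conv by blast
      then show ?thesis using other[OF that] by simp
    qed
    ultimately show ?thesis by blast
  qed
  then show ?case using other snoc.prems by (cases "i = j") auto
qed

lemma tree_colouring: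
  "colouring_from_root d (tree_complex d T, root_list d) c \<longleftrightarrow>
     c = restrict word_colour (vertices (tree_complex d T))" (is "?L \<longleftrightarrow> ?R")
proof
  assume c: ?L
  have cv: "c v = word_colour v" if "v \<in> vertices (tree_complex d T)" for v
  proof -
    from that consider w where "w \<in> T" "v = to_nat w" | i where "1 \<le> i" "i \<le> d" "v = to_nat [i]"
      unfolding vertices_tree_complex by auto
    then show ?thesis
    proof cases
      case 1
      then show ?thesis using colour_of_node[OF c, of w "last w"] wordD[of w] by (auto simp: node_last)
    next
      case 2
      then show ?thesis using colour_of_node[OF c, of "[]" i] by auto
    qed
  qed
  show ?R
  proof (rule ext)
    fix v show "c v = restrict word_colour (vertices (tree_complex d T)) v"
      using c cv by (cases "v \<in> vertices (tree_complex d T)")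
        (auto simp: colouring_from_root_def proper_colouring_def PiE_def extensional_def)
  qed
next
  let ?c = "restrict word_colour (vertices (tree_complex d T))"
  assume c: ?R
  have 1: "?c \<in> vertices (tree_complex d T) \<rightarrow>\<^sub>E {0..d}"
    using wordD(5) unfolding vertices_tree_complex by auto
  have 2: "?c u \<noteq> ?c v" if uv: "{u, v} \<in> tree_complex d T" "u \<noteq> v" for u v
  proof -
    have V: "u \<in> vertices (tree_complex d T)" "v \<in> vertices (tree_complex d T)"
      using uv unfolding vertices_def by auto
    from uv consider "{u, v} \<subseteq> set (root_list d)" | w where "w \<in> T" "{u, v} \<subseteq> word_simplex d w"
      by (auto simp: tree_complex_def)
    then have "word_colour u \<noteq> word_colour v"
    proof cases
      case 1
      then show ?thesis using uv(2) by (auto simp: set_root_list)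
    next
      case 2
      then show ?thesis using uv(2) by (auto simp: word_simplex_def)
    qed
    then show ?thesis using V by simp
  qed
  have 3: "?c (root_list d ! (i - 1)) = i" if "i \<in> {1..d}" for i
  proof -
    have "root_list d ! (i - 1) \<in> vertices (tree_complex d T)"
      using that unfolding vertices_tree_complex by (auto simp: root_list_nth)
    then show ?thesis using that by (auto simp: root_list_nth)
  qed
  show ?L
    unfolding c colouring_from_root_def proper_colouring_def using 1 2 3 by simp
qed

text \<open>The root provides one vertex of each colour except 0; every other vertex is added by
  exactly one word, whose last letter is its colour.\<close>

lemma colour_count_tree_complex:
  assumes "i \<le> d"
  shows "card {v \<in> vertices (tree_complex d T). word_colour v = i} = type_count T i + (if i = 0 then 0 else 1)"
proof -
  have "{v \<in> vertices (tree_complex d T). word_colour v = i} =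
     to_nat ` ({w \<in> T. last w = i} \<union> (if i = 0 then {} else {[i]}))"
    unfolding vertices_tree_complex using assms by auto
  then have "card {v \<in> vertices (tree_complex d T). word_colour v = i} =
     card ({w \<in> T. last w = i} \<union> (if i = 0 then {} else {[i]}))"
    by (simp add: card_image)
  also have "\<dots> = type_count T i + (if i = 0 then 0 else 1)"
  proof (cases "i = 0")
    case False
    then have "[i] \<notin> {w \<in> T. last w = i}" using wordD(2)[of "[i]"] by auto
    then show ?thesis using False tree_finite[OF T] by (simp add: type_count_def)
  qed (simp add: type_count_def)
  finally show ?thesis .
qed

end

section \<open>Rooted isomorphisms and the transport of colourings\<close>

lemma rooted_iso_refl: "rooted_iso P P"
  unfolding rooted_iso_def by (cases P) (auto intro!: exI[of _ id])

lemma rooted_iso_trans: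
  assumes "rooted_iso P Q" "rooted_iso Q R"
  shows "rooted_iso P R"
proof -
  obtain K r L q M p where P: "P = (K, r)" "Q = (L, q)" "R = (M, p)" by (metis prod.exhaust)
  then obtain f g where f: "bij_betw f (vertices K) (vertices L)" "(\<lambda>\<sigma>. f ` \<sigma>) ` K = L" "map f r = q"
    and g: "bij_betw g (vertices L) (vertices M)" "(\<lambda>\<sigma>. g ` \<sigma>) ` L = M" "map g q = p"
    using assms unfolding rooted_iso_def by auto
  have "bij_betw (g \<circ> f) (vertices K) (vertices M)" using f g bij_betw_trans by blast
  moreover have "(\<lambda>\<sigma>. (g \<circ> f) ` \<sigma>) ` K = M" unfolding f(2)[symmetric] g(2)[symmetric] by (auto simp: image_comp)
  moreover have "map (g \<circ> f) r = p" using f g by auto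
  ultimately show ?thesis unfolding rooted_iso_def P by blast
qed

lemma rooted_iso_inverse:
  assumes f: "bij_betw f (vertices K) (vertices L)" "(\<lambda>\<sigma>. f ` \<sigma>) ` K = L" "map f r = q"
    and r: "set r \<subseteq> vertices K"
  obtains g where "bij_betw g (vertices L) (vertices K)" "(\<lambda>\<sigma>. g ` \<sigma>) ` L = K" "map g q = r"
    "\<forall>v\<in>vertices K. g (f v) = v"
proof
  let ?g = "inv_into (vertices K) f"
  have gf: "?g (f v) = v" if "v \<in> vertices K" for v
    using that f(1) by (simp add: bij_betw_inv_into_left)
  then show "\<forall>v\<in>vertices K. ?g (f v) = v" by blast
  show "bij_betw ?g (vertices L) (vertices K)" using f(1) by (rule bij_betw_inv_into)
  have "?g ` f ` \<sigma> = \<sigma>" if "\<sigma> \<in> K" for \<sigma>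
  proof -
    have "\<sigma> \<subseteq> vertices K" using that by (auto simp: vertices_def)
    then show ?thesis using gf by force
  qed
  then show "(\<lambda>\<sigma>. ?g ` \<sigma>) ` L = K" unfolding f(2)[symmetric] image_image[of "\<lambda>\<sigma>. ?g ` \<sigma>"] by simp
  show "map ?g q = r" unfolding f(3)[symmetric] using r gf by (auto intro!: map_idI)
qed

text \<open>The map is injective only on vertices, so the inverse recovers the list r only when its
  entries are vertices.\<close>

lemma rooted_iso_sym:
  assumes "rooted_iso (K, r) Q" "set r \<subseteq> vertices K"
  shows "rooted_iso Q (K, r)"
proof -
  obtain L q where Q: "Q = (L, q)" by (cases Q)
  then obtain f where f: "bij_betw f (vertices K) (vertices L)" "(\<lambda>\<sigma>. f ` \<sigma>) ` K = L" "map f r = q"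
    using assms unfolding rooted_iso_def by auto
  obtain g where "bij_betw g (vertices L) (vertices K)" "(\<lambda>\<sigma>. g ` \<sigma>) ` L = K" "map g q = r"
    by (rule rooted_iso_inverse[OF f assms(2)])
  then show ?thesis unfolding rooted_iso_def Q by auto
qed

lemma colouring_from_root_pullback:
  assumes f: "bij_betw f (vertices K) (vertices L)" "(\<lambda>\<sigma>. f ` \<sigma>) ` K = L" "map f r = q"
    and r: "set r \<subseteq> vertices K" "length r = d" and c: "colouring_from_root d (L, q) c"
  shows "colouring_from_root d (K, r) (restrict (c \<circ> f) (vertices K))"
  unfolding colouring_from_root_def proper_colouring_def fst_conv snd_conv
proof (intro conjI allI impI ballI)
  show "restrict (c \<circ> f) (vertices K) \<in> vertices K \<rightarrow>\<^sub>E {0..d}"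
    using c bij_betwE[OF f(1)] unfolding colouring_from_root_def proper_colouring_def by fastforce
next
  fix u v assume uv: "{u, v} \<in> K \<and> u \<noteq> v"
  then have V: "u \<in> vertices K" "v \<in> vertices K" by (auto simp: vertices_def)
  then have "f u \<noteq> f v" using uv f(1) by (metis bij_betw_inv_into_left)
  moreover have "{f u, f v} \<in> L" unfolding f(2)[symmetric] using uv by (auto intro!: image_eqI[of _ _ "{u, v}"])
  ultimately have "c (f u) \<noteq> c (f v)"
    using c unfolding colouring_from_root_def proper_colouring_def fst_conv by blast
  then show "restrict (c \<circ> f) (vertices K) u \<noteq> restrict (c \<circ> f) (vertices K) v" using V by simp
next
  fix i assume i: "i \<in> {1..d}"
  then have "r ! (i - 1) \<in> vertices K" "f (r ! (i - 1)) = q ! (i - 1)"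
    using r f(3) by (auto simp: subset_iff)
  then show "restrict (c \<circ> f) (vertices K) (r ! (i - 1)) = i"
    using c i by (simp add: colouring_from_root_def)
qed

text \<open>Uniqueness travels along the inverse isomorphism: any colouring of the source is carried
  to the unique colouring \<open>c0\<close> of the target. The definite description is therefore the
  pullback of \<open>c0\<close>.\<close>

lemma root_colouring_pullback:
  assumes f: "bij_betw f (vertices K) (vertices L)" "(\<lambda>\<sigma>. f ` \<sigma>) ` K = L" "map f r = q"
    and r: "set r \<subseteq> vertices K" "length r = d"
    and c0: "\<And>c. colouring_from_root d (L, q) c \<longleftrightarrow> c = c0"
  shows "root_colouring d (K, r) = restrict (c0 \<circ> f) (vertices K)"
proof -
  have "root_colouring d (K, r) = (THE c. colouring_from_root d (K, r) c)"
    unfolding root_colouring_def colouring_from_root_def by simp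
  also have "\<dots> = restrict (c0 \<circ> f) (vertices K)"
  proof (rule the_equality)
    show "colouring_from_root d (K, r) (restrict (c0 \<circ> f) (vertices K))"
      using colouring_from_root_pullback[OF f r] c0 by blast
    fix c assume c: "colouring_from_root d (K, r) c"
    obtain g where g: "bij_betw g (vertices L) (vertices K)" "(\<lambda>\<sigma>. g ` \<sigma>) ` L = K" "map g q = r"
        "\<forall>v\<in>vertices K. g (f v) = v"
      by (rule rooted_iso_inverse[OF f r(1)])
    have "set q \<subseteq> vertices L" unfolding f(3)[symmetric] using r(1) bij_betwE[OF f(1)] by auto
    moreover have "length q = d" using f(3) r(2) by auto
    ultimately have "restrict (c \<circ> g) (vertices L) = c0"
      using colouring_from_root_pullback[OF g(1-3)] c c0 by blast
    then have "restrict (c0 \<circ> f) (vertices K) v = c v" if "v \<in> vertices K" for v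
      using that g(4) bij_betwE[OF f(1)] by auto
    moreover have "c \<in> extensional (vertices K)"
      using c unfolding colouring_from_root_def proper_colouring_def by (auto simp: PiE_def)
    ultimately show "c = restrict (c0 \<circ> f) (vertices K)" by (auto simp: extensional_def fun_eq_iff)
  qed
  finally show ?thesis .
qed

lemma colour_count_iso:
  assumes iso: "rooted_iso (K, r) (tree_complex d T, root_list d)" and T: "T \<in> trees d 0"
    and r: "set r \<subseteq> vertices K" and i: "i \<le> d"
  shows "card {v \<in> vertices K. root_colouring d (K, r) v = i} = type_count T i + (if i = 0 then 0 else 1)"
proof -
  obtain f where f: "bij_betw f (vertices K) (vertices (tree_complex d T))"
      "(\<lambda>\<sigma>. f ` \<sigma>) ` K = tree_complex d T" "map f r = root_list d"
    using iso unfolding rooted_iso_def by auto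
  have "length r = d" using f(3) by (metis length_map length_root_list)
  note rc = root_colouring_pullback[OF f r this tree_colouring[OF T]]
  have im: "f ` {v \<in> vertices K. root_colouring d (K, r) v = i} = {v \<in> vertices (tree_complex d T). word_colour v = i}"
    unfolding rc using f(1) by (auto simp: bij_betw_def)
  have "inj_on f {v \<in> vertices K. root_colouring d (K, r) v = i}"
    by (rule inj_on_subset[OF bij_betw_imp_inj_on[OF f(1)]]) blast
  from card_image[OF this] show ?thesis unfolding im colour_count_tree_complex[OF T i] by simp
qed

text \<open>Rigidity: an isomorphism that respects the ordered root fixes every vertex. If the facet
  y is fixed pointwise, the facet y @ [j] goes to a facet on the same ridge, hence to y or y @ [j],
  and injectivity excludes y. Consequently different trees give complexes that are not
  isomorphic.\<close>

lemma tree_iso_subset: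
  assumes T: "T \<in> trees d 0" and T': "T' \<in> trees d 0" and d: "d \<ge> 1"
    and iso: "rooted_iso (tree_complex d T, root_list d) (tree_complex d T', root_list d)"
  shows "T \<subseteq> T'"
proof -
  obtain f where f: "bij_betw f (vertices (tree_complex d T)) (vertices (tree_complex d T'))"
      "(\<lambda>\<sigma>. f ` \<sigma>) ` tree_complex d T = tree_complex d T'" "map f (root_list d) = root_list d"
    using iso unfolding rooted_iso_def by auto
  have root: "f (to_nat [i]) = to_nat [i]" if "1 \<le> i" "i \<le> d" for i
    using f(3) that unfolding root_list_def by auto
  have sub: "word_simplex d w \<subseteq> vertices (tree_complex d T)" if "w \<in> T" for w
    using that tree_complex_facets[OF T] unfolding vertices_def by blast
  have inj: "inj_on f (word_simplex d w)" if "w \<in> T" for w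
    using f(1) sub[OF that] inj_on_subset unfolding bij_betw_def by blast
  have img: "\<exists>v\<in>T'. f ` word_simplex d w = word_simplex d v" if "w \<in> T" for w
  proof -
    have "word_simplex d w \<in> tree_complex d T" using that tree_complex_facets[OF T] by blast
    then have "f ` word_simplex d w \<in> tree_complex d T'" using f(2) by blast
    moreover have "card (f ` word_simplex d w) = d + 1" using card_image[OF inj[OF that]] by simp
    ultimately show ?thesis using tree_complex_facets[OF T'] by blast
  qed
  have fixlast: "f (to_nat (node w j)) = to_nat (node w j)"
    if w: "w \<in> T" "j \<le> d" "f ` word_simplex d w = word_simplex d w"
      "\<And>i. i \<le> d \<Longrightarrow> i \<noteq> j \<Longrightarrow> f (to_nat (node w i)) = to_nat (node w i)" for w j
  proof -
    have "to_nat (node w j) \<in> word_simplex d w" using w(2) node_in_word_simplex by blast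
    then obtain k where k: "k \<le> d" "f (to_nat (node w j)) = to_nat (node w k)"
      using w(3) unfolding word_simplex_def by blast
    show ?thesis
    proof (cases "k = j")
      case False
      then have "f (to_nat (node w j)) = f (to_nat (node w k))" using w(4) k by metis
      moreover have "to_nat (node w k) \<in> word_simplex d w" using k node_in_word_simplex by blast
      ultimately have "to_nat (node w j) = to_nat (node w k)"
        using inj[OF w(1)] \<open>to_nat (node w j) \<in> _\<close> by (metis inj_onD)
      then show ?thesis using k by simp
    qed (use k in simp)
  qed
  have "w \<in> T' \<and> (\<forall>i\<le>d. f (to_nat (node w i)) = to_nat (node w i))" if "w \<in> T" for w
    using that
  proof (induction w rule: rev_induct)
    case Nil
    then show ?case using wordD(1)[OF T] by blast
  next
    case (snoc j y)
    obtain v where v: "v \<in> T'" "f ` word_simplex d (y @ [j]) = word_simplex d v" using img[OF snoc.prems] by blast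
    have j: "j \<le> d" using wordD(5)[OF T snoc.prems] by simp
    have "v = y @ [j] \<and> (\<forall>i\<le>d. i \<noteq> j \<longrightarrow> f (to_nat (node (y @ [j]) i)) = to_nat (node (y @ [j]) i))"
    proof (cases "y = []")
      case True
      then have j0: "j = 0" using wordD(2)[OF T snoc.prems] by simp
      have "f ` set (root_list d) = set (root_list d)" using f(3) by (metis list.set_map)
      then have "set (root_list d) \<subseteq> word_simplex d v"
        using root_subset_simplex[OF T] v(2) True j0 by (metis append_Nil image_mono)
      then have "v = [0]" using root_words[OF T' v(1)] by blast
      moreover have "node [0] i = [i]" for i using node_snoc[of "[]" 0 i] by simp
      ultimately show ?thesis using True j0 root by simp
    next
      case False
      have y: "y \<in> T" using snoc.prems tree_prefix[OF T] False by blast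
      have IH: "y \<in> T'" "f (to_nat (node y i)) = to_nat (node y i)" if "i \<le> d" for i
        using snoc.IH[OF y] that by auto
      have jl: "j \<noteq> last y" using wordD(3)[OF T snoc.prems] False by (auto simp: distinct_adj_append_iff)
      have fy: "f ` word_simplex d y = word_simplex d y"
        unfolding word_simplex_def using IH(2) by (force simp: image_iff)
      have fx: "f x = x" if "x \<in> word_simplex d y" for x using that IH(2) by (auto simp: word_simplex_def)
      have "word_simplex d y - {to_nat (node y j)} \<subseteq> f ` word_simplex d (y @ [j])"
        unfolding word_simplex_snoc[OF j] using fx by (force simp: image_iff)
      then have "v = y \<or> v = y @ [j]" using facet_words[OF T' IH(1)[OF j] v(1) j jl] v(2) by simp
      moreover have "v \<noteq> y"
      proof
        assume "v = y"
        then have "f ` word_simplex d (y @ [j]) = f ` word_simplex d y" using v fy by simp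
        then have "word_simplex d (y @ [j]) = word_simplex d y"
          using inj_on_image_eq_iff[OF bij_betw_imp_inj_on[OF f(1)] sub[OF snoc.prems] sub[OF y]] by blast
        then show False using word_simplex_inj[OF T snoc.prems y] by simp
      qed
      ultimately show ?thesis using IH(2) by (simp add: node_snoc)
    qed
    then show ?case using fixlast[OF snoc.prems j] v by (metis node_snoc)
  qed
  then show ?thesis by blast
qed

section \<open>Complexes with a tree-like dual graph\<close>

definition facets :: "nat \<Rightarrow> 'v set set \<Rightarrow> 'v set set" where
  "facets d K = {\<sigma> \<in> K. card \<sigma> = d + 1}"

text \<open>The predicate P restricts the ridges that may be crossed. It is used for the ridges
  through a given vertex, for those different from a given ridge, and for those met by a given
  subset of the realization.\<close>

definition dual_edges :: "nat \<Rightarrow> 'v set set \<Rightarrow> ('v set \<Rightarrow> bool) \<Rightarrow> ('v set \<times> 'v set) set" where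
  "dual_edges d S P = {(\<sigma>, \<tau>). \<sigma> \<in> S \<and> \<tau> \<in> S \<and> card (\<sigma> \<inter> \<tau>) = d \<and> P (\<sigma> \<inter> \<tau>)}"

lemma insert_point:
  assumes "finite \<sigma>" "F \<subseteq> \<sigma>" "card \<sigma> = Suc (card F)"
  obtains v where "\<sigma> = insert v F" "v \<notin> F"
proof -
  have "card (\<sigma> - F) = 1" using assms by (simp add: card_Diff_subset finite_subset)
  then obtain v where "\<sigma> - F = {v}" by (auto simp: card_1_singleton_iff)
  then show ?thesis using assms(2) by (intro that[of v]) auto
qed

lemma dual_edges_sym: "(\<sigma>, \<tau>) \<in> dual_edges d S P \<Longrightarrow> (\<tau>, \<sigma>) \<in> dual_edges d S P"
  by (auto simp: dual_edges_def Int_commute)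

lemma dual_edges_rtrancl_sym:
  "(\<sigma>, \<tau>) \<in> (dual_edges d S P)\<^sup>* \<Longrightarrow> (\<tau>, \<sigma>) \<in> (dual_edges d S P)\<^sup>*"
  by (meson dual_edges_sym symD symI sym_rtrancl)

lemma dual_edges_mono:
  "(\<And>e. P e \<Longrightarrow> Q e) \<Longrightarrow> (dual_edges d S P)\<^sup>* \<subseteq> (dual_edges d S Q)\<^sup>*"
  by (rule rtrancl_mono) (auto simp: dual_edges_def)

lemma rtrancl_leaves_set:
  "(a, b) \<in> R\<^sup>* \<Longrightarrow> a \<in> S \<Longrightarrow> b \<notin> S \<Longrightarrow> \<exists>x y. (x, y) \<in> R \<and> x \<in> S \<and> y \<notin> S"
  by (induction rule: rtrancl_induct) blast+

lemma image_eq_imageD: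
  assumes "f ` A = g ` B"
  shows "a \<in> A \<Longrightarrow> \<exists>b\<in>B. f a = g b" "b \<in> B \<Longrightarrow> \<exists>a\<in>A. f a = g b"
  using assms by (metis imageE imageI)+

text \<open>Invariant of the exploration: S contains the facets reached so far, T their words, and f
  names the vertices accordingly. The last clause asks for dual paths that stay inside S; such paths
  cannot cross a ridge leading out of S.\<close>

definition labelled :: "nat \<Rightarrow> 'v set set \<Rightarrow> 'v list \<Rightarrow> 'v set set \<Rightarrow> nat list set \<Rightarrow> ('v \<Rightarrow> nat) \<Rightarrow> bool" where
  "labelled d K r S T f \<longleftrightarrow> S \<subseteq> facets d K \<and> T \<in> trees d 0 \<and> inj_on f (\<Union>S) \<and>
     (\<lambda>\<sigma>. f ` \<sigma>) ` S = word_simplex d ` T \<and> map f r = root_list d \<and> (\<exists>\<sigma>\<in>S. set r \<subseteq> \<sigma>) \<and>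
     (\<forall>\<sigma>\<in>S. \<forall>\<tau>\<in>S. (\<sigma>, \<tau>) \<in> (dual_edges d S (\<lambda>_. True))\<^sup>*)"

text \<open>Everything the reconstruction of the tree needs, in combinatorial form; topology enters
  only when these properties are proved for balls. The properties \<open>star_connected\<close> and
  \<open>bridge\<close> together keep the apex of an added facet from being an old vertex.\<close>

locale stacked =
  fixes d :: nat and K :: "'v set set" and r :: "'v list"
  assumes dim_pos: "d \<ge> 1"
    and complex: "abstract_complex K"
    and root_distinct: "distinct r"
    and root_length: "length r = d"
    and root_simplex: "set r \<in> K"
    and pure: "\<rho> \<in> K \<Longrightarrow> \<exists>\<sigma>\<in>facets d K. \<rho> \<subseteq> \<sigma>"
    and two_facets: "\<sigma> \<in> facets d K \<Longrightarrow> \<tau> \<in> facets d K \<Longrightarrow> \<kappa> \<in> facets d K \<Longrightarrow> card e = d \<Longrightarrow>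
        e \<subseteq> \<sigma> \<Longrightarrow> e \<subseteq> \<tau> \<Longrightarrow> e \<subseteq> \<kappa> \<Longrightarrow> \<sigma> = \<tau> \<or> \<sigma> = \<kappa> \<or> \<tau> = \<kappa>"
    and root_facet: "\<sigma> \<in> facets d K \<Longrightarrow> \<tau> \<in> facets d K \<Longrightarrow> set r \<subseteq> \<sigma> \<Longrightarrow> set r \<subseteq> \<tau> \<Longrightarrow> \<sigma> = \<tau>"
    and dual_connected: "\<sigma> \<in> facets d K \<Longrightarrow> \<tau> \<in> facets d K \<Longrightarrow>
        (\<sigma>, \<tau>) \<in> (dual_edges d (facets d K) (\<lambda>_. True))\<^sup>*"
    and star_connected: "\<sigma> \<in> facets d K \<Longrightarrow> \<tau> \<in> facets d K \<Longrightarrow> v \<in> \<sigma> \<Longrightarrow> v \<in> \<tau> \<Longrightarrow>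
        (\<sigma>, \<tau>) \<in> (dual_edges d (facets d K) (\<lambda>e. v \<in> e))\<^sup>*"
    and bridge: "\<sigma> \<in> facets d K \<Longrightarrow> \<tau> \<in> facets d K \<Longrightarrow> card (\<sigma> \<inter> \<tau>) = d \<Longrightarrow>
        (\<sigma>, \<tau>) \<notin> (dual_edges d (facets d K) (\<lambda>e. e \<noteq> \<sigma> \<inter> \<tau>))\<^sup>*"
begin

lemma finite_facet: "\<sigma> \<in> facets d K \<Longrightarrow> finite \<sigma>"
  using complex unfolding abstract_complex_def facets_def by blast

lemma finite_facets: "finite (facets d K)"
  using complex unfolding abstract_complex_def facets_def by simp

lemma card_facet: "\<sigma> \<in> facets d K \<Longrightarrow> card \<sigma> = Suc d"
  unfolding facets_def by simp

lemma facet_minus_point: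
  assumes "\<sigma> \<in> facets d K" "F \<subseteq> \<sigma>" "card F = d"
  obtains v where "\<sigma> = insert v F" "v \<notin> F"
  by (rule insert_point[OF finite_facet[OF assms(1)] assms(2)]) (use card_facet assms in auto)

text \<open>The facet at the root gets the word [0], because the vertex it adds to the root must
  have colour 0.\<close>

lemma labelled_root:
  "\<exists>S T f. labelled d K r S T f"
proof -
  obtain \<sigma> where s: "\<sigma> \<in> facets d K" "set r \<subseteq> \<sigma>" using root_simplex pure by blast
  have "card (set r) = d" using root_distinct root_length by (simp add: distinct_card)
  then obtain v where v: "\<sigma> = insert v (set r)" "v \<notin> set r"
    using facet_minus_point[OF s] by blast
  obtain g where g: "map g r = root_list d" using root_labelling[OF root_distinct root_length] by blast
  then have ginj: "inj_on g (set r)" by (metis distinct_map distinct_root_list)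
  define f where "f = g(v := to_nat [0::nat])"
  have fr: "map f r = root_list d" using v g unfolding f_def by simp
  have f1: "f ` set r = set (root_list d)" using fr by (metis list.set_map)
  have z: "to_nat [0::nat] \<notin> set (root_list d)" by (auto simp: set_root_list)
  have "{..d} = insert 0 {1..d}" by auto
  then have "word_simplex d [0] = insert (to_nat [0::nat]) (set (root_list d))"
    unfolding word_simplex_def set_root_list using node_snoc[of "[]" 0] by simp
  moreover have "f v = to_nat [0::nat]" unfolding f_def by simp
  ultimately have img: "f ` \<sigma> = word_simplex d [0]" using v f1 by simp
  have "inj_on f (set r)" using ginj v unfolding f_def by (auto simp: inj_on_def)
  then have "inj_on f \<sigma>" unfolding v(1) using f1 z \<open>f v = _\<close> v by (simp add: inj_on_insert)
  moreover have "{[0]} \<in> trees d 0" unfolding trees_def by (auto simp: append_eq_Cons_conv)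
  ultimately have "labelled d K r {\<sigma>} {[0]} f"
    unfolding labelled_def using s img fr by auto
  then show ?thesis by blast
qed

text \<open>A dual edge leads out of S from some \<kappa> to some \<sigma>. With w the word of
  \<kappa> and j the colour of its vertex off the common ridge F, the new word is w @ [j]. It is
  admissible because the apex of \<sigma> is new, j differs from the last letter of w, and no facet
  of S has this word.\<close>

lemma labelled_extend:
  assumes lab: "labelled d K r S T f" and ne: "S \<noteq> facets d K"
  shows "\<exists>\<sigma> T' f'. \<sigma> \<in> facets d K - S \<and> labelled d K r (insert \<sigma> S) T' f'"
proof -
  from lab have S: "S \<subseteq> facets d K" and T: "T \<in> trees d 0" and inj: "inj_on f (\<Union>S)"
    and img: "(\<lambda>\<sigma>. f ` \<sigma>) ` S = word_simplex d ` T" and fr: "map f r = root_list d"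
    and root: "\<exists>\<sigma>\<in>S. set r \<subseteq> \<sigma>"
    and con': "\<forall>\<sigma>\<in>S. \<forall>\<tau>\<in>S. (\<sigma>, \<tau>) \<in> (dual_edges d S (\<lambda>_. True))\<^sup>*"
    unfolding labelled_def by - (elim conjE, assumption)+
  have con: "(\<sigma>, \<tau>) \<in> (dual_edges d S (\<lambda>_. True))\<^sup>*" if "\<sigma> \<in> S" "\<tau> \<in> S" for \<sigma> \<tau>
    using con' that by blast
  obtain \<sigma>0 where \<sigma>0: "\<sigma>0 \<in> S" "set r \<subseteq> \<sigma>0" using root by blast
  obtain \<tau>0 where \<tau>0: "\<tau>0 \<in> facets d K" "\<tau>0 \<notin> S" using S ne by blast
  have "\<exists>\<kappa> \<sigma>. (\<kappa>, \<sigma>) \<in> dual_edges d (facets d K) (\<lambda>_. True) \<and> \<kappa> \<in> S \<and> \<sigma> \<notin> S"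
    by (rule rtrancl_leaves_set[OF dual_connected]) (use S \<sigma>0 \<tau>0 in auto)
  then obtain \<kappa> \<sigma> where \<kappa>: "\<kappa> \<in> S" "\<sigma> \<notin> S" "\<sigma> \<in> facets d K" "card (\<kappa> \<inter> \<sigma>) = d"
    unfolding dual_edges_def by auto
  define F where "F = \<kappa> \<inter> \<sigma>"
  have \<kappa>f: "\<kappa> \<in> facets d K" using S \<kappa> by blast
  obtain v where v: "\<sigma> = insert v F" "v \<notin> F"
    using facet_minus_point[OF \<kappa>(3), of F] \<kappa>(4) unfolding F_def by blast
  obtain u where u: "\<kappa> = insert u F" "u \<notin> F"
    using facet_minus_point[OF \<kappa>f, of F] \<kappa>(4) unfolding F_def by blast
  have two: "\<tau> = \<kappa> \<or> \<tau> = \<sigma>" if "\<tau> \<in> facets d K" "F \<subseteq> \<tau>" for \<tau>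
    using two_facets[OF that(1) \<kappa>f \<kappa>(3), of F] that \<kappa> unfolding F_def by auto
  \<comment> \<open>An old apex would give a detour around F: from \<sigma> to \<tau> through ridges
    containing v, all different from F, and then inside S to \<kappa>, where F is not crossed since
    its only facets are \<kappa> and \<sigma>.\<close>
  have vnew: "v \<notin> \<Union>S"
  proof
    assume "v \<in> \<Union>S"
    then obtain \<tau> where \<tau>: "\<tau> \<in> S" "v \<in> \<tau>" by blast
    let ?R = "dual_edges d (facets d K) (\<lambda>e. e \<noteq> \<sigma> \<inter> \<kappa>)"
    have Fc: "\<sigma> \<inter> \<kappa> = F" unfolding F_def by blast
    have "(\<sigma>, \<tau>) \<in> (dual_edges d (facets d K) (\<lambda>e. v \<in> e))\<^sup>*"
      using star_connected[of \<sigma> \<tau> v] \<kappa> \<tau> S v by blast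
    moreover have "dual_edges d (facets d K) (\<lambda>e. v \<in> e) \<subseteq> ?R"
      unfolding dual_edges_def Fc using v by auto
    ultimately have 1: "(\<sigma>, \<tau>) \<in> ?R\<^sup>*" using rtrancl_mono by blast
    have "dual_edges d S (\<lambda>_. True) \<subseteq> ?R"
    proof (rule subrelI)
      fix a b assume ab: "(a, b) \<in> dual_edges d S (\<lambda>_. True)"
      then have ab': "a \<in> S" "b \<in> S" "card (a \<inter> b) = d" by (auto simp: dual_edges_def)
      have "a \<inter> b \<noteq> F"
      proof
        assume eq: "a \<inter> b = F"
        have "a = \<kappa>" "b = \<kappa>" using two[of a] two[of b] ab' eq S \<kappa> by auto
        then show False using ab'(3) card_facet[OF \<kappa>f] by simp
      qed
      then show "(a, b) \<in> ?R" using ab' S unfolding dual_edges_def Fc by auto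
    qed
    then have 2: "(\<tau>, \<kappa>) \<in> ?R\<^sup>*" using con[OF \<tau>(1) \<kappa>(1)] rtrancl_mono by blast
    have "card (\<sigma> \<inter> \<kappa>) = d" using \<kappa>(4) by (simp add: Int_commute)
    then show False using bridge[OF \<kappa>(3) \<kappa>f] 1 2 by (meson rtrancl_trans)
  qed
  obtain w where w: "w \<in> T" "f ` \<kappa> = word_simplex d w" using image_eq_imageD(1)[OF img \<kappa>(1)] by blast
  have \<kappa>S: "\<kappa> \<subseteq> \<Union>S" using \<kappa>(1) by blast
  then have injk: "inj_on f \<kappa>" using inj inj_on_subset by blast
  have "f u \<in> word_simplex d w" using w(2) u by blast
  then obtain j where j: "j \<le> d" "f u = to_nat (node w j)" by (auto simp: word_simplex_def)
  have fF: "f ` F = word_simplex d w - {to_nat (node w j)}"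
    using injk u unfolding w(2)[symmetric] j(2)[symmetric] by (auto simp: inj_on_def)
  \<comment> \<open>Only \<kappa> contains F among the facets of S, and the labelling carries this
    over to words.\<close>
  have same: "y = w" if yT: "y \<in> T" and fy: "f ` F \<subseteq> word_simplex d y" for y
  proof -
    obtain \<tau> where \<tau>: "\<tau> \<in> S" "f ` \<tau> = word_simplex d y" using image_eq_imageD(2)[OF img yT] by blast
    have "F \<subseteq> \<tau>"
    proof
      fix x assume x: "x \<in> F"
      then obtain z where "z \<in> \<tau>" "f x = f z" using fy \<tau>(2) by blast
      then show "x \<in> \<tau>" using inj x u \<tau>(1) \<kappa>(1) by (metis UnionI inj_onD insertI2)
    qed
    then have "\<tau> = \<kappa>" using two[of \<tau>] \<tau> \<kappa> S by blast
    then show ?thesis using \<tau> w word_simplex_inj[OF T yT w(1)] by simp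
  qed
  \<comment> \<open>Otherwise F would be the ridge through which w itself was attached. Then F lies
    in the parent facet, against \<open>same\<close>, or F is the root, which is contained in one
    facet only.\<close>
  have jl: "j \<noteq> last w"
  proof
    assume "j = last w"
    then obtain y where y: "w = y @ [j]" using wordD(1)[OF T w(1)] by (metis append_butlast_last_id)
    have fF': "f ` F \<subseteq> word_simplex d y" unfolding fF y word_simplex_snoc[OF j(1)] by (auto simp: node_snoc)
    show False
    proof (cases "y = []")
      case True
      then have "j = 0" using wordD(2)[OF T w(1)] y by simp
      have "{..d} = insert 0 {1..d}" by auto
      then have "word_simplex d w = insert (to_nat [0::nat]) (set (root_list d))"
        unfolding word_simplex_def set_root_list using node_snoc[of "[]" 0] True y \<open>j = 0\<close> by simp
      moreover have "to_nat (node w j) = to_nat [0::nat]" using True y \<open>j = 0\<close> node_snoc[of "[]" 0] by simp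
      moreover have "to_nat [0::nat] \<notin> set (root_list d)" by (auto simp: set_root_list)
      ultimately have "f ` F = set (root_list d)" unfolding fF by simp
      also have "\<dots> = f ` set r" using fr by (metis list.set_map)
      finally have "F = set r" using inj_on_image_eq_iff[OF inj, of F "set r"] u \<kappa>(1) \<sigma>0 by blast
      then have "\<kappa> = \<sigma>" using root_facet[OF \<kappa>f \<kappa>(3)] u v by blast
      then show False using \<kappa> by blast
    next
      case False
      then have "y \<in> T" using prefix_in_tree[OF T] w(1) y by blast
      then show False using same[OF _ fF'] y by simp
    qed
  qed
  define w' where "w' = w @ [j]"
  have ws': "word_simplex d w' = insert (to_nat w') (f ` F)"
    unfolding w'_def word_simplex_snoc[OF j(1)] fF by simp
  have w'T: "w' \<notin> T"
  proof
    assume "w' \<in> T"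
    then have "w' = w" using same ws' by blast
    then show False unfolding w'_def by simp
  qed
  have T': "insert w' T \<in> trees d 0"
    unfolding trees_def
  proof (intro CollectI conjI ballI allI impI)
    show "finite (insert w' T)" using tree_finite[OF T] by simp
  next
    fix x assume "x \<in> insert w' T"
    then show "x \<noteq> []" "hd x = 0" "distinct_adj x" "set x \<subseteq> {..d}"
      using wordD[OF T, of x] wordD[OF T w(1)] jl j(1)
      unfolding w'_def by (auto simp: distinct_adj_append_iff)
  next
    fix x i assume "x @ [i] \<in> insert w' T \<and> x \<noteq> []"
    then show "x \<in> insert w' T" using tree_prefix[OF T] w(1) unfolding w'_def by auto
  qed
  define f' where "f' = f(v := to_nat w')"
  have f'v: "f' v = to_nat w'" unfolding f'_def by simp
  have f'eq: "f' x = f x" if "x \<in> \<Union>S" for x using that vnew unfolding f'_def by auto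
  have FS: "F \<subseteq> \<Union>S" using u \<kappa>S by blast
  have un: "\<Union>(insert \<sigma> S) = insert v (\<Union>S)" using v FS by auto
  have fresh: "to_nat w' \<notin> f ` \<Union>S"
  proof
    assume "to_nat w' \<in> f ` \<Union>S"
    then obtain \<tau> where "\<tau> \<in> S" "to_nat w' \<in> f ` \<tau>" by blast
    then obtain y where y: "y \<in> T" "to_nat w' \<in> word_simplex d y"
      using image_eq_imageD(1)[OF img] by blast
    then obtain x where "y = w' @ x" using word_in_simplex[OF T', of w' y] by auto
    then have "w' \<in> T" using prefix_in_tree[OF T, of w' x] y unfolding w'_def by simp
    then show False using w'T by blast
  qed
  have f'im: "f' ` A = f ` A" if "A \<subseteq> \<Union>S" for A
    by (rule image_cong[OF refl], rule f'eq, rule subsetD[OF that])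
  have injS: "inj_on f' (\<Union>S)" by (rule iffD2[OF inj_on_cong[OF f'eq] inj])
  have inj': "inj_on f' (\<Union>(insert \<sigma> S))"
    unfolding un inj_on_insert f'im[OF Diff_subset] f'v
    using injS fresh by blast
  have f's: "f' ` \<sigma> = word_simplex d w'" unfolding v(1) ws' using f'im[OF FS] f'v by simp
  have "(\<lambda>\<sigma>. f' ` \<sigma>) ` S = (\<lambda>\<sigma>. f ` \<sigma>) ` S" by (rule image_cong[OF refl], rule f'im, rule Union_upper)
  then have img': "(\<lambda>\<sigma>. f' ` \<sigma>) ` insert \<sigma> S = word_simplex d ` insert w' T" using img f's by simp
  have fr': "map f' r = root_list d"
    unfolding fr[symmetric] by (rule map_cong[OF refl], rule f'eq) (use \<sigma>0 in blast)
  let ?R = "dual_edges d (insert \<sigma> S) (\<lambda>_. True)"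
  have sub: "(dual_edges d S (\<lambda>_. True))\<^sup>* \<subseteq> ?R\<^sup>*"
    by (rule rtrancl_mono) (auto simp: dual_edges_def)
  have e1: "(\<kappa>, \<sigma>) \<in> ?R" using \<kappa> by (auto simp: dual_edges_def)
  have s1: "(a, \<sigma>) \<in> ?R\<^sup>*" if "a \<in> insert \<sigma> S" for a
    using that con[of a \<kappa>] \<kappa>(1) sub e1 by (auto intro: rtrancl_into_rtrancl)
  have con'': "(a, b) \<in> ?R\<^sup>*" if "a \<in> insert \<sigma> S" "b \<in> insert \<sigma> S" for a b
    using s1[OF that(1)] dual_edges_rtrancl_sym[OF s1[OF that(2)]] by (rule rtrancl_trans)
  have "labelled d K r (insert \<sigma> S) (insert w' T) f'"
    unfolding labelled_def using S \<kappa>(3) T' inj' img' fr' \<sigma>0 con''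
    by (intro conjI ballI) (simp_all, blast)
  then show ?thesis using \<kappa> by blast
qed

lemma labelled_facets: "\<exists>T f. labelled d K r (facets d K) T f"
proof -
  obtain S T f where "labelled d K r S T f" using labelled_root by blast
  then show ?thesis
  proof (induction "card (facets d K - S)" arbitrary: S T f rule: less_induct)
    case less
    show ?case
    proof (cases "S = facets d K")
      case False
      then obtain \<sigma> T' f' where *: "\<sigma> \<in> facets d K - S" "labelled d K r (insert \<sigma> S) T' f'"
        using labelled_extend[OF less.prems] by blast
      then have "card (facets d K - insert \<sigma> S) < card (facets d K - S)"
        using finite_facets by (intro psubset_card_mono) auto
      then show ?thesis using less.hyps * by blast
    qed (use less.prems in blast)
  qed
qed

text \<open>By purity a complex is determined by its facets, so a vertex map that matches the facets
  is an isomorphism.\<close>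

lemma stacked_iso_tree_complex:
  "\<exists>T\<in>trees d 0. card T = card (facets d K) \<and> T \<noteq> {} \<and> rooted_iso (K, r) (tree_complex d T, root_list d)"
proof -
  obtain T f where lab: "labelled d K r (facets d K) T f" using labelled_facets by blast
  then have T: "T \<in> trees d 0" and inj: "inj_on f (\<Union>(facets d K))"
    and img: "(\<lambda>\<sigma>. f ` \<sigma>) ` facets d K = word_simplex d ` T" and fr: "map f r = root_list d"
    unfolding labelled_def by - (elim conjE, assumption)+
  have "facets d K \<noteq> {}" using root_simplex pure by blast
  then have Tne: "T \<noteq> {}" using img by blast
  have Kf: "K = {\<sigma>. \<sigma> \<noteq> {} \<and> (\<exists>\<tau>\<in>facets d K. \<sigma> \<subseteq> \<tau>)}"
    using complex pure unfolding abstract_complex_def facets_def by blast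
  have V: "vertices K = \<Union>(facets d K)"
  proof
    show "vertices K \<subseteq> \<Union>(facets d K)" unfolding vertices_def using pure by blast
    show "\<Union>(facets d K) \<subseteq> vertices K" unfolding vertices_def facets_def by blast
  qed
  have Kimg: "(\<lambda>\<sigma>. f ` \<sigma>) ` K = tree_complex d T"
  proof (intro equalityI subsetI)
    fix x assume "x \<in> (\<lambda>\<sigma>. f ` \<sigma>) ` K"
    then obtain \<sigma> where s: "x = f ` \<sigma>" "\<sigma> \<in> K" by blast
    then obtain \<tau> where t: "\<tau> \<in> facets d K" "\<sigma> \<subseteq> \<tau>" "\<sigma> \<noteq> {}" using Kf by blast
    then obtain w where "w \<in> T" "f ` \<tau> = word_simplex d w" using image_eq_imageD(1)[OF img t(1)] by blast
    then show "x \<in> tree_complex d T" unfolding tree_complex_nonempty_eq[OF T Tne] using s t by blast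
  next
    fix x assume "x \<in> tree_complex d T"
    then obtain w where w: "x \<noteq> {}" "w \<in> T" "x \<subseteq> word_simplex d w"
      unfolding tree_complex_nonempty_eq[OF T Tne] by blast
    then obtain \<tau> where t: "\<tau> \<in> facets d K" "f ` \<tau> = word_simplex d w"
      using image_eq_imageD(2)[OF img w(2)] by blast
    then obtain \<sigma> where "\<sigma> \<subseteq> \<tau>" "x = f ` \<sigma>" using w(3) by (metis subset_imageE)
    then show "x \<in> (\<lambda>\<sigma>. f ` \<sigma>) ` K" using w(1) t(1) Kf by blast
  qed
  have "f ` vertices K = vertices (tree_complex d T)"
    unfolding Kimg[symmetric] vertices_def by blast
  then have "bij_betw f (vertices K) (vertices (tree_complex d T))"
    using inj V unfolding bij_betw_def by simp
  then have iso: "rooted_iso (K, r) (tree_complex d T, root_list d)"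
    unfolding rooted_iso_def using Kimg fr by blast
  have "inj_on (\<lambda>\<sigma>. f ` \<sigma>) (facets d K)"
    by (rule inj_onI) (use inj_on_image_eq_iff[OF inj] in blast)
  then have "card T = card (facets d K)"
    using img card_image[of "\<lambda>\<sigma>. f ` \<sigma>" "facets d K"] card_image[of "word_simplex d" T] word_simplex_inj[OF T]
    by (simp add: inj_on_def)
  then show ?thesis using T Tne iso by blast
qed

end

section \<open>Attaching a simplex to a ball\<close>

lemma homeomorphic_map_top_of_set:
  "homeomorphic_map (top_of_set S) (top_of_set T) f \<longleftrightarrow> (\<exists>g. homeomorphism S T f g)"
proof
  assume "homeomorphic_map (top_of_set S) (top_of_set T) f"
  then obtain g where g: "homeomorphic_maps (top_of_set S) (top_of_set T) f g"
    using homeomorphic_map_maps by blast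
  then have "continuous_on S f" "f ` S \<subseteq> T" "continuous_on T g" "g ` T \<subseteq> S"
     "\<forall>x\<in>S. g (f x) = x" "\<forall>y\<in>T. f (g y) = y"
    by (auto simp: homeomorphic_maps_def)
  then have "homeomorphism S T f g" by (intro homeomorphismI) auto
  then show "\<exists>g. homeomorphism S T f g" by blast
next
  assume "\<exists>g. homeomorphism S T f g"
  then obtain g where g: "homeomorphism S T f g" ..
  then have "homeomorphic_maps (top_of_set S) (top_of_set T) f g"
    unfolding homeomorphic_maps_def by (auto simp: homeomorphism_def)
  then show "homeomorphic_map (top_of_set S) (top_of_set T) f"
    using homeomorphic_map_maps by blast
qed

lemma homeomorphic_map_compactI:
  fixes f :: "'a::topological_space \<Rightarrow> 'b::t2_space"
  assumes "compact S" "continuous_on S f" "f ` S = T" "inj_on f S"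
  shows "homeomorphic_map (top_of_set S) (top_of_set T) f"
  using homeomorphism_compact[OF assms] homeomorphic_map_top_of_set by blast

lemma continuous_on_apply [continuous_intros]:
  "continuous_on S (\<lambda>x. (x i :: 'b::topological_space))"
  by (rule continuous_on_subset[OF continuous_on_product_coordinates]) simp

lemma continuous_on_Min_apply:
  fixes S :: "('a \<Rightarrow> real) set"
  assumes "finite F" "F \<noteq> {}"
  shows "continuous_on S (\<lambda>x. Min (x ` F))"
  using assms
proof (induction F rule: finite_ne_induct)
  case (insert a F)
  then have eq: "(\<lambda>x::'a \<Rightarrow> real. Min (x ` insert a F)) = (\<lambda>x. min (x a) (Min (x ` F)))" by auto
  show ?case unfolding eq by (rule continuous_on_min[OF continuous_on_apply insert.IH])
qed (simp add: continuous_on_apply)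

text \<open>The closed simplex in barycentric coordinates: the support of a point may be a proper
  face of \<sigma>.\<close>

definition cell :: "'v set \<Rightarrow> ('v \<Rightarrow> real) set" where
  "cell \<sigma> = {x. (\<forall>v. 0 \<le> x v) \<and> (\<forall>v. v \<notin> \<sigma> \<longrightarrow> x v = 0) \<and> sum x \<sigma> = 1}"

definition points :: "'v set set \<Rightarrow> ('v \<Rightarrow> real) set" where
  "points K = {x. (\<forall>v. 0 \<le> x v) \<and> support x \<in> K \<and> (\<Sum>v\<in>support x. x v) = 1}"

lemma realization_eq: "realization K = top_of_set (points K)"
  by (simp add: realization_def points_def euclidean_product_topology)

lemma topspace_realization [simp]: "topspace (realization K) = points K"
  by (simp add: realization_eq)

definition ball_points :: "nat \<Rightarrow> (nat \<Rightarrow> real) set" where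
  "ball_points d = {x. (\<forall>i\<ge>d. x i = 0) \<and> (\<Sum>i<d. (x i)\<^sup>2) \<le> 1}"

lemma closed_ball_eq: "closed_ball d = top_of_set (ball_points d)"
  by (simp add: closed_ball_def Euclidean_space_def subtopology_subtopology euclidean_product_topology
      ball_points_def Collect_conj_eq)

lemma topspace_closed_ball [simp]: "topspace (closed_ball d) = ball_points d"
  by (simp add: closed_ball_eq)

lemma topspace_sphere:
  assumes "d \<ge> 1"
  shows "topspace (nsphere (d - 1)) = {x. (\<forall>i\<ge>d. x i = 0) \<and> (\<Sum>i<d. (x i)\<^sup>2) = 1}"
proof -
  obtain k where "d = Suc k" using assms by (cases d) auto
  then show ?thesis by (auto simp: nsphere lessThan_Suc_atMost Suc_le_eq)
qed

lemma pointsD: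
  assumes "x \<in> points K"
  shows "0 \<le> x w" "support x \<in> K" "(\<Sum>w\<in>support x. x w) = 1"
  using assms by (auto simp: points_def)

lemma support_iff: "w \<in> support x \<longleftrightarrow> x w \<noteq> 0"
  by (simp add: support_def)

lemma sum_support_subset: "finite A \<Longrightarrow> support x \<subseteq> A \<Longrightarrow> (\<Sum>w\<in>support x. x w) = sum x A"
  by (rule sum.mono_neutral_left) (auto simp: support_def)

lemma cellD:
  assumes "x \<in> cell \<sigma>" "finite \<sigma>"
  shows "0 \<le> x v" "v \<notin> \<sigma> \<Longrightarrow> x v = 0" "sum x \<sigma> = 1" "support x \<subseteq> \<sigma>" "support x \<noteq> {}"
    "(\<Sum>v\<in>support x. x v) = 1"
proof -
  show "0 \<le> x v" "v \<notin> \<sigma> \<Longrightarrow> x v = 0" "sum x \<sigma> = 1" using assms by (auto simp: cell_def)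
  show sub: "support x \<subseteq> \<sigma>" using assms by (auto simp: cell_def support_def)
  have "sum x \<sigma> = (\<Sum>v\<in>support x. x v)"
    by (rule sum.mono_neutral_right[OF assms(2) sub]) (simp add: support_def)
  then show 1: "(\<Sum>v\<in>support x. x v) = 1" using assms(1) by (simp add: cell_def)
  show "support x \<noteq> {}" using 1 by auto
qed

lemma cell_support:
  assumes "\<forall>v. 0 \<le> x v" "support x \<subseteq> \<sigma>" "finite \<sigma>" "(\<Sum>v\<in>support x. x v) = 1"
  shows "x \<in> cell \<sigma>"
proof -
  have "sum x \<sigma> = (\<Sum>v\<in>support x. x v)"
    by (rule sum.mono_neutral_right[OF assms(3,2)]) (simp add: support_def)
  then show ?thesis using assms by (auto simp: cell_def support_def)
qed

lemma abstract_complexD: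
  assumes "abstract_complex K"
  shows "finite K" "\<sigma> \<in> K \<Longrightarrow> finite \<sigma>" "\<sigma> \<in> K \<Longrightarrow> \<sigma> \<noteq> {}"
    "\<sigma> \<in> K \<Longrightarrow> \<tau> \<subseteq> \<sigma> \<Longrightarrow> \<tau> \<noteq> {} \<Longrightarrow> \<tau> \<in> K"
proof -
  have *: "finite K" "\<forall>\<sigma>\<in>K. finite \<sigma> \<and> \<sigma> \<noteq> {}" "\<forall>\<sigma>\<in>K. \<forall>\<tau>\<subseteq>\<sigma>. \<tau> \<noteq> {} \<longrightarrow> \<tau> \<in> K"
    using assms unfolding abstract_complex_def by - (elim conjE, assumption)+
  show "finite K" "\<sigma> \<in> K \<Longrightarrow> finite \<sigma>" "\<sigma> \<in> K \<Longrightarrow> \<sigma> \<noteq> {}" using *(1,2) by simp_all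
  show "\<sigma> \<in> K \<Longrightarrow> \<tau> \<subseteq> \<sigma> \<Longrightarrow> \<tau> \<noteq> {} \<Longrightarrow> \<tau> \<in> K" using *(3) by simp
qed

lemma cell_subset_points:
  assumes "abstract_complex K" "\<sigma> \<in> K"
  shows "cell \<sigma> \<subseteq> points K"
proof
  fix x assume "x \<in> cell \<sigma>"
  note x = cellD[OF this abstract_complexD(2)[OF assms]]
  have "support x \<in> K" by (rule abstract_complexD(4)[OF assms x(4,5)])
  then show "x \<in> points K" using x(1,6) by (simp add: points_def)
qed

lemma points_in_cell:
  assumes "abstract_complex K" "x \<in> points K" "support x \<subseteq> \<sigma>" "finite \<sigma>"
  shows "x \<in> cell \<sigma>"
  using assms(2) by (intro cell_support[OF _ assms(3,4)]) (simp_all add: points_def)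

lemma cell_eq:
  assumes "abstract_complex K" "\<sigma> \<in> K"
  shows "cell \<sigma> = {x \<in> points K. support x \<subseteq> \<sigma>}"
  using cell_subset_points[OF assms] points_in_cell[OF assms(1) _ _ abstract_complexD(2)[OF assms]]
    cellD(4)[OF _ abstract_complexD(2)[OF assms]]
  by blast

lemma points_eq:
  assumes "abstract_complex K"
  shows "points K = (\<Union>\<sigma>\<in>K. cell \<sigma>)"
proof (intro equalityI subsetI)
  fix x assume x: "x \<in> points K"
  then have s: "support x \<in> K" by (simp add: points_def)
  then have "x \<in> cell (support x)"
    by (intro points_in_cell[OF assms x order_refl] abstract_complexD(2)[OF assms])
  then show "x \<in> (\<Union>\<sigma>\<in>K. cell \<sigma>)" using s by blast
qed (use cell_subset_points[OF assms] in blast)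

text \<open>Tychonoff's theorem for a cube. Closed simplices and balls are closed subsets of it, and
  compactness later spares the continuity of inverse maps.\<close>

lemma compact_box: "compact {x :: nat \<Rightarrow> real. \<forall>i. x i \<in> {-1..1}}"
proof -
  have "compactin (product_topology (\<lambda>_. euclideanreal) UNIV) (PiE UNIV (\<lambda>_::nat. {-1..1::real}))"
    by (subst compactin_PiE) auto
  moreover have "PiE UNIV (\<lambda>_::nat. {-1..1::real}) = {x. \<forall>i. x i \<in> {-1..1}}" by auto
  ultimately show ?thesis by (simp only: euclidean_product_topology compactin_euclidean_iff)
qed

lemma closed_cell: "closed (cell \<sigma>)"
proof -
  have "cell \<sigma> = (\<Inter>v. {x. 0 \<le> x v}) \<inter> (\<Inter>v\<in>-\<sigma>. {x. x v = 0}) \<inter> {x. sum x \<sigma> = 1}"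
    by (auto simp: cell_def)
  moreover have "closed {x :: 'a \<Rightarrow> real. 0 \<le> x v}" "closed {x :: 'a \<Rightarrow> real. x v = 0}" for v
    by (intro closed_Collect_le closed_Collect_eq continuous_intros)+
  moreover have "closed {x :: 'a \<Rightarrow> real. sum x \<sigma> = 1}"
    by (intro closed_Collect_eq continuous_intros)
  ultimately show ?thesis by (auto intro!: closed_Int closed_INT)
qed

lemma cell_le_1:
  assumes "x \<in> cell \<sigma>" "finite \<sigma>"
  shows "x v \<le> 1"
proof (cases "v \<in> \<sigma>")
  case True
  then have "x v \<le> sum x \<sigma>" using cellD(1)[OF assms] assms(2) by (intro member_le_sum) auto
  then show ?thesis using cellD(3)[OF assms] by simp
qed (use cellD(2)[OF assms] in simp)

lemma compact_cell:
  fixes \<sigma> :: "nat set"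
  assumes "finite \<sigma>"
  shows "compact (cell \<sigma>)"
proof -
  have "cell \<sigma> = {x. \<forall>i. x i \<in> {-1..1}} \<inter> cell \<sigma>"
  proof -
    have "-1 \<le> x i \<and> x i \<le> 1" if "x \<in> cell \<sigma>" for x i
      using cellD(1)[OF that assms, of i] cell_le_1[OF that assms, of i] by linarith
    then show ?thesis by auto
  qed
  then show ?thesis using compact_Int_closed[OF compact_box closed_cell] by metis
qed

lemma compact_points:
  fixes K :: "nat set set"
  assumes "abstract_complex K"
  shows "compact (points K)"
  unfolding points_eq[OF assms] 
  by (intro compact_UN abstract_complexD(1)[OF assms] ballI compact_cell abstract_complexD(2)[OF assms])

lemma closed_ball_points: "closed (ball_points d)"
proof -
  have "ball_points d = (\<Inter>i\<in>{d..}. {x. x i = 0}) \<inter> {x. (\<Sum>i<d. (x i)\<^sup>2) \<le> 1}"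
    by (auto simp: ball_points_def)
  moreover have "closed {x :: nat \<Rightarrow> real. x v = 0}" for v
    by (intro closed_Collect_eq continuous_intros)
  moreover have "closed {x :: nat \<Rightarrow> real. (\<Sum>i<d. (x i)\<^sup>2) \<le> 1}"
    by (intro closed_Collect_le continuous_intros)
  ultimately show ?thesis by (auto intro!: closed_Int closed_INT)
qed

lemma compact_ball_points: "compact (ball_points d)"
proof -
  have "x i \<in> {-1..1}" if x: "x \<in> ball_points d" for x i
  proof (cases "i < d")
    case True
    then have "(x i)\<^sup>2 \<le> (\<Sum>i<d. (x i)\<^sup>2)" by (intro member_le_sum) auto
    then have "(x i)\<^sup>2 \<le> 1" using x by (auto simp: ball_points_def)
    then show ?thesis by (auto simp: abs_square_le_1 abs_le_iff)
  qed (use x in \<open>auto simp: ball_points_def\<close>)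
  then have "ball_points d = {x. \<forall>i. x i \<in> {-1..1}} \<inter> ball_points d" by auto
  then show ?thesis using compact_Int_closed[OF compact_box closed_ball_points] by metis
qed

text \<open>Being a boundary point asks for some homeomorphism to the ball only, so composition with
  \<phi> is enough.\<close>

lemma boundary_points_homeomorphic:
  assumes "homeomorphic_map (realization K) (realization L) \<phi>" "x \<in> points K" "\<phi> x \<in> boundary_points d L"
  shows "x \<in> boundary_points d K"
proof -
  obtain h where h: "homeomorphic_map (realization L) (closed_ball d) h" "h (\<phi> x) \<in> topspace (nsphere (d - 1))"
    using assms(3) by (auto simp: boundary_points_def)
  have "homeomorphic_map (realization K) (closed_ball d) (h \<circ> \<phi>)"
    using homeomorphic_map_compose[OF assms(1) h(1)] .
  then show ?thesis using assms(2) h(2) by (auto simp: boundary_points_def intro!: exI[of _ "h \<circ> \<phi>"])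
qed

lemma in_boundary_iff:
  assumes "abstract_complex K"
  shows "in_boundary d K \<sigma> \<longleftrightarrow> \<sigma> \<in> K \<and> cell \<sigma> \<subseteq> boundary_points d K"
  unfolding in_boundary_def using cell_eq[OF assms] by auto

lemma in_boundary_subset:
  assumes "abstract_complex K" "in_boundary d K \<sigma>" "\<tau> \<subseteq> \<sigma>" "\<tau> \<noteq> {}"
  shows "in_boundary d K \<tau>"
  using assms abstract_complexD(4)[OF assms(1)] unfolding in_boundary_def by blast

text \<open>
  A simplex spanned by a facet \<open>F\<close> of the boundary and a new vertex \<open>v\<close> can be absorbed into the
  simplex spanned by \<open>F\<close> and \<open>u\<close> on the other side: the two simplices form a bipyramid over \<open>F\<close>,
  whose points are pushed along the segments parallel to its axis \<open>uv\<close>.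
\<close>

locale absorb =
  fixes K' :: "nat set set" and F :: "nat set" and u v :: nat
  assumes K': "abstract_complex K'" and F: "F \<noteq> {}" "u \<notin> F" "insert u F \<in> K'"
    and v: "v \<notin> vertices K'"
    and free: "\<And>\<rho>. \<rho> \<in> K' \<Longrightarrow> F \<subseteq> \<rho> \<Longrightarrow> \<rho> \<subseteq> insert u F"
begin

definition K where "K = K' \<union> {\<rho>. \<rho> \<noteq> {} \<and> \<rho> \<subseteq> insert v F}"

definition height :: "(nat \<Rightarrow> real) \<Rightarrow> real" where "height x = Min (x ` F)"

text \<open>Let c be the number of vertices of F and place v so that the barycentre of F is the
  midpoint of u and v. A line parallel to uv meets the bipyramid where p = x u - x v runs from - c *
  h to c * h; here h is the smallest F-coordinate at p = 0. The new u-coordinate is (p + c * h) / 2,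
  so the segment is halved towards its end on the side of u and covers just the part beyond
  F.\<close>

definition push :: "(nat \<Rightarrow> real) \<Rightarrow> nat \<Rightarrow> real" where
  "push x = (\<lambda>w. if w = u then x u + real (card F) * height x / 2 else if w = v then 0
     else if w \<in> F then x w + x v / real (card F) - height x / 2 else x w)"

text \<open>If y is the pushed image of x, then p recovers x u - x v; its sign decides on which side
  of F the preimage lies.\<close>

definition pull :: "(nat \<Rightarrow> real) \<Rightarrow> nat \<Rightarrow> real" where
  "pull y = (let p = y u - real (card F) * height y in (\<lambda>w. if w = u then max p 0 else if w = v then max (- p) 0
     else if w \<in> F then y w + height y - 2 * max (- p) 0 / real (card F) else y w))"

lemma finF: "finite F"
  using abstract_complexD(2)[OF K' F(3)] by simp

lemma cardF: "real (card F) > 0"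
  using finF F(1) by (simp add: card_gt_0_iff)

lemma vF: "v \<notin> F" and uv: "u \<noteq> v"
  using v F(3) unfolding vertices_def by auto

lemma K: "abstract_complex K"
  unfolding abstract_complex_def K_def
proof (intro conjI ballI allI impI)
  show "finite (K' \<union> {\<rho>. \<rho> \<noteq> {} \<and> \<rho> \<subseteq> insert v F})" using finF abstract_complexD(1)[OF K'] by simp
  fix \<sigma> assume s: "\<sigma> \<in> K' \<union> {\<rho>. \<rho> \<noteq> {} \<and> \<rho> \<subseteq> insert v F}"
  have "finite \<rho>" if "\<rho> \<subseteq> insert v F" for \<rho> using finite_subset[OF that] finF by simp
  then show "finite \<sigma>" "\<sigma> \<noteq> {}"
    using s abstract_complexD(2,3)[OF K', of \<sigma>] by blast+
  fix \<tau> assume "\<tau> \<subseteq> \<sigma>" "\<tau> \<noteq> {}"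
  then show "\<tau> \<in> K' \<union> {\<rho>. \<rho> \<noteq> {} \<and> \<rho> \<subseteq> insert v F}" using s abstract_complexD(4)[OF K', of \<sigma> \<tau>] by blast
qed

lemma height_le: "w \<in> F \<Longrightarrow> height x \<le> x w"
  unfolding height_def using finF by simp

lemma height_attained: obtains w where "w \<in> F" "x w = height x"
  using Min_in[of "x ` F"] finF F(1) unfolding height_def by fastforce

lemma height_affine:
  assumes "\<And>w. w \<in> F \<Longrightarrow> y w = x w + c"
  shows "height y = height x + c"
proof -
  obtain w where w: "w \<in> F" "x w = height x" by (rule height_attained)
  obtain w' where w': "w' \<in> F" "y w' = height y" by (rule height_attained)
  show ?thesis using assms[OF w(1)] assms[OF w'(1)] height_le[OF w(1), of y] height_le[OF w'(1), of x] w w' by simp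
qed

lemma height_zero:
  assumes "\<And>w. 0 \<le> x w" "\<not> F \<subseteq> support x"
  shows "height x = 0"
proof -
  obtain w where w: "w \<in> F" "x w = 0" using assms(2) by (auto simp: support_def)
  obtain w' where "w' \<in> F" "x w' = height x" by (rule height_attained)
  then show ?thesis using height_le[OF w(1), of x] assms(1)[of w'] w by simp
qed

lemma height_nonneg:
  assumes "\<And>w. 0 \<le> x w"
  shows "0 \<le> height x"
  using height_attained[of x] assms by metis

lemma push_height: "height (push x) = height x / 2 + x v / real (card F)"
proof -
  have "height (push x) = height x + (x v / real (card F) - height x / 2)"
    by (rule height_affine) (use F(2) vF in \<open>auto simp: push_def\<close>)
  then show ?thesis by simp
qed

lemma pull_push:
  assumes "0 \<le> x u" "0 \<le> x v" "x u = 0 \<or> x v = 0"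
  shows "pull (push x) = x"
proof -
  have p: "push x u - real (card F) * height (push x) = x u - x v"
    unfolding push_height using cardF by (simp add: push_def field_simps)
  have m: "max (x u - x v) 0 = x u" "max (- (x u - x v)) 0 = x v" using assms by auto
  show ?thesis
    unfolding pull_def Let_def p m using F(2) vF uv cardF
    by (intro ext) (simp add: push_height, simp add: push_def field_simps)
qed

lemma push_pull:
  assumes "y v = 0"
  shows "push (pull y) = y"
proof -
  define p where "p = y u - real (card F) * height y"
  have e: "pull y w = y w + (height y - 2 * max (- p) 0 / real (card F))" if "w \<in> F" for w
    using that F(2) vF by (auto simp: pull_def p_def Let_def)
  have h: "height (pull y) = 2 * height y - 2 * max (- p) 0 / real (card F)"
    using height_affine[of "pull y" y, OF e] by simp
  have uu: "pull y u = max p 0" "pull y v = max (- p) 0" using uv by (auto simp: pull_def p_def Let_def)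
  have pp: "max p 0 - max (- p) 0 = p" by simp
  have u1: "push (pull y) u = y u"
  proof -
    have "push (pull y) u = max p 0 - max (- p) 0 + real (card F) * height y"
      unfolding push_def h uu using cardF by (simp add: field_simps)
    then show ?thesis unfolding pp by (simp add: p_def)
  qed
  show ?thesis
  proof (rule ext)
    fix w
    consider "w = u" | "w = v" | "w \<in> F" "w \<noteq> u" "w \<noteq> v" | "w \<notin> F" "w \<noteq> u" "w \<noteq> v" by blast
    then show "push (pull y) w = y w"
    proof cases
      case 1 then show ?thesis using u1 by simp
    next
      case 2 then show ?thesis using assms uv by (simp add: push_def)
    next
      case 3
      then have "push (pull y) w = pull y w + pull y v / real (card F) - height (pull y) / 2"
        by (simp add: push_def)
      then show ?thesis unfolding h uu e[OF 3(1)] using cardF by (simp add: field_simps)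
    next
      case 4 then show ?thesis by (simp add: push_def pull_def Let_def)
    qed
  qed
qed

lemma points_K: "points K = points K' \<union> cell (insert v F)"
proof -
  have "cell \<rho> \<subseteq> cell (insert v F)" if "\<rho> \<noteq> {}" "\<rho> \<subseteq> insert v F" for \<rho>
  proof
    fix x assume "x \<in> cell \<rho>"
    note x = cellD[OF this finite_subset[OF that(2)]]
    show "x \<in> cell (insert v F)"
      by (rule cell_support) (use x that(2) finF in auto)
  qed
  then have "(\<Union>\<rho>\<in>{\<rho>. \<rho> \<noteq> {} \<and> \<rho> \<subseteq> insert v F}. cell \<rho>) = cell (insert v F)"
    by (intro equalityI UN_least UN_upper) auto
  then show ?thesis unfolding points_eq[OF K] points_eq[OF K'] unfolding K_def UN_Un by simp
qed

lemma points_K'_v: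
  assumes "x \<in> points K'"
  shows "x v = 0"
  using assms v by (auto simp: points_def vertices_def support_def)

text \<open>This is where the deformation of the bipyramid fits together with the identity on the
  rest of the complex.\<close>

lemma push_fixed:
  assumes "x \<in> points K'" "\<not> F \<subseteq> support x"
  shows "push x = x"
proof -
  have "height x = 0" using assms by (intro height_zero) (auto simp: points_def)
  then show ?thesis using points_K'_v[OF assms(1)] by (auto simp: push_def)
qed

text \<open>Freeness of F: the only old points whose support contains F are those of the simplex
  that absorbs the new one.\<close>

lemma cell_full:
  assumes "x \<in> points K'" "F \<subseteq> support x"
  shows "x \<in> cell (insert u F)"
  using assms free[of "support x"] finF by (intro points_in_cell[OF K' assms(1)]) (simp_all add: points_def)

lemma sum_push:
  assumes "\<And>w. w \<in> F \<Longrightarrow> y w = x w + c"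
  shows "sum y F = sum x F + real (card F) * c"
  using assms by (simp add: sum.distrib)

lemma push_cell:
  assumes "x \<in> cell (insert u F) \<or> x \<in> cell (insert v F)"
  shows "push x \<in> cell (insert u F)"
proof -
  have x: "\<And>w. 0 \<le> x w" "\<And>w. w \<notin> F \<Longrightarrow> w \<noteq> u \<Longrightarrow> w \<noteq> v \<Longrightarrow> x w = 0" "x u + x v + sum x F = 1"
    using assms finF F(2) vF uv by (auto simp: cell_def)
  have s: "sum (push x) F = sum x F + real (card F) * (x v / real (card F) - height x / 2)"
    by (rule sum_push) (use F(2) vF in \<open>auto simp: push_def\<close>)
  have "sum (push x) (insert u F) = 1"
  proof -
    have "sum (push x) (insert u F) = push x u + sum (push x) F" using finF F(2) by simp
    moreover have "push x u = x u + real (card F) * height x / 2" by (simp add: push_def)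
    moreover have "real (card F) * (x v / real (card F) - height x / 2) = x v - real (card F) * height x / 2"
      using cardF by (simp only: right_diff_distrib) simp
    ultimately show ?thesis using s x(3) by linarith
  qed
  moreover have "0 \<le> push x w" for w
  proof -
    define a where "a = x v / real (card F)"
    define b where "b = real (card F) * height x / 2"
    have "height x / 2 \<le> x w" if "w \<in> F" using height_le[OF that, of x] x(1)[of w] by linarith
    moreover have "0 \<le> a" unfolding a_def using x(1)[of v] cardF by simp
    moreover have "0 \<le> b" unfolding b_def using height_nonneg[OF x(1)] cardF by simp
    ultimately show ?thesis
      using x(1)[of w] unfolding push_def a_def[symmetric] b_def[symmetric] by auto
  qed
  moreover have "push x w = 0" if "w \<notin> insert u F" for w using that x(2) by (auto simp: push_def)
  ultimately show ?thesis by (auto simp: cell_def)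
qed

lemma push_in_points:
  assumes "x \<in> points K"
  shows "push x \<in> points K'"
proof (cases "x \<in> points K' \<and> \<not> F \<subseteq> support x")
  case True
  then show ?thesis using push_fixed by simp
next
  case False
  then have "x \<in> cell (insert u F) \<or> x \<in> cell (insert v F)" using assms points_K cell_full by blast
  then show ?thesis using push_cell cell_subset_points[OF K' F(3)] by blast
qed

lemma pull_in_points:
  assumes y: "y \<in> points K'"
  shows "pull y \<in> points K"
proof -
  define p where "p = y u - real (card F) * height y"
  have y0: "\<And>w. 0 \<le> y w" using y by (auto simp: points_def)
  have yv: "y v = 0" using points_K'_v[OF y] .
  have pl: "pull y u = max p 0" "pull y v = max (- p) 0"
     "\<And>w. w \<in> F \<Longrightarrow> pull y w = y w + (height y - 2 * max (- p) 0 / real (card F))"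
     "\<And>w. w \<noteq> u \<Longrightarrow> w \<noteq> v \<Longrightarrow> w \<notin> F \<Longrightarrow> pull y w = y w"
    using uv F(2) vF by (auto simp: pull_def p_def Let_def)
  show ?thesis
  proof (cases "F \<subseteq> support y")
    case False
    then have h: "height y = 0" using y0 by (intro height_zero) auto
    then have "p = y u" by (simp add: p_def)
    then have "pull y = y" using y0[of u] h yv by (auto simp: pull_def p_def Let_def)
    then show ?thesis using y points_K by simp
  next
    case True
    then have c: "y \<in> cell (insert u F)" using cell_full y by blast
    then have s: "y u + sum y F = 1" and o: "\<And>w. w \<notin> insert u F \<Longrightarrow> y w = 0"
      using finF F(2) by (auto simp: cell_def)
    have sp: "sum (pull y) F = sum y F + real (card F) * (height y - 2 * max (- p) 0 / real (card F))"
      by (rule sum_push) (use pl in auto)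
    have sp': "sum (pull y) F = sum y F + (y u - p) - 2 * max (- p) 0"
      unfolding sp p_def using cardF by (simp add: field_simps)
    show ?thesis
    proof (cases "p \<ge> 0")
      case True
      have "pull y \<in> cell (insert u F)"
        unfolding cell_def
      proof (intro CollectI conjI allI impI)
        show "0 \<le> pull y w" for w
          using True pl(1,2) pl(3,4)[of w] y0[of w] height_nonneg[OF y0]
          by (cases "w = u"; cases "w = v"; cases "w \<in> F") auto
        show "pull y w = 0" if "w \<notin> insert u F" for w
          using that True pl(2) pl(4)[of w] o by (cases "w = v") auto
        show "sum (pull y) (insert u F) = 1" using sp' True s pl(1) finF F(2) by simp
      qed
      then show ?thesis using cell_subset_points[OF K' F(3)] points_K by blast
    next
      case False
      have "pull y \<in> cell (insert v F)"
        unfolding cell_def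
      proof (intro CollectI conjI allI impI)
        have "height y - 2 * (- p) / real (card F) = 2 * y u / real (card F) - height y"
          unfolding p_def using cardF by (simp add: field_simps)
        moreover have "0 \<le> 2 * y u / real (card F)" using y0[of u] cardF by simp
        ultimately show "0 \<le> pull y w" for w
          using False pl(1,2) pl(3,4)[of w] y0[of w] height_le[of w y]
          by (cases "w = u"; cases "w = v"; cases "w \<in> F") auto
        show "pull y w = 0" if "w \<notin> insert v F" for w
          using that False pl(1) pl(4)[of w] o by (cases "w = u") auto
        show "sum (pull y) (insert v F) = 1" using sp' False s pl(2) finF vF by simp
      qed
      then show ?thesis using points_K by blast
    qed
  qed
qed

lemma points_K_uv:
  assumes "x \<in> points K"
  shows "0 \<le> x u" "0 \<le> x v" "x u = 0 \<or> x v = 0"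
proof -
  show "0 \<le> x u" "0 \<le> x v" using assms by (auto simp: points_def)
  show "x u = 0 \<or> x v = 0"
    using assms points_K points_K'_v F(2) uv by (auto simp: cell_def)
qed

lemma continuous_push: "continuous_on S push"
proof (rule continuous_on_coordinatewise_then_product)
  fix w
  have h: "continuous_on S height"
    using continuous_on_Min_apply[OF finF F(1), of S] by (simp add: height_def[abs_def])
  show "continuous_on S (\<lambda>x. push x w)"
  proof -
    consider "w = u" | "w \<noteq> u" "w = v" | "w \<in> F" "w \<noteq> u" "w \<noteq> v" | "w \<notin> F" "w \<noteq> u" "w \<noteq> v" by blast
    then show ?thesis
    proof cases
      case 3
      show ?thesis unfolding push_def using 3 cardF by (simp) (intro continuous_intros h; simp)
    qed (unfold push_def; use cardF in simp; intro continuous_intros h; simp)+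
  qed
qed

lemma homeomorphic_push: "homeomorphic_map (realization K) (realization K') push"
  unfolding realization_eq
proof (rule homeomorphic_map_compactI)
  show "compact (points K)" by (rule compact_points[OF K])
  show "continuous_on (points K) push" by (rule continuous_push)
  show "push ` points K = points K'"
  proof (intro equalityI subsetI)
    fix y assume y: "y \<in> points K'"
    then have "push (pull y) = y" using push_pull points_K'_v by blast
    then show "y \<in> push ` points K" using pull_in_points[OF y] by (metis imageI)
  qed (use push_in_points in blast)
  show "inj_on push (points K)"
    by (rule inj_on_inverseI[of _ pull]) (use pull_push points_K_uv in blast)
qed

text \<open>No point of G has all of F in its support, so the push fixes G pointwise.\<close>

lemma in_boundary_old:
  assumes "in_boundary d K' G" "\<not> F \<subseteq> G"
  shows "in_boundary d K G"
  unfolding in_boundary_iff[OF K]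
proof (intro conjI subsetI)
  have G: "G \<in> K'" "cell G \<subseteq> boundary_points d K'" using assms(1) in_boundary_iff[OF K'] by auto
  then show "G \<in> K" unfolding K_def by blast
  fix x assume x: "x \<in> cell G"
  then have "x \<in> points K'" "\<not> F \<subseteq> support x"
    using cell_eq[OF K' G(1)] assms(2) by auto
  then have "push x = x" "x \<in> points K" using push_fixed points_K by auto
  then show "x \<in> boundary_points d K"
    using boundary_points_homeomorphic[OF homeomorphic_push, of x d] G x by auto
qed

text \<open>Without the vertex f the height is 0, and the u-coordinate is 0 as well. The push then
  merely spreads the v-coordinate evenly over F, so the image lies in the old boundary simplex
  F.\<close>

lemma in_boundary_new:
  assumes "in_boundary d K' F" "f \<in> F"
  shows "in_boundary d K (insert v F - {f})"
  unfolding in_boundary_iff[OF K]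
proof (intro conjI subsetI)
  have G: "F \<in> K'" "cell F \<subseteq> boundary_points d K'" using assms(1) in_boundary_iff[OF K'] by auto
  show "insert v F - {f} \<in> K" unfolding K_def using vF assms(2) by auto
  fix x assume x: "x \<in> cell (insert v F - {f})"
  have x0: "x f = 0" "x u = 0" "\<And>w. 0 \<le> x w" "\<And>w. w \<notin> F \<Longrightarrow> w \<noteq> v \<Longrightarrow> x w = 0"
    using x uv F(2) by (auto simp: cell_def)
  have s: "sum x (insert v F) = 1"
  proof -
    have "sum x (insert v F) = sum x (insert v F - {f}) + x f"
      using finF assms(2) by (simp add: sum.remove[of "insert v F" f])
    then show ?thesis using x x0 by (simp add: cell_def)
  qed
  have "x \<in> cell (insert v F)" unfolding cell_def using s x0 by auto
  then have xK: "x \<in> points K" using points_K by blast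
  have h: "height x = 0"
    using x0 assms(2) by (intro height_zero) (auto simp: support_def)
  have p: "push x w = x w + x v / real (card F)" if "w \<in> F" for w
    using that h F(2) vF by (auto simp: push_def)
  have "push x \<in> cell F"
    unfolding cell_def
  proof (intro CollectI conjI allI impI)
    have c0: "0 \<le> x v / real (card F)" using x0(3)[of v] cardF by simp
    show "0 \<le> push x w" for w
      using c0 h x0(3)[of w] x0(3)[of u] by (auto simp: push_def)
    show "push x w = 0" if "w \<notin> F" for w using that h x0 by (auto simp: push_def)
    show "sum (push x) F = 1" using sum_push[of "push x" x, OF p] s finF vF F(1) by simp
  qed
  then show "x \<in> boundary_points d K"
    using boundary_points_homeomorphic[OF homeomorphic_push xK] G by blast
qed

end

section \<open>Complexes of trees are balls\<close>

text \<open>The ball uses the barycentric coordinates at b 0, ..., b (d - 1); the coordinate at b d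
  is determined by the sum.\<close>

locale simplex_to_ball =
  fixes d :: nat and \<sigma> :: "nat set" and b :: "nat \<Rightarrow> nat"
  assumes d: "d \<ge> 1" and b: "bij_betw b {..d} \<sigma>"
begin

definition centre :: real where "centre = 1 / (real d + 1)"

definition offset :: "(nat \<Rightarrow> real) \<Rightarrow> nat \<Rightarrow> real" where "offset x i = x (b i) - centre"

definition offset_norm :: "(nat \<Rightarrow> real) \<Rightarrow> real" where
  "offset_norm x = sqrt (\<Sum>i<d. (offset x i)\<^sup>2)"

definition depth :: "(nat \<Rightarrow> real) \<Rightarrow> real" where
  "depth x = 1 - (real d + 1) * Min (x ` \<sigma>)"

text \<open>
  On each ray from the barycentre, \<open>depth\<close> is the gauge of the simplex; it becomes the Euclidean
  norm. The barycentre itself is mapped to 0 because of division by zero.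
\<close>

definition radial :: "(nat \<Rightarrow> real) \<Rightarrow> nat \<Rightarrow> real" where
  "radial x i = (if i < d then offset x i * depth x / offset_norm x else 0)"

lemma fin: "finite \<sigma>" and ne: "\<sigma> \<noteq> {}"
  using b bij_betw_finite[OF b] by (auto simp: bij_betw_def)

lemma b_in: "i \<le> d \<Longrightarrow> b i \<in> \<sigma>"
  using b by (auto simp: bij_betw_def)

lemma b_onto: "v \<in> \<sigma> \<Longrightarrow> \<exists>i\<le>d. v = b i"
  using b by (auto simp: bij_betw_def)

lemma sum_b: "sum x \<sigma> = (\<Sum>i<d. x (b i)) + x (b d)"
proof -
  have "sum x \<sigma> = (\<Sum>i\<le>d. x (b i))" using sum.reindex_bij_betw[OF b, of x] by simp
  then show ?thesis by (simp flip: lessThan_Suc_atMost)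
qed

lemma centre_mult: "(real d + 1) * centre = 1"
  by (simp add: centre_def)

lemma centre_pos: "centre > 0"
  by (simp add: centre_def)

lemma last_offset:
  assumes "x \<in> cell \<sigma>"
  shows "offset x d = - (\<Sum>i<d. offset x i)"
proof -
  have "(\<Sum>i<d. x (b i)) + x (b d) = 1" using assms sum_b[of x] by (simp add: cell_def)
  then show ?thesis using centre_mult by (simp add: offset_def sum_subtractf algebra_simps)
qed

lemma Min_attained: obtains v where "v \<in> \<sigma>" "x v = Min (x ` \<sigma>)"
  using Min_in[of "x ` \<sigma>"] fin ne by fastforce

lemma Min_lower: "v \<in> \<sigma> \<Longrightarrow> Min (x ` \<sigma>) \<le> x v"
  using fin by simp

lemma card_sigma: "real (card \<sigma>) = real d + 1"
  using bij_betw_same_card[OF b] by simp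

lemma depth_bounds:
  assumes x: "x \<in> cell \<sigma>"
  shows "0 \<le> depth x" "depth x \<le> 1"
proof -
  have "real (card \<sigma>) * Min (x ` \<sigma>) \<le> sum x \<sigma>"
    by (rule sum_bounded_below[OF Min_lower])
  then show "0 \<le> depth x" using x card_sigma by (simp add: depth_def cell_def)
  obtain v where "v \<in> \<sigma>" "x v = Min (x ` \<sigma>)" by (rule Min_attained)
  then have "0 \<le> Min (x ` \<sigma>)" using cellD(1)[OF x fin, of v] by simp
  then show "depth x \<le> 1" by (simp add: depth_def)
qed

lemma depth_zero:
  assumes x: "x \<in> cell \<sigma>" and g: "depth x = 0" and v: "v \<in> \<sigma>"
  shows "x v = centre"
proof -
  have m: "Min (x ` \<sigma>) = centre"
    using g centre_mult by (simp add: depth_def centre_def field_simps)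
  have "sum (\<lambda>v. x v - centre) \<sigma> = 0"
    using x card_sigma centre_mult by (simp add: sum_subtractf cell_def)
  moreover have "0 \<le> x v - centre" if "v \<in> \<sigma>" for v using Min_lower[OF that, of x] m by simp
  ultimately have "x v - centre = 0" using sum_nonneg_eq_0_iff[OF fin, of "\<lambda>v. x v - centre"] v by blast
  then show ?thesis by simp
qed

text \<open>Both vanish exactly at the barycentre, so this is the only point where the quotient in
  \<open>radial\<close> degenerates.\<close>

lemma offset_norm_zero_iff:
  assumes x: "x \<in> cell \<sigma>"
  shows "offset_norm x = 0 \<longleftrightarrow> depth x = 0"
proof
  assume "offset_norm x = 0"
  then have "(\<Sum>i<d. (offset x i)\<^sup>2) = 0" by (simp add: offset_norm_def)
  then have 1: "\<forall>i<d. offset x i = 0" by (simp add: sum_nonneg_eq_0_iff)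
  then have 2: "offset x d = 0" using last_offset[OF x] by simp
  have "offset x i = 0" if "i \<le> d" for i using 1 2 that by (cases "i = d") auto
  then have "x v = centre" if "v \<in> \<sigma>" for v using b_onto[OF that] by (auto simp: offset_def)
  then have "Min (x ` \<sigma>) = centre" using Min_attained[of x] by metis
  then show "depth x = 0" using centre_mult by (simp add: depth_def)
next
  assume "depth x = 0"
  then show "offset_norm x = 0" using depth_zero[OF x] b_in by (simp add: offset_norm_def offset_def)
qed

lemma offset_norm_nonneg: "0 \<le> offset_norm x"
  by (simp add: offset_norm_def sum_nonneg)

lemma radial_norm:
  assumes x: "x \<in> cell \<sigma>"
  shows "(\<Sum>i<d. (radial x i)\<^sup>2) = (depth x)\<^sup>2"
proof (cases "offset_norm x = 0")
  case True
  then have "depth x = 0" using offset_norm_zero_iff[OF x] by simp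
  then show ?thesis by (simp add: radial_def)
next
  case False
  have "(\<Sum>i<d. (radial x i)\<^sup>2) = (\<Sum>i<d. (offset x i)\<^sup>2) * ((depth x)\<^sup>2 / (offset_norm x)\<^sup>2)"
    unfolding sum_distrib_right
    by (rule sum.cong) (simp_all add: radial_def power_divide power_mult_distrib)
  also have "(\<Sum>i<d. (offset x i)\<^sup>2) = (offset_norm x)\<^sup>2"
    by (simp add: offset_norm_def sum_nonneg)
  finally show ?thesis using False by simp
qed

lemma radial_in_ball:
  assumes "x \<in> cell \<sigma>"
  shows "radial x \<in> ball_points d"
proof -
  have "(depth x)\<^sup>2 \<le> 1" using depth_bounds[OF assms] by (simp add: power_le_one)
  then show ?thesis using radial_norm[OF assms] by (simp add: ball_points_def radial_def)
qed

lemma radial_in_sphere: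
  assumes x: "x \<in> cell \<sigma>" and v: "v \<in> \<sigma>" "x v = 0"
  shows "radial x \<in> topspace (nsphere (d - 1))"
proof -
  have "Min (x ` \<sigma>) \<le> 0" using Min_lower[OF v(1), of x] v by simp
  then have "depth x \<ge> 1" unfolding depth_def by (simp add: mult_nonneg_nonpos)
  then have "depth x = 1" using depth_bounds[OF x] by simp
  then show ?thesis unfolding topspace_sphere[OF d] using radial_norm[OF x] by (simp add: radial_def)
qed

text \<open>Points with the same image have the same depth and proportional offsets. The factor t >
  0 also scales the depth, hence t = 1 away from the barycentre.\<close>

lemma inj_radial: "inj_on radial (cell \<sigma>)"
proof (rule inj_onI)
  fix x y assume x: "x \<in> cell \<sigma>" and y: "y \<in> cell \<sigma>" and eq: "radial x = radial y"
  have "(depth x)\<^sup>2 = (depth y)\<^sup>2" using radial_norm[OF x] radial_norm[OF y] eq by simp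
  then have g: "depth x = depth y" using depth_bounds(1)[OF x] depth_bounds(1)[OF y] by simp
  have on: "x v = y v" if "v \<in> \<sigma>" for v
  proof (cases "depth x = 0")
    case True
    then show ?thesis using depth_zero[OF x _ that] depth_zero[OF y _ that] g by simp
  next
    case False
    then have N: "offset_norm x > 0" "offset_norm y > 0"
      using offset_norm_zero_iff[OF x] offset_norm_zero_iff[OF y] g offset_norm_nonneg[of x] offset_norm_nonneg[of y]
      by simp_all
    define t where "t = offset_norm x / offset_norm y"
    have o: "offset x i = t * offset y i" if "i < d" for i
    proof -
      have "offset x i * depth x / offset_norm x = offset y i * depth x / offset_norm y"
        using fun_cong[OF eq, of i] that g by (simp add: radial_def)
      then show ?thesis using False N by (simp add: t_def field_simps)
    qed
    have "offset x d = t * offset y d"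
      unfolding last_offset[OF x] last_offset[OF y] using o by (simp add: sum_distrib_left)
    then have "offset x i = t * offset y i" if "i \<le> d" for i using o that by (cases "i = d") auto
    then have xy: "x v - centre = t * (y v - centre)" if "v \<in> \<sigma>" for v
      using b_onto[OF that] by (auto simp: offset_def)
    have t: "t > 0" using N by (simp add: t_def)
    obtain v1 where v1: "v1 \<in> \<sigma>" "x v1 = Min (x ` \<sigma>)" by (rule Min_attained)
    obtain v2 where v2: "v2 \<in> \<sigma>" "y v2 = Min (y ` \<sigma>)" by (rule Min_attained)
    have "Min (x ` \<sigma>) - centre \<le> t * (Min (y ` \<sigma>) - centre)"
      using Min_lower[OF v2(1), of x] xy[OF v2(1)] v2 by simp
    moreover have "t * (Min (y ` \<sigma>) - centre) \<le> Min (x ` \<sigma>) - centre"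
      using Min_lower[OF v1(1), of y] xy[OF v1(1)] v1 t by simp
    ultimately have m: "Min (x ` \<sigma>) - centre = t * (Min (y ` \<sigma>) - centre)" by simp
    have gm: "depth z = - (real d + 1) * (Min (z ` \<sigma>) - centre)" for z
      using centre_mult by (simp add: depth_def algebra_simps)
    have "depth x = t * depth y" unfolding gm m by simp
    then have "t = 1" using g False by simp
    then show ?thesis using xy[OF that] by simp
  qed
  show "x = y"
  proof (rule ext)
    fix v show "x v = y v" using on x y by (cases "v \<in> \<sigma>") (auto simp: cell_def)
  qed
qed

lemma surj_radial:
  assumes y: "y \<in> ball_points d"
  shows "\<exists>x\<in>cell \<sigma>. radial x = y"
proof (cases "(\<Sum>i<d. (y i)\<^sup>2) = 0")
  case True
  then have y0: "y i = 0" for i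
    using y by (cases "i < d") (auto simp: ball_points_def sum_nonneg_eq_0_iff)
  define x where "x = (\<lambda>v. if v \<in> \<sigma> then centre else 0)"
  have "sum x \<sigma> = 1" unfolding x_def using card_sigma centre_mult by simp
  then have "x \<in> cell \<sigma>" using centre_pos by (auto simp: cell_def x_def)
  moreover have "offset x i = 0" if "i < d" for i using b_in that by (simp add: offset_def x_def)
  then have "radial x = y" using y0 by (auto simp: radial_def)
  ultimately show ?thesis by blast
next
  case False
  define Y where "Y = sqrt (\<Sum>i<d. (y i)\<^sup>2)"
  have "(\<Sum>i<d. (y i)\<^sup>2) \<ge> 0" by (simp add: sum_nonneg)
  then have Y: "Y > 0" "Y \<le> 1" using False y by (auto simp: Y_def ball_points_def)
  \<comment> \<open>The direction y is completed by a last coordinate to one of sum 0, as required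
    of offsets of barycentric coordinates.\<close>
  define e where "e i = (if i < d then y i else - (\<Sum>i<d. y i))" for i
  have e0: "(\<Sum>i\<le>d. e i) = 0" by (simp add: e_def flip: lessThan_Suc_atMost)
  define \<mu> where "\<mu> = Min (e ` {..d})"
  have \<mu>le: "\<mu> \<le> e i" if "i \<le> d" for i unfolding \<mu>_def using that by simp
  have "\<mu> \<in> e ` {..d}" unfolding \<mu>_def by (rule Min_in) auto
  then obtain i0 where i0: "i0 \<le> d" "e i0 = \<mu>" by auto
  have \<mu>: "\<mu> < 0"
  proof (rule ccontr)
    assume "\<not> \<mu> < 0"
    then have "e i \<ge> 0" if "i \<le> d" for i using \<mu>le[OF that] by simp
    then have "\<forall>i\<in>{..d}. e i = 0" using e0 sum_nonneg_eq_0_iff[of "{..d}" e] by simp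
    then have "\<forall>i<d. y i = 0" by (metis atMost_iff e_def less_imp_le)
    then show False using False by simp
  qed
  \<comment> \<open>Chosen so that the smallest coordinate of the point centre + s * e is centre *
    (1 - Y); its depth is then the norm Y of y.\<close>
  define s where "s = - Y / ((real d + 1) * \<mu>)"
  have s: "s > 0" unfolding s_def using Y \<mu> by (simp add: divide_less_0_iff mult_pos_neg zero_less_divide_iff mult_less_0_iff)
  have s\<mu>: "s * \<mu> = - Y * centre" 
  proof -
    define m where "m = (real d + 1) * \<mu>"
    have "m \<noteq> 0" unfolding m_def using \<mu> by simp
    then have "s * m = - Y" unfolding s_def m_def[symmetric] by simp
    then have "(real d + 1) * (s * \<mu>) = - Y" unfolding m_def by (simp add: mult_ac)
    then show ?thesis unfolding centre_def by (simp add: field_simps)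
  qed
  define x where "x v = (if v \<in> \<sigma> then centre + s * e (inv_into {..d} b v) else 0)" for v
  have xb: "x (b i) = centre + s * e i" if "i \<le> d" for i
    using that b_in b by (simp add: x_def bij_betw_inv_into_left)
  have x1: "x \<in> cell \<sigma>"
    unfolding cell_def
  proof (intro CollectI conjI allI impI)
    show "0 \<le> x v" for v
    proof (cases "v \<in> \<sigma>")
      case True
      then obtain i where i: "i \<le> d" "v = b i" using b_onto by blast
      have "s * \<mu> \<le> s * e i" using \<mu>le[OF i(1)] s by simp
      moreover have "Y * centre \<le> centre" using Y centre_pos by simp
      ultimately show ?thesis using xb i s\<mu> by simp
    qed (simp add: x_def)
    show "x v = 0" if "v \<notin> \<sigma>" for v using that by (simp add: x_def)
    have "sum x \<sigma> = (\<Sum>i\<le>d. x (b i))" using sum.reindex_bij_betw[OF b, of x] by simp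
    also have "\<dots> = (\<Sum>i\<le>d. centre + s * e i)" using xb by simp
    also have "\<dots> = (real d + 1) * centre + s * (\<Sum>i\<le>d. e i)"
      by (simp add: sum.distrib sum_distrib_left)
    also have "\<dots> = 1" using e0 centre_mult by simp
    finally show "sum x \<sigma> = 1" .
  qed
  have o: "offset x i = s * y i" if "i < d" for i using xb[of i] that by (simp add: offset_def e_def)
  have "(\<Sum>i<d. (offset x i)\<^sup>2) = s\<^sup>2 * (\<Sum>i<d. (y i)\<^sup>2)" using o by (simp add: power_mult_distrib sum_distrib_left)
  then have N: "offset_norm x = s * Y" using s by (simp add: offset_norm_def real_sqrt_mult Y_def)
  have "Min (x ` \<sigma>) = centre + s * \<mu>"
  proof (rule antisym)
    show "Min (x ` \<sigma>) \<le> centre + s * \<mu>" using Min_lower[OF b_in[OF i0(1)], of x] xb[OF i0(1)] i0 by simp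
    obtain v where v: "v \<in> \<sigma>" "x v = Min (x ` \<sigma>)" by (rule Min_attained)
    then obtain i where i: "i \<le> d" "v = b i" using b_onto by blast
    then show "centre + s * \<mu> \<le> Min (x ` \<sigma>)"
      using v xb[OF i(1)] mult_left_mono[OF \<mu>le[OF i(1)] less_imp_le[OF s]] by simp
  qed
  then have m: "Min (x ` \<sigma>) = centre - Y * centre" using s\<mu> by simp
  have "depth x = 1 - (real d + 1) * centre + (real d + 1) * centre * Y"
    unfolding depth_def m by (simp add: algebra_simps)
  then have g: "depth x = Y" using centre_mult by simp
  have "radial x = y"
  proof (rule ext)
    fix i show "radial x i = y i"
      using o[of i] N g s Y y by (cases "i < d") (auto simp: radial_def ball_points_def)
  qed
  then show ?thesis using x1 by blast
qed

text \<open>At the barycentre the quotient is useless, but every coordinate of the image is bounded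
  by the depth, which tends to 0 there.\<close>

lemma continuous_radial: "continuous_on (cell \<sigma>) radial"
proof (rule continuous_on_coordinatewise_then_product)
  fix i
  have cg: "continuous_on (cell \<sigma>) depth"
    unfolding depth_def[abs_def] by (intro continuous_intros continuous_on_Min_apply fin ne)
  have cn: "continuous_on (cell \<sigma>) offset_norm" and co: "continuous_on (cell \<sigma>) (\<lambda>x. offset x i)"
    unfolding offset_norm_def[abs_def] offset_def by (intro continuous_intros)+
  show "continuous_on (cell \<sigma>) (\<lambda>x. radial x i)"
  proof (cases "i < d")
    case True
    show ?thesis
      unfolding continuous_on_def
    proof
      fix x assume x: "x \<in> cell \<sigma>"
      have tg: "(depth \<longlongrightarrow> depth x) (at x within cell \<sigma>)"
        and tn: "(offset_norm \<longlongrightarrow> offset_norm x) (at x within cell \<sigma>)"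
        and to: "((\<lambda>x. offset x i) \<longlongrightarrow> offset x i) (at x within cell \<sigma>)"
        using cg cn co x unfolding continuous_on_def by blast+
      show "((\<lambda>x. radial x i) \<longlongrightarrow> radial x i) (at x within cell \<sigma>)"
      proof (cases "offset_norm x = 0")
        case False
        then show ?thesis unfolding radial_def using True tg tn to by (simp add: tendsto_intros)
      next
        case N: True
        then have g0: "depth x = 0" using offset_norm_zero_iff[OF x] by simp
        have "norm (radial z i) \<le> depth z" if z: "z \<in> cell \<sigma>" for z
        proof -
          have "(radial z i)\<^sup>2 \<le> (\<Sum>i<d. (radial z i)\<^sup>2)" using True by (intro member_le_sum) auto
          then have "(radial z i)\<^sup>2 \<le> (depth z)\<^sup>2" using radial_norm[OF z] by simp
          then have "\<bar>radial z i\<bar> \<le> \<bar>depth z\<bar>" by (rule abs_le_square_iff[THEN iffD2])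
          then show ?thesis using depth_bounds(1)[OF z] by simp
        qed
        then have "eventually (\<lambda>z. norm (radial z i) \<le> depth z) (at x within cell \<sigma>)"
          unfolding eventually_at_topological by blast
        then have "((\<lambda>z. radial z i) \<longlongrightarrow> 0) (at x within cell \<sigma>)"
          by (rule Lim_null_comparison) (use tg g0 in simp)
        moreover have "radial x i = 0" using N by (simp add: radial_def)
        ultimately show ?thesis by simp
      qed
    qed
  qed (simp add: radial_def)
qed

lemma homeomorphic_radial: "homeomorphic_map (top_of_set (cell \<sigma>)) (closed_ball d) radial"
  unfolding closed_ball_eq
proof (rule homeomorphic_map_compactI)
  show "compact (cell \<sigma>)" by (rule compact_cell[OF fin])
  show "radial ` cell \<sigma> = ball_points d" using radial_in_ball surj_radial by blast
qed (rule continuous_radial inj_radial)+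

end

text \<open>Invariant under attaching facets. The last clause describes the free ridges other than
  the root: a ridge of w not opposite to its newest vertex, across which no child is attached. These
  are the places where further facets can be glued.\<close>

definition boundary_tree :: "nat \<Rightarrow> nat list set \<Rightarrow> bool" where
  "boundary_tree d T \<longleftrightarrow> realization (tree_complex d T) homeomorphic_space closed_ball d \<and>
     (\<forall>\<rho>\<in>tree_complex d T. card \<rho> \<le> d - 1 \<longrightarrow> in_boundary d (tree_complex d T) \<rho>) \<and>
     in_boundary d (tree_complex d T) (set (root_list d)) \<and>
     (\<forall>w\<in>T. \<forall>j\<le>d. j \<noteq> last w \<longrightarrow> w @ [j] \<notin> T \<longrightarrow>
        in_boundary d (tree_complex d T) (word_simplex d w - {to_nat (node w j)}))"

lemma boundary_tree_single:
  assumes d: "d \<ge> 2"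
  shows "boundary_tree d {[0]}"
proof -
  let ?\<sigma> = "word_simplex d [0]" and ?K = "tree_complex d {[0]}"
  have T: "{[0]} \<in> trees d 0" unfolding trees_def by (auto simp: append_eq_Cons_conv)
  have K: "?K = {\<rho>. \<rho> \<noteq> {} \<and> \<rho> \<subseteq> ?\<sigma>}" unfolding tree_complex_nonempty_eq[OF T insert_not_empty] by simp
  have ac: "abstract_complex ?K" by (rule abstract_tree_complex[OF T])
  have "inj_on (\<lambda>i. to_nat (node [0] i)) {..d}"
    by (rule inj_onI) (metis last_node to_nat_split)
  then have "bij_betw (\<lambda>i. to_nat (node [0] i)) {..d} ?\<sigma>" by (simp add: bij_betw_def word_simplex_def)
  then interpret simplex_to_ball d ?\<sigma> "\<lambda>i. to_nat (node [0] i)"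
    using d by unfold_locales auto
  have sK: "?\<sigma> \<in> ?K" unfolding K using ne by blast
  have pts: "points ?K = cell ?\<sigma>"
  proof
    show "cell ?\<sigma> \<subseteq> points ?K" by (rule cell_subset_points[OF ac sK])
    show "points ?K \<subseteq> cell ?\<sigma>"
    proof
      fix x assume x: "x \<in> points ?K"
      then have "support x \<subseteq> ?\<sigma>" using K by (auto simp: points_def)
      then show "x \<in> cell ?\<sigma>" using points_in_cell[OF ac x _ fin] by blast
    qed
  qed
  have hom: "homeomorphic_map (realization ?K) (closed_ball d) radial"
    unfolding realization_eq pts by (rule homeomorphic_radial)
  have bd: "in_boundary d ?K \<rho>" if \<rho>: "\<rho> \<noteq> {}" "\<rho> \<subseteq> ?\<sigma>" "v \<in> ?\<sigma>" "v \<notin> \<rho>" for \<rho> v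
    unfolding in_boundary_def
  proof (intro conjI subsetI)
    show "\<rho> \<in> ?K" using K \<rho> by blast
    fix x assume "x \<in> {x \<in> topspace (realization ?K). support x \<subseteq> \<rho>}"
    then have x: "x \<in> points ?K" "support x \<subseteq> \<rho>" by auto
    then have "x v = 0" using \<rho>(4) by (auto simp: support_def)
    then have "radial x \<in> topspace (nsphere (d - 1))" using x pts \<rho>(3) radial_in_sphere by blast
    then show "x \<in> boundary_points d ?K" using x hom by (auto simp: boundary_points_def)
  qed
  show ?thesis
    unfolding boundary_tree_def
  proof (intro conjI ballI allI impI)
    show "realization ?K homeomorphic_space closed_ball d"
      using hom homeomorphic_map_imp_homeomorphic_space by blast
  next
    fix \<rho> assume r: "\<rho> \<in> ?K" "card \<rho> \<le> d - 1"
    then have "\<rho> \<noteq> {}" "\<rho> \<subseteq> ?\<sigma>" using K by auto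
    moreover have "\<rho> \<noteq> ?\<sigma>" using r(2) by auto
    ultimately show "in_boundary d ?K \<rho>" using bd by blast
  next
    have "to_nat [0::nat] \<in> ?\<sigma>" using node_in_word_simplex[of "[0]" 0 d "[0]"] by (simp add: node_def)
    moreover have "to_nat [0::nat] \<notin> set (root_list d)" by (auto simp: set_root_list)
    moreover have "set (root_list d) \<noteq> {}" using d by (auto simp: set_root_list)
    ultimately show "in_boundary d ?K (set (root_list d))" using bd root_subset_simplex[OF T] by blast
  next
    fix w j assume w: "w \<in> {[0::nat]}" "j \<le> d" "j \<noteq> last w"
    then have w0: "w = [0]" by simp
    have 1: "to_nat (node w j) \<in> ?\<sigma>" unfolding w0 using w(2) node_in_word_simplex by blast
    have "node w 0 \<noteq> node w j" using w by (metis last.simps last_node singletonD)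
    then have "to_nat (node w 0) \<in> ?\<sigma> - {to_nat (node w j)}"
      using node_in_word_simplex[of w 0 d w] w0 by simp
    then have 2: "?\<sigma> - {to_nat (node w j)} \<noteq> {}" by blast
    have "in_boundary d ?K (?\<sigma> - {to_nat (node w j)})"
      by (rule bd[OF 2 Diff_subset 1]) simp
    then show "in_boundary d ?K (word_simplex d w - {to_nat (node w j)})" unfolding w0 .
  qed
qed

text \<open>The new facet sits on a free boundary ridge F of w, so it can be absorbed with the
  vertex of colour j of w as the opposite apex. A simplex with at most d - 1 vertices cannot contain
  F; it is either an old simplex that the push does not move or a face of the new facet missing a
  vertex of F.\<close>

lemma boundary_tree_extend:
  assumes d: "d \<ge> 2" and T0: "T0 \<in> trees d 0" and T: "insert (w @ [j]) T0 \<in> trees d 0"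
    and w: "w \<in> T0" and new: "w @ [j] \<notin> T0" and bt: "boundary_tree d T0"
  shows "boundary_tree d (insert (w @ [j]) T0)"
proof -
  let ?w = "w @ [j]" and ?T = "insert (w @ [j]) T0"
  let ?F = "word_simplex d w - {to_nat (node w j)}"
  have w0: "w \<noteq> []" using wordD(1)[OF T0 w] .
  have j: "j \<le> d" using wordD(5)[OF T, of ?w] by simp
  have jl: "j \<noteq> last w" using wordD(3)[OF T, of ?w] w0 by (auto simp: distinct_adj_append_iff)
  have uin: "to_nat (node w j) \<in> word_simplex d w" using j node_in_word_simplex by blast
  have ins: "insert (to_nat (node w j)) ?F = word_simplex d w" using uin by blast
  have cF: "card ?F = d" using uin by simp
  have wF: "to_nat w \<in> ?F"
    using node_in_word_simplex[of w "last w" d w] wordD(5)[OF T0 w] node_last[OF w0] jl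
    by simp (metis last_node)
  have wr: "to_nat w \<notin> set (root_list d)" using wordD(2)[OF T0 w] by (auto simp: set_root_list)
  \<comment> \<open>By \<open>facet_words\<close> only w and its absent child could contain F, and
    the root lacks the newest vertex of w.\<close>
  have free: "\<rho> \<subseteq> insert (to_nat (node w j)) ?F" if \<rho>: "\<rho> \<in> tree_complex d T0" "?F \<subseteq> \<rho>" for \<rho>
  proof -
    have "\<not> \<rho> \<subseteq> set (root_list d)" using that(2) wF wr by blast
    then obtain x where x: "x \<in> T0" "\<rho> \<subseteq> word_simplex d x" using \<rho> unfolding tree_complex_def by blast
    then have "x = w \<or> x = ?w" using facet_words[OF T0 w x(1) j jl] that(2) by blast
    then show ?thesis using x new ins by auto
  qed
  have vnew: "to_nat ?w \<notin> vertices (tree_complex d T0)"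
    unfolding vertices_tree_complex[OF T0] using new wordD(2)[OF T, of ?w] w0 by auto
  interpret absorb "tree_complex d T0" ?F "to_nat (node w j)" "to_nat ?w"
  proof
    show "abstract_complex (tree_complex d T0)" by (rule abstract_tree_complex[OF T0])
    show "?F \<noteq> {}" using wF by blast
    show "insert (to_nat (node w j)) ?F \<in> tree_complex d T0"
      unfolding ins tree_complex_def using w uin by blast
  qed (use vnew free in auto)
  have ws: "word_simplex d ?w = insert (to_nat ?w) ?F" by (rule word_simplex_snoc[OF j])
  have KT: "K = tree_complex d ?T"
    unfolding K_def unfolding tree_complex_def using ws by auto
  from bt have b1: "realization (tree_complex d T0) homeomorphic_space closed_ball d"
    and b2: "\<forall>\<rho>\<in>tree_complex d T0. card \<rho> \<le> d - 1 \<longrightarrow> in_boundary d (tree_complex d T0) \<rho>"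
    and b3: "in_boundary d (tree_complex d T0) (set (root_list d))"
    and b4: "\<forall>w\<in>T0. \<forall>j\<le>d. j \<noteq> last w \<longrightarrow> w @ [j] \<notin> T0 \<longrightarrow>
        in_boundary d (tree_complex d T0) (word_simplex d w - {to_nat (node w j)})"
    unfolding boundary_tree_def by - (elim conjE, assumption)+
  have bF: "in_boundary d (tree_complex d T0) ?F" using b4 w j jl new by blast
  show ?thesis
    unfolding boundary_tree_def KT[symmetric]
  proof (intro conjI ballI allI impI)
    show "realization K homeomorphic_space closed_ball d"
      using homeomorphic_map_imp_homeomorphic_space[OF homeomorphic_push] b1 homeomorphic_space_trans by blast
  next
    fix \<rho> assume r: "\<rho> \<in> K" "card \<rho> \<le> d - 1"
    have finr: "finite \<rho>" using abstract_complexD(2)[OF K r(1)] .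
    have nF: "\<not> ?F \<subseteq> \<rho>" using card_mono[OF finr, of ?F] cF r(2) d by auto
    show "in_boundary d K \<rho>"
    proof (cases "\<rho> \<in> tree_complex d T0")
      case True
      then show ?thesis using b2 r(2) in_boundary_old nF by blast
    next
      case False
      then have r': "\<rho> \<noteq> {}" "\<rho> \<subseteq> insert (to_nat ?w) ?F" using r(1) unfolding K_def by auto
      obtain f where f: "f \<in> ?F" "f \<notin> \<rho>" using nF by blast
      then have "\<rho> \<subseteq> insert (to_nat ?w) ?F - {f}" using r' by blast
      then show ?thesis using in_boundary_subset[OF K in_boundary_new[OF bF f(1)]] r'(1) by blast
    qed
  next
    show "in_boundary d K (set (root_list d))" using in_boundary_old[OF b3] wF wr by blast
  next
    fix x i assume x: "x \<in> ?T" "i \<le> d" "i \<noteq> last x" "x @ [i] \<notin> ?T"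
    show "in_boundary d K (word_simplex d x - {to_nat (node x i)})"
    proof (cases "x = ?w")
      case True
      then have "i \<noteq> j" using x(3) by simp
      then have n: "node x i = node w i" unfolding True by (simp add: node_snoc)
      have "node w i \<noteq> node w j" using \<open>i \<noteq> j\<close> by (metis last_node)
      then have "to_nat (node w i) \<in> ?F" using node_in_word_simplex[of w i d w] x(2) by simp
      then show ?thesis unfolding n unfolding True ws by (rule in_boundary_new[OF bF])
    next
      case False
      then have xT: "x \<in> T0" "x @ [i] \<notin> T0" using x by auto
      have "\<not> ?F \<subseteq> word_simplex d x - {to_nat (node x i)}"
      proof
        assume s: "?F \<subseteq> word_simplex d x - {to_nat (node x i)}"
        then have "x = w \<or> x = ?w" using facet_words[OF T0 w xT(1) j jl] by blast
        then have xw: "x = w" using False by blast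
        then have "to_nat (node w i) \<notin> ?F" using s by blast
        then have "node w i = node w j" using node_in_word_simplex[of w i d w] x(2) by simp
        then have "i = j" by (metis last_node)
        then show False using x(4) xw by simp
      qed
      then show ?thesis using b4 xT x in_boundary_old by blast
    qed
  qed
qed

text \<open>A longest word is a leaf: removing it keeps the set closed under prefixes, and its facet
  is then attached last.\<close>

lemma boundary_tree:
  assumes d: "d \<ge> 2"
  shows "T \<in> trees d 0 \<Longrightarrow> T \<noteq> {} \<Longrightarrow> boundary_tree d T"
proof (induction "card T" arbitrary: T rule: less_induct)
  case less
  note T = less.prems(1)
  have fT: "finite T" by (rule tree_finite[OF T])
  have r: "[0] \<in> T" by (rule tree_nonempty_root[OF less.prems])
  show ?case
  proof (cases "T = {[0]}")
    case True
    then show ?thesis using boundary_tree_single[OF d] by simp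
  next
    case False
    have "Max (length ` T) \<in> length ` T" using fT less.prems(2) by (intro Max_in) auto
    then obtain v where v: "v \<in> T" "length v = Max (length ` T)" by auto
    have vmax: "length x \<le> length v" if "x \<in> T" for x unfolding v(2) using that fT by simp
    obtain w j where wj: "v = w @ [j]" using wordD(1)[OF T v(1)] by (metis append_butlast_last_id)
    have w: "w \<noteq> []"
    proof
      assume "w = []"
      then have l: "length x \<le> 1" if "x \<in> T" for x using vmax[OF that] wj by simp
      have "x = [0]" if "x \<in> T" for x
        using l[OF that] wordD(1,2)[OF T that] by (cases x) auto
      then show False using False r by blast
    qed
    let ?T0 = "T - {v}"
    have wT: "w \<in> ?T0" using tree_prefix[OF T] v(1) w wj by auto
    have T0: "?T0 \<in> trees d 0"
      unfolding trees_def
    proof (intro CollectI conjI ballI allI impI)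
      fix x i assume a: "x @ [i] \<in> ?T0 \<and> x \<noteq> []"
      then have "length (x @ [i]) \<le> length v" using vmax by blast
      then have "x \<noteq> v" by auto
      then show "x \<in> ?T0" using a tree_prefix[OF T] by blast
    qed (use fT wordD[OF T] in auto)
    have ins: "insert (w @ [j]) ?T0 = T" using v(1) wj by blast
    have "card ?T0 < card T" using fT v(1) by (rule card_Diff1_less)
    then have "boundary_tree d ?T0" using less.hyps T0 wT by blast
    then show ?thesis using boundary_tree_extend[OF d T0, of w j] T wT wj unfolding ins by auto
  qed
qed

lemma rooted_fuss_catalan_tree_complex:
  assumes d: "d \<ge> 2" and T: "T \<in> trees d 0"
  shows "rooted_fuss_catalan d (card T) (tree_complex d T, root_list d)"
proof (cases "T = {}")
  case True
  then have "tree_complex d T = {\<sigma>. \<sigma> \<subseteq> set (root_list d) \<and> \<sigma> \<noteq> {}}" by (auto simp: tree_complex_def)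
  then show ?thesis using True by (simp add: rooted_fuss_catalan_def)
next
  case False
  then have c: "card T \<noteq> 0" using tree_finite[OF T] by simp
  have bt: "boundary_tree d T" by (rule boundary_tree[OF d T False])
  have "card \<sigma> \<le> d + 1" if \<sigma>: "\<sigma> \<in> tree_complex d T" for \<sigma>
  proof -
    obtain w where "\<sigma> \<subseteq> word_simplex d w" using \<sigma> unfolding tree_complex_nonempty_eq[OF T False] by blast
    then show ?thesis using card_mono[of "word_simplex d w" \<sigma>] by simp
  qed
  then show ?thesis
    using bt c card_tree_complex_facets[OF T] abstract_tree_complex[OF T]
    unfolding rooted_fuss_catalan_def fuss_catalan_complex_def boundary_tree_def by simp
qed

section \<open>The interior of a ball complex\<close>

definition euclid :: "nat \<Rightarrow> (nat \<Rightarrow> real) set" where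
  "euclid d = {x. \<forall>i\<ge>d. x i = 0}"

definition open_ball :: "nat \<Rightarrow> (nat \<Rightarrow> real) set" where
  "open_ball d = {x \<in> euclid d. (\<Sum>i<d. (x i)\<^sup>2) < 1}"

definition segment :: "('v \<Rightarrow> real) \<Rightarrow> ('v \<Rightarrow> real) \<Rightarrow> real \<Rightarrow> 'v \<Rightarrow> real" where
  "segment a b t = (\<lambda>v. (1 - t) * a v + t * b v)"

definition bary :: "'v set \<Rightarrow> 'v \<Rightarrow> real" where
  "bary \<sigma> = (\<lambda>v. if v \<in> \<sigma> then 1 / real (card \<sigma>) else 0)"

lemma Euclidean_space_eq: "Euclidean_space d = top_of_set (euclid d)"
  by (simp add: Euclidean_space_def euclidean_product_topology euclid_def)

lemma ball_points_euclid: "ball_points d \<subseteq> euclid d"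
  by (auto simp: ball_points_def euclid_def)

lemma open_ball_subset: "open_ball d \<subseteq> ball_points d"
  by (auto simp: ball_points_def open_ball_def euclid_def)

lemma openin_open_ball: "openin (top_of_set (euclid d)) (open_ball d)"
proof -
  have "open {x :: nat \<Rightarrow> real. (\<Sum>i<d. (x i)\<^sup>2) < 1}"
    by (intro open_Collect_less continuous_intros)
  moreover have "open_ball d = euclid d \<inter> {x. (\<Sum>i<d. (x i)\<^sup>2) < 1}" by (auto simp: open_ball_def)
  ultimately show ?thesis by (simp add: openin_open_Int)
qed

lemma invariance_of_domain_euclid:
  assumes "openin (top_of_set (euclid d)) W" "continuous_on W f" "f ` W \<subseteq> euclid d" "inj_on f W"
  shows "openin (top_of_set (euclid d)) (f ` W)"
proof -
  have W: "W \<subseteq> euclid d" using openin_imp_subset[OF assms(1)] .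
  have "continuous_map (subtopology (Euclidean_space d) W) (Euclidean_space d) f"
    using assms(2,3) W by (auto simp: Euclidean_space_eq subtopology_subtopology Int_absorb1)
  then show ?thesis
    using invariance_of_domain_Euclidean_space[of d W f] assms(1,4) by (simp add: Euclidean_space_eq)
qed

text \<open>The form in which openness is exploited below: moving a little along a ray or a segment,
  with no metric on the function space.\<close>

lemma curve_enters_open:
  fixes \<gamma> :: "real \<Rightarrow> 'a::topological_space"
  assumes V: "openin (top_of_set X) V" and \<gamma>: "continuous_on S \<gamma>" "\<gamma> ` S \<subseteq> X" and t: "t \<in> S" "\<gamma> t \<in> V"
  obtains e where "e > 0" "\<And>t'. t' \<in> S \<Longrightarrow> \<bar>t' - t\<bar> < e \<Longrightarrow> \<gamma> t' \<in> V"
proof -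
  have "openin (top_of_set S) (S \<inter> \<gamma> -` V)"
    by (rule continuous_openin_preimage[OF \<gamma>(1) _ V]) (use \<gamma>(2) in auto)
  moreover have "t \<in> S \<inter> \<gamma> -` V" using t by simp
  ultimately obtain e where e: "e > 0" "\<forall>t'\<in>S. dist t' t < e \<longrightarrow> t' \<in> S \<inter> \<gamma> -` V"
    unfolding openin_euclidean_subtopology_iff by blast
  show ?thesis by (rule that[OF e(1)]) (use e(2) in \<open>auto simp: dist_real_def\<close>)
qed

lemma continuous_scale: "continuous_on S (\<lambda>t. \<lambda>i. t * y i :: real)"
  by (intro continuous_on_coordinatewise_then_product continuous_intros)

lemma continuous_segment: "continuous_on S (segment a b)"
  unfolding segment_def by (intro continuous_on_coordinatewise_then_product continuous_intros)

lemma sum_scale_square: "(\<Sum>i<d. (t * y i)\<^sup>2) = t\<^sup>2 * (\<Sum>i<d. (y i :: real)\<^sup>2)"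
  by (simp add: power_mult_distrib sum_distrib_left)

text \<open>A point of V on the sphere could be scaled by a factor slightly above 1 without leaving
  V, but that leaves the ball.\<close>

lemma open_subset_ball:
  assumes V: "openin (top_of_set (euclid d)) V" "V \<subseteq> ball_points d"
  shows "V \<subseteq> open_ball d"
proof
  fix y assume y: "y \<in> V"
  then have yb: "y \<in> ball_points d" using V by blast
  show "y \<in> open_ball d"
  proof (rule ccontr)
    assume "y \<notin> open_ball d"
    then have 1: "(\<Sum>i<d. (y i)\<^sup>2) = 1" using yb by (auto simp: open_ball_def ball_points_def euclid_def)
    have sub: "(\<lambda>t. \<lambda>i. t * y i) ` UNIV \<subseteq> euclid d" using yb by (auto simp: ball_points_def euclid_def)
    have "(\<lambda>i. 1 * y i) \<in> V" using y by simp
    then obtain e where e: "e > 0" "\<And>t'. t' \<in> UNIV \<Longrightarrow> \<bar>t' - 1\<bar> < e \<Longrightarrow> (\<lambda>i. t' * y i) \<in> V"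
      using curve_enters_open[OF V(1) continuous_scale sub UNIV_I] by blast
    have "(\<lambda>i. (1 + e / 2) * y i) \<in> V" using e by (intro e(2)) auto
    then have "(\<Sum>i<d. ((1 + e / 2) * y i)\<^sup>2) \<le> 1" using V(2) by (auto simp: ball_points_def)
    then have "(1 + e / 2)\<^sup>2 \<le> 1" unfolding sum_scale_square 1 by simp
    moreover have "(1 + e / 2)\<^sup>2 > 1" using e(1) by (simp add: one_less_power)
    ultimately show False by simp
  qed
qed

lemma bary_cell: "finite \<sigma> \<Longrightarrow> \<sigma> \<noteq> {} \<Longrightarrow> bary \<sigma> \<in> cell \<sigma>"
  by (auto simp: bary_def cell_def)

lemma support_bary: "finite \<sigma> \<Longrightarrow> \<sigma> \<noteq> {} \<Longrightarrow> support (bary \<sigma>) = \<sigma>"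
  by (auto simp: bary_def support_def)

lemma segment_cell:
  assumes "a \<in> cell \<sigma>" "b \<in> cell \<sigma>" "0 \<le> t" "t \<le> 1"
  shows "segment a b t \<in> cell \<sigma>"
proof -
  have "sum (segment a b t) \<sigma> = (1 - t) * sum a \<sigma> + t * sum b \<sigma>"
    by (simp add: segment_def sum.distrib sum_distrib_left)
  then show ?thesis using assms by (auto simp: cell_def segment_def)
qed

lemma segment_0 [simp]: "segment a b 0 = a" and segment_1 [simp]: "segment a b 1 = b"
  by (auto simp: segment_def)

lemma support_segment:
  assumes "\<And>v. 0 \<le> a v" "\<And>v. 0 \<le> b v" "0 < t" "t < 1"
  shows "support (segment a b t) = support a \<union> support b"
proof -
  have "(1 - t) * a v + t * b v = 0 \<longleftrightarrow> a v = 0 \<and> b v = 0" for v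
    using assms(1,2)[of v] assms(3,4) by (simp add: add_nonneg_eq_0_iff)
  then show ?thesis by (auto simp: support_def segment_def)
qed

lemma path_component_segment:
  assumes "\<And>t. 0 \<le> t \<Longrightarrow> t \<le> 1 \<Longrightarrow> segment a b t \<in> S"
  shows "path_component S a b"
  unfolding path_component_def
  using assms by (intro exI[of _ "segment a b"])
    (auto simp: path_def continuous_segment path_image_def pathstart_def pathfinish_def)

lemma connected_segments:
  fixes S :: "('v \<Rightarrow> real) set"
  assumes "\<And>a b t. a \<in> S \<Longrightarrow> b \<in> S \<Longrightarrow> 0 \<le> t \<Longrightarrow> t \<le> 1 \<Longrightarrow> segment a b t \<in> S"
  shows "connected S"
proof -
  have "path_connected S"
    unfolding path_connected_def
  proof (intro ballI)
    fix x y assume "x \<in> S" "y \<in> S"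
    then show "\<exists>g. path g \<and> path_image g \<subseteq> S \<and> pathstart g = x \<and> pathfinish g = y"
      using assms by (intro exI[of _ "segment x y"])
        (auto simp: path_def continuous_segment path_image_def pathstart_def pathfinish_def)
  qed
  then show ?thesis by (rule path_connected_imp_connected)
qed

text \<open>Convexity of the square in each coordinate; sums of squares stand for distances
  here.\<close>

lemma sum_square_segment:
  fixes a b p :: "nat \<Rightarrow> real"
  assumes "0 \<le> t" "t \<le> 1" "(\<Sum>i<d. (a i - p i)\<^sup>2) < c" "(\<Sum>i<d. (b i - p i)\<^sup>2) < c"
  shows "(\<Sum>i<d. (segment a b t i - p i)\<^sup>2) < c"
proof -
  have sq: "((1 - t) * x + t * y)\<^sup>2 \<le> (1 - t) * x\<^sup>2 + t * y\<^sup>2" for x y :: real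
  proof -
    have "(1 - t) * x\<^sup>2 + t * y\<^sup>2 - ((1 - t) * x + t * y)\<^sup>2 = t * (1 - t) * (x - y)\<^sup>2"
      by (simp add: power2_eq_square algebra_simps)
    moreover have "t * (1 - t) * (x - y)\<^sup>2 \<ge> 0" using assms(1,2) by simp
    ultimately show ?thesis by linarith
  qed
  have "segment a b t i - p i = (1 - t) * (a i - p i) + t * (b i - p i)" for i
    by (simp add: segment_def algebra_simps)
  then have "(\<Sum>i<d. (segment a b t i - p i)\<^sup>2) \<le> (\<Sum>i<d. (1 - t) * (a i - p i)\<^sup>2 + t * (b i - p i)\<^sup>2)"
    using sq by (intro sum_mono) simp
  also have "\<dots> = (1 - t) * (\<Sum>i<d. (a i - p i)\<^sup>2) + t * (\<Sum>i<d. (b i - p i)\<^sup>2)"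
    by (simp add: sum.distrib sum_distrib_left)
  also have "\<dots> < c" using assms by (intro convex_bound_lt) auto
  finally show ?thesis .
qed

lemma connected_open_ball: "connected (open_ball d)"
proof (rule connected_segments)
  fix a b and t :: real assume *: "a \<in> open_ball d" "b \<in> open_ball d" "0 \<le> t" "t \<le> 1"
  then have "(\<Sum>i<d. (segment a b t i - 0)\<^sup>2) < 1"
    by (intro sum_square_segment) (auto simp: open_ball_def)
  then show "segment a b t \<in> open_ball d" using * by (auto simp: open_ball_def euclid_def segment_def)
qed

text \<open>One homeomorphism h with inverse g is fixed, and U is the interior as h sees it,
  although \<open>in_boundary\<close> refers to arbitrary homeomorphisms.\<close>

locale ball_complex =
  fixes d :: nat and K :: "nat set set" and h :: "(nat \<Rightarrow> real) \<Rightarrow> nat \<Rightarrow> real" and g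
  assumes d: "d \<ge> 2" and K: "abstract_complex K"
    and dim: "\<sigma> \<in> K \<Longrightarrow> card \<sigma> \<le> d + 1"
    and hom: "homeomorphism (points K) (ball_points d) h g"
    and skeleton: "\<sigma> \<in> K \<Longrightarrow> card \<sigma> \<le> d - 1 \<Longrightarrow> in_boundary d K \<sigma>"
begin

definition U where "U = {x \<in> points K. h x \<in> open_ball d}"

lemma homD:
  shows "continuous_on (points K) h" "continuous_on (ball_points d) g"
    "x \<in> points K \<Longrightarrow> h x \<in> ball_points d" "y \<in> ball_points d \<Longrightarrow> g y \<in> points K"
    "x \<in> points K \<Longrightarrow> g (h x) = x" "y \<in> ball_points d \<Longrightarrow> h (g y) = y"
  using hom unfolding homeomorphism_def by blast+

lemma finite_simplex: "\<sigma> \<in> K \<Longrightarrow> finite \<sigma>" and simplex_nonempty: "\<sigma> \<in> K \<Longrightarrow> \<sigma> \<noteq> {}"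
  and simplex_subset: "\<sigma> \<in> K \<Longrightarrow> \<tau> \<subseteq> \<sigma> \<Longrightarrow> \<tau> \<noteq> {} \<Longrightarrow> \<tau> \<in> K"
  using abstract_complexD[OF K] by blast+

lemma U_points: "x \<in> U \<Longrightarrow> x \<in> points K"
  by (simp add: U_def)

lemma U_image: "U = g ` open_ball d"
proof (intro equalityI subsetI)
  fix x assume "x \<in> U"
  then show "x \<in> g ` open_ball d" using homD(5)[of x] by (auto simp: U_def intro: image_eqI[of _ _ "h x"])
next
  fix x assume "x \<in> g ` open_ball d"
  then show "x \<in> U" using homD(4,6) open_ball_subset by (auto simp: U_def) (metis subsetD)+
qed

lemma continuous_map_into_ball:
  assumes W: "openin (top_of_set (euclid d)) W" and f: "continuous_on W f" "f ` W \<subseteq> ball_points d" "inj_on f W"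
  shows "f ` W \<subseteq> open_ball d" "openin (top_of_set (euclid d)) (f ` W)"
proof -
  show o: "openin (top_of_set (euclid d)) (f ` W)"
    by (rule invariance_of_domain_euclid[OF W f(1) _ f(3)]) (use f(2) ball_points_euclid in blast)
  show "f ` W \<subseteq> open_ball d" by (rule open_subset_ball[OF o f(2)])
qed

text \<open>For another homeomorphism h', the composition of g and h' is continuous and injective on
  the open ball with values in the closed ball. By invariance of domain its image is open and thus
  misses the sphere, so h' cannot send an interior point to the sphere.\<close>

lemma boundary_not_interior:
  assumes "in_boundary d K \<sigma>" "x \<in> cell \<sigma>"
  shows "x \<notin> U"
proof
  assume xU: "x \<in> U"
  have "x \<in> boundary_points d K" using assms in_boundary_iff[OF K] by blast
  then obtain h' where h': "homeomorphic_map (realization K) (closed_ball d) h'" "h' x \<in> topspace (nsphere (d - 1))"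
    by (auto simp: boundary_points_def)
  then obtain g' where g': "homeomorphism (points K) (ball_points d) h' g'"
    unfolding realization_eq closed_ball_eq homeomorphic_map_top_of_set by blast
  have c: "continuous_on (open_ball d) (h' \<circ> g)"
  proof (rule continuous_on_compose)
    show "continuous_on (open_ball d) g" using homD(2) open_ball_subset continuous_on_subset by blast
    show "continuous_on (g ` open_ball d) h'"
      using g' U_points unfolding U_image[symmetric] homeomorphism_def by (blast intro: continuous_on_subset)
  qed
  have i: "inj_on (h' \<circ> g) (open_ball d)"
  proof (rule inj_on_inverseI[of _ "h \<circ> g'"])
    fix y assume "y \<in> open_ball d"
    then have "y \<in> ball_points d" using open_ball_subset by blast
    then show "(h \<circ> g') ((h' \<circ> g) y) = y" using g' homD(4,6) by (simp add: homeomorphism_def)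
  qed
  have "(h' \<circ> g) ` open_ball d \<subseteq> ball_points d"
    using g' U_points unfolding image_comp[symmetric] U_image[symmetric] homeomorphism_def by blast
  then have "(h' \<circ> g) ` open_ball d \<subseteq> open_ball d"
    by (rule continuous_map_into_ball(1)[OF openin_open_ball c _ i])
  moreover have "h' x \<in> (h' \<circ> g) ` open_ball d"
    using xU homD(5)[of x] by (auto simp: U_def intro!: image_eqI[of _ _ "h x"])
  ultimately have "h' x \<in> open_ball d" by blast
  moreover have "1 \<le> d" using d by simp
  ultimately show False using h'(2) unfolding topspace_sphere[OF \<open>1 \<le> d\<close>] by (simp add: open_ball_def)
qed

text \<open>Simplices of dimension at most d - 2 consist of boundary points; this is how condition
  (ii) enters.\<close>

lemma card_support_U:
  assumes "x \<in> U"
  shows "card (support x) \<ge> d"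
proof (rule ccontr)
  assume "\<not> card (support x) \<ge> d"
  moreover have s: "support x \<in> K" using U_points[OF assms] by (simp add: points_def)
  ultimately have "in_boundary d K (support x)" using skeleton by simp
  moreover have "x \<in> cell (support x)"
    using points_in_cell[OF K U_points[OF assms] order_refl] finite_simplex[OF s] by blast
  ultimately show False using boundary_not_interior assms by blast
qed

text \<open>Invariance of domain carried over to the complex by h. It recognizes interior points
  from barycentric coordinates alone, without knowing h.\<close>

lemma chart_open:
  assumes W: "openin (top_of_set (euclid d)) W" and \<psi>: "continuous_on W \<psi>" "\<psi> ` W \<subseteq> points K" "inj_on \<psi> W"
  shows "\<psi> ` W \<subseteq> U" "openin (top_of_set (points K)) (\<psi> ` W)"
proof -
  have c: "continuous_on W (h \<circ> \<psi>)"
    by (rule continuous_on_compose[OF \<psi>(1) continuous_on_subset[OF homD(1) \<psi>(2)]])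
  have s: "(h \<circ> \<psi>) ` W \<subseteq> ball_points d" using \<psi>(2) homD(3) by auto
  have i: "inj_on (h \<circ> \<psi>) W"
    by (rule comp_inj_on[OF \<psi>(3)]) (rule inj_on_inverseI[of _ g], use \<psi>(2) homD(5) in blast)
  note o = continuous_map_into_ball[OF W c s i]
  show "\<psi> ` W \<subseteq> U" using o(1) \<psi>(2) by (auto simp: U_def)
  have "openin (top_of_set (ball_points d)) ((h \<circ> \<psi>) ` W)"
    by (rule openin_subset_trans[OF o(2) s ball_points_euclid])
  then have "openin (top_of_set (points K)) (points K \<inter> h -` ((h \<circ> \<psi>) ` W))"
    by (rule continuous_openin_preimage[OF homD(1), rotated]) (use homD(3) in auto)
  moreover have "points K \<inter> h -` ((h \<circ> \<psi>) ` W) = \<psi> ` W"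
  proof (intro equalityI subsetI)
    fix x assume x: "x \<in> points K \<inter> h -` ((h \<circ> \<psi>) ` W)"
    then obtain w where w: "w \<in> W" "h x = h (\<psi> w)" by auto
    then have "x = \<psi> w" using x homD(5)[of x] homD(5)[of "\<psi> w"] \<psi>(2) by auto
    then show "x \<in> \<psi> ` W" using w by blast
  qed (use \<psi>(2) in auto)
  ultimately show "openin (top_of_set (points K)) (\<psi> ` W)" by simp
qed

text \<open>Shrinking h x slightly towards 0 produces interior points arbitrarily close to
  x.\<close>

lemma dense_U:
  assumes N: "openin (top_of_set (points K)) N" "x \<in> N"
  shows "\<exists>z\<in>N. z \<in> U"
proof -
  have x: "x \<in> points K" using openin_imp_subset[OF N(1)] N(2) by blast
  define y where "y = h x"
  have y: "y \<in> ball_points d" using homD(3)[OF x] by (simp add: y_def)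
  have y2: "(\<Sum>i<d. (y i)\<^sup>2) \<le> 1" using y by (simp add: ball_points_def)
  have sc: "(\<lambda>i. t * y i) \<in> ball_points d" if "t \<in> {0..1}" for t
  proof -
    have "t\<^sup>2 * (\<Sum>i<d. (y i)\<^sup>2) \<le> 1" using that y2 by (intro mult_le_one) (auto simp: power_le_one sum_nonneg)
    then show ?thesis using y by (simp add: ball_points_def sum_scale_square[symmetric])
  qed
  define \<gamma> where "\<gamma> t = g (\<lambda>i. t * y i)" for t
  have c: "continuous_on {0..1} \<gamma>"
    unfolding \<gamma>_def by (rule continuous_on_compose2[OF homD(2) continuous_scale]) (use sc in auto)
  have im: "\<gamma> ` {0..1} \<subseteq> points K" using sc homD(4) by (auto simp: \<gamma>_def)
  have "\<gamma> 1 \<in> N" using N(2) homD(5)[OF x] by (simp add: \<gamma>_def y_def)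
  then obtain e where e: "e > 0" "\<And>t'. t' \<in> {0..1} \<Longrightarrow> \<bar>t' - 1\<bar> < e \<Longrightarrow> \<gamma> t' \<in> N"
    using curve_enters_open[OF N(1) c im, of 1] by auto
  define t where "t = max (1/2) (1 - e / 2)"
  have t: "t \<in> {0..1}" "t < 1" "\<bar>t - 1\<bar> < e" using e(1) by (auto simp: t_def max_def)
  have "t\<^sup>2 * (\<Sum>i<d. (y i)\<^sup>2) \<le> t\<^sup>2" using y2 by (simp add: mult_left_le)
  also have "t\<^sup>2 < 1" using t by (simp add: abs_square_less_1)
  finally have "(\<lambda>i. t * y i) \<in> open_ball d"
    using y by (simp add: open_ball_def ball_points_def euclid_def sum_scale_square[symmetric])
  then have "\<gamma> t \<in> U" unfolding U_image \<gamma>_def by blast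
  then show ?thesis using e(2)[OF t(1,3)] by blast
qed

text \<open>
  For trivial \<open>P\<close> the set \<open>B\<close> is the open bipyramid over \<open>e\<close> with apexes \<open>u\<close> and \<open>v\<close>; for
  \<open>P t \<longleftrightarrow> t > 0\<close>, where \<open>v\<close> need not be a vertex, it is the open simplex spanned by \<open>e\<close> and \<open>u\<close>.
\<close>

lemma bipyramid_chart:
  assumes e: "finite e" "card e = d" and uv: "u \<notin> e" "v \<notin> e" "u \<noteq> v"
    and B: "B \<subseteq> points K" "\<And>x. x \<in> B \<longleftrightarrow> (\<forall>w. 0 \<le> x w) \<and> (x u = 0 \<or> x v = 0) \<and> (\<forall>w\<in>e. 0 < x w) \<and>
        (\<forall>w. w \<notin> e \<and> w \<noteq> u \<and> w \<noteq> v \<longrightarrow> x w = 0) \<and> x u + x v + sum x e = 1 \<and> P (x u - x v)"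
    and P: "open {t. P t}"
  shows "B \<subseteq> U" "openin (top_of_set (points K)) B"
proof -
  \<comment> \<open>Chart coordinates: the barycentric coordinates at d - 1 vertices of e, followed
    by x u - x v. Since x u or x v is 0, this difference determines both, and the coordinate at the
    remaining vertex z of e follows from the sum.\<close>
  define m where "m = d - 1"
  have dm: "d = Suc m" using d by (simp add: m_def)
  obtain b where b: "bij_betw b {..<d} e"
    using ex_bij_betw_nat_finite[OF e(1)] e(2) by (auto simp: lessThan_atLeast0)
  define z where "z = b m"
  define W where "W = {w \<in> euclid d. (\<forall>i<m. 0 < w i) \<and> 0 < 1 - \<bar>w m\<bar> - (\<Sum>i<m. w i) \<and> P (w m)}"
  define \<psi> where "\<psi> w x = (if x = u then max (w m) 0 else if x = v then max (- w m) 0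
      else if x = z then 1 - \<bar>w m\<bar> - (\<Sum>i<m. w i) else if x \<in> e then w (inv_into {..<d} b x) else 0)"
    for w :: "nat \<Rightarrow> real" and x
  define co where "co x i = (if i < m then x (b i) else if i = m then x u - x v else 0)" for x :: "nat \<Rightarrow> real" and i
  have bi: "b i \<in> e" "b i \<noteq> u" "b i \<noteq> v" "inv_into {..<d} b (b i) = i" if "i < d" for i
    using b that uv by (auto simp: bij_betw_def inv_into_f_f)
  have bz: "b i \<noteq> z" if "i < m" for i
    unfolding z_def using bi(4)[of i] bi(4)[of m] that dm by auto
  have ze: "z \<in> e" "z \<noteq> u" "z \<noteq> v" unfolding z_def using bi dm by auto
  have be: "\<exists>i<d. x = b i" if "x \<in> e" for x using b that by (auto simp: bij_betw_def)
  have sum_e: "sum x e = (\<Sum>i<m. x (b i)) + x z" for x :: "nat \<Rightarrow> real"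
  proof -
    have "sum x e = (\<Sum>i<d. x (b i))" using sum.reindex_bij_betw[OF b, of x] by simp
    then show ?thesis by (simp add: dm z_def)
  qed
  have \<psi>b: "\<psi> w (b i) = w i" if "i < m" for w i
    using that bz[OF that] bi[of i] dm by (simp add: \<psi>_def)
  have \<psi>z: "\<psi> w z = 1 - \<bar>w m\<bar> - (\<Sum>i<m. w i)" for w using ze by (simp add: \<psi>_def)
  have \<psi>uv: "\<psi> w u = max (w m) 0" "\<psi> w v = max (- w m) 0" for w using uv by (auto simp: \<psi>_def)
  have \<psi>B: "\<psi> w \<in> B" if w: "w \<in> W" for w
  proof -
    have pos: "0 < \<psi> w x" if xe: "x \<in> e" for x
    proof -
      obtain i where i: "i < d" "x = b i" using be[OF xe] by blast
      then show ?thesis using w \<psi>b[of i w] \<psi>z[of w] by (cases "i = m") (auto simp: W_def z_def dm)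
    qed
    have "sum (\<psi> w) e = 1 - \<bar>w m\<bar>" unfolding sum_e \<psi>z using \<psi>b by simp
    then have "\<psi> w u + \<psi> w v + sum (\<psi> w) e = 1" unfolding \<psi>uv by (simp add: max_def abs_if)
    moreover have o: "\<psi> w x = 0" if "x \<notin> e" "x \<noteq> u" "x \<noteq> v" for x using that ze by (auto simp: \<psi>_def)
    moreover have "0 \<le> \<psi> w x" for x
      using pos[of x] o[of x] \<psi>uv[of w] by (cases "x \<in> e"; cases "x = u"; cases "x = v") auto
    moreover have "P (\<psi> w u - \<psi> w v)" using w unfolding \<psi>uv by (auto simp: W_def max_def)
    moreover have "\<psi> w u = 0 \<or> \<psi> w v = 0" unfolding \<psi>uv by auto
    ultimately show ?thesis unfolding B(2) using pos by blast
  qed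
  have cp: "co (\<psi> w) = w" if "w \<in> W" for w
  proof (rule ext)
    fix i show "co (\<psi> w) i = w i"
      using that \<psi>b[of i w] \<psi>uv[of w] dm by (cases "i < m"; cases "i = m") (auto simp: co_def W_def euclid_def)
  qed
  have co_inv: "co x \<in> W \<and> \<psi> (co x) = x" if xB: "x \<in> B" for x
  proof -
    from xB have x: "\<And>w. 0 \<le> x w" "x u = 0 \<or> x v = 0" "\<And>w. w \<in> e \<Longrightarrow> 0 < x w"
      "\<And>w. w \<notin> e \<Longrightarrow> w \<noteq> u \<Longrightarrow> w \<noteq> v \<Longrightarrow> x w = 0" "x u + x v + sum x e = 1" "P (x u - x v)"
      unfolding B(2) by auto
    have ab: "\<bar>x u - x v\<bar> = x u + x v" using x(1)[of u] x(1)[of v] x(2) by auto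
    have s: "(\<Sum>i<m. co x i) = (\<Sum>i<m. x (b i))" by (simp add: co_def)
    have zz: "1 - \<bar>co x m\<bar> - (\<Sum>i<m. co x i) = x z"
      using x(5) ab unfolding s sum_e by (simp add: co_def)
    have "co x \<in> W"
      unfolding W_def using zz x(3)[OF ze(1)] x(3)[OF bi(1)] x(6) dm by (auto simp: euclid_def co_def)
    moreover have "\<psi> (co x) y = x y" for y
    proof -
      consider "y = u" | "y = v" | "y = z" | i where "i < m" "y = b i" | "y \<notin> e" "y \<noteq> u" "y \<noteq> v"
        using be[of y] dm z_def by (metis less_Suc_eq)
      then show ?thesis
      proof cases
        case 1 then show ?thesis using \<psi>uv x(1)[of u] x(1)[of v] x(2) by (auto simp: co_def)
      next
        case 2 then show ?thesis using \<psi>uv x(1)[of u] x(1)[of v] x(2) by (auto simp: co_def)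
      next
        case 3 then show ?thesis using \<psi>z zz by simp
      next
        case 4 then show ?thesis using \<psi>b by (simp add: co_def)
      next
        case 5 then show ?thesis using x(4) ze by (auto simp: \<psi>_def)
      qed
    qed
    ultimately show ?thesis by blast
  qed
  have "openin (top_of_set (euclid d)) W"
  proof -
    have "open ({w. \<forall>i\<in>{..<m}. 0 < w i} \<inter> {w :: nat \<Rightarrow> real. 0 < 1 - \<bar>w m\<bar> - (\<Sum>i<m. w i)} \<inter> (\<lambda>w. w m) -` {t. P t})"
    proof (intro open_Int)
      have "{w :: nat \<Rightarrow> real. \<forall>i\<in>{..<m}. 0 < w i} = (\<Inter>i\<in>{..<m}. {w. 0 < w i})" by auto
      then show "open {w :: nat \<Rightarrow> real. \<forall>i\<in>{..<m}. 0 < w i}"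
        by (simp only:) (intro open_INT finite_lessThan ballI open_Collect_less continuous_intros)
      show "open {w :: nat \<Rightarrow> real. 0 < 1 - \<bar>w m\<bar> - (\<Sum>i<m. w i)}"
        by (intro open_Collect_less continuous_intros)
      show "open ((\<lambda>w :: nat \<Rightarrow> real. w m) -` {t. P t})"
        by (rule open_vimage[OF P]) (intro continuous_intros)
    qed
    moreover have "W = euclid d \<inter> ({w. \<forall>i\<in>{..<m}. 0 < w i} \<inter> {w :: nat \<Rightarrow> real. 0 < 1 - \<bar>w m\<bar> - (\<Sum>i<m. w i)} \<inter> (\<lambda>w. w m) -` {t. P t})"
      by (auto simp: W_def)
    ultimately show ?thesis by (simp only: openin_open_Int)
  qed
  moreover have "continuous_on W \<psi>"
  proof (rule continuous_on_coordinatewise_then_product)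
    fix x show "continuous_on W (\<lambda>w. \<psi> w x)"
      unfolding \<psi>_def
      by (cases "x = u"; cases "x = v"; cases "x = z"; cases "x \<in> e") (simp; intro continuous_intros)+
  qed
  moreover have "\<psi> ` W = B"
    using \<psi>B co_inv by (auto simp: image_iff) (metis co_inv)
  moreover have "inj_on \<psi> W" by (rule inj_on_inverseI[of _ co]) (rule cp)
  ultimately show "B \<subseteq> U" "openin (top_of_set (points K)) B"
    using chart_open[of W \<psi>] B(1) by auto
qed

text \<open>Here the support is e, \<open>insert u e\<close> or \<open>insert v e\<close>: the open
  ridge together with the open simplices on its two sides.\<close>

definition bip where
  "bip e u v = {x \<in> points K. e \<subseteq> support x \<and> (support x \<subseteq> insert u e \<or> support x \<subseteq> insert v e)}"

lemma bip_open:
  assumes uK: "insert u e \<in> K" and vK: "insert v e \<in> K" and c: "card e = d"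
    and uv: "u \<notin> e" "v \<notin> e" "u \<noteq> v"
  shows "bip e u v \<subseteq> U" "openin (top_of_set (points K)) (bip e u v)"
proof -
  have fe: "finite e" using finite_simplex[OF uK] by simp
  have *: "x \<in> bip e u v \<longleftrightarrow> (\<forall>w. 0 \<le> x w) \<and> (x u = 0 \<or> x v = 0) \<and> (\<forall>w\<in>e. 0 < x w) \<and>
        (\<forall>w. w \<notin> e \<and> w \<noteq> u \<and> w \<noteq> v \<longrightarrow> x w = 0) \<and> x u + x v + sum x e = 1 \<and> True"
    (is "_ \<longleftrightarrow> ?R") for x
  proof
    assume x: "x \<in> bip e u v"
    then have p: "x \<in> points K" by (simp add: bip_def)
    have "support x \<subseteq> insert u (insert v e)" using x by (auto simp: bip_def)
    then have "sum x (insert u (insert v e)) = 1"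
      using sum_support_subset[of "insert u (insert v e)" x] pointsD(3)[OF p] fe by simp
    then have s: "x u + x v + sum x e = 1" using uv fe by simp
    have "0 < x w" if "w \<in> e" for w
      using x that pointsD(1)[OF p, of w] by (force simp: bip_def support_def less_le)
    moreover have "x u = 0 \<or> x v = 0" "w \<notin> e \<and> w \<noteq> u \<and> w \<noteq> v \<longrightarrow> x w = 0" for w
      using x uv by (auto simp: bip_def support_def)
    ultimately show ?R using s pointsD(1)[OF p] by auto
  next
    assume R: ?R
    then have R': "\<forall>w. 0 \<le> x w" "x u = 0 \<or> x v = 0" "\<forall>w\<in>e. 0 < x w"
       "\<forall>w. w \<notin> e \<and> w \<noteq> u \<and> w \<noteq> v \<longrightarrow> x w = 0" "x u + x v + sum x e = 1"
      by - (elim conjE, assumption)+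
    have x: "0 \<le> x w" "w \<in> e \<Longrightarrow> x w \<noteq> 0" "w \<notin> e \<Longrightarrow> w \<noteq> u \<Longrightarrow> w \<noteq> v \<Longrightarrow> x w = 0" for w
      using R'(1,3,4) by auto
    have es: "e \<subseteq> support x" using x(2) by (auto simp: support_def)
    have sub: "support x \<subseteq> insert u (insert v e)" using x(3) by (auto simp: support_def)
    have sub2: "support x \<subseteq> insert u e \<or> support x \<subseteq> insert v e"
      using R'(2) sub by (auto simp: support_def)
    have "support x \<noteq> {}" using es c d by auto
    then have "support x \<in> K" using sub2 simplex_subset[OF uK] simplex_subset[OF vK] by blast
    moreover have "(\<Sum>w\<in>support x. x w) = 1"
      using sum_support_subset[OF _ sub] R'(5) uv fe by simp
    ultimately show "x \<in> bip e u v" using x(1) es sub2 by (simp add: bip_def points_def)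
  qed
  have sub: "bip e u v \<subseteq> points K" by (auto simp: bip_def)
  show "bip e u v \<subseteq> U" "openin (top_of_set (points K)) (bip e u v)"
    using bipyramid_chart[OF fe c uv sub *] by auto
qed

lemma open_simplex_U:
  assumes s: "\<sigma> \<in> facets d K" and x: "x \<in> points K" "support x = \<sigma>"
  shows "x \<in> U"
proof -
  have sK: "\<sigma> \<in> K" "card \<sigma> = Suc d" using s by (auto simp: facets_def)
  then obtain u e where u: "\<sigma> = insert u e" "u \<notin> e" "card e = d" "finite e"
    by (metis card_Suc_eq finite_simplex finite_insert)
  \<comment> \<open>A fictitious second apex; the condition x u - x v > 0 cuts the bipyramid down to
    the open simplex \<sigma>.\<close>
  obtain v where v: "v \<notin> \<sigma>" using ex_new_if_finite[OF infinite_UNIV_nat finite_simplex[OF sK(1)]] by blast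
  define B where "B = {x \<in> points K. support x = \<sigma>}"
  have *: "x \<in> B \<longleftrightarrow> (\<forall>w. 0 \<le> x w) \<and> (x u = 0 \<or> x v = 0) \<and> (\<forall>w\<in>e. 0 < x w) \<and>
        (\<forall>w. w \<notin> e \<and> w \<noteq> u \<and> w \<noteq> v \<longrightarrow> x w = 0) \<and> x u + x v + sum x e = 1 \<and> 0 < x u - x v"
    (is "_ \<longleftrightarrow> ?R") for x
  proof
    assume "x \<in> B"
    then have p: "x \<in> points K" and sx: "support x = \<sigma>" by (auto simp: B_def)
    have "0 < x w" if "w \<in> \<sigma>" for w
      using that pointsD(1)[OF p, of w] sx[symmetric] by (simp add: support_iff less_le)
    moreover have "x w = 0" if "w \<notin> \<sigma>" for w using that sx[symmetric] by (simp add: support_iff)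
    moreover have "sum x \<sigma> = 1" using pointsD(3)[OF p] sx by simp
    ultimately show ?R using pointsD(1)[OF p] u v by auto
  next
    assume R: ?R
    then have R': "\<forall>w. 0 \<le> x w" "x u = 0 \<or> x v = 0" "\<forall>w\<in>e. 0 < x w"
       "\<forall>w. w \<notin> e \<and> w \<noteq> u \<and> w \<noteq> v \<longrightarrow> x w = 0" "x u + x v + sum x e = 1" "0 < x u - x v"
      by - (elim conjE, assumption)+
    have xv: "x v = 0" "0 < x u" using R'(2,6) R'(1)[rule_format, of v] by auto
    have sx: "support x = \<sigma>"
      unfolding u(1)
    proof (intro equalityI subsetI)
      fix w assume "w \<in> insert u e" then show "w \<in> support x" using xv R'(3) by (auto simp: support_def)
    next
      fix w assume "w \<in> support x" then show "w \<in> insert u e" using xv R'(4) by (auto simp: support_def)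
    qed
    moreover have "sum x \<sigma> = 1" using R'(5) xv u by simp
    ultimately show "x \<in> B" using R'(1) sK by (simp add: B_def points_def)
  qed
  have "open {t::real. 0 < t}" by (intro open_Collect_less continuous_intros)
  then have "B \<subseteq> U" using bipyramid_chart(1)[OF u(4,3,2) _ _ _ *] u v by (auto simp: B_def)
  then show ?thesis using x by (auto simp: B_def)
qed

text \<open>The open simplex of a maximal m is open in the complex, so it contains interior points
  and m has at least d vertices. With exactly d vertices, barycentric coordinates would map a
  nonempty open set of dimension d injectively into the hyperplane of sum 1. By invariance of domain
  the image is open, although rescaling a point leaves the hyperplane.\<close>

lemma pure:
  assumes "\<rho> \<in> K"
  shows "\<exists>\<sigma>\<in>facets d K. \<rho> \<subseteq> \<sigma>"
proof -
  obtain m where m: "m \<in> K" "\<rho> \<subseteq> m" "\<And>x. x \<in> K \<Longrightarrow> m \<subseteq> x \<Longrightarrow> x = m"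
    using finite_has_maximal2[OF abstract_complexD(1)[OF K] assms] by auto
  have fm: "finite m" "m \<noteq> {}" using finite_simplex simplex_nonempty m(1) by auto
  define N where "N = {x \<in> points K. support x = m}"
  have "N = points K \<inter> (\<Inter>v\<in>m. {x. 0 < x v})"
  proof (intro equalityI subsetI)
    fix x assume x: "x \<in> N"
    then have "0 < x v" if "v \<in> m" for v
      using that pointsD(1)[of x K v] by (auto simp: N_def support_def less_le)
    then show "x \<in> points K \<inter> (\<Inter>v\<in>m. {x. 0 < x v})" using x by (auto simp: N_def)
  next
    fix x assume x: "x \<in> points K \<inter> (\<Inter>v\<in>m. {x. 0 < x v})"
    then have "m \<subseteq> support x" by (auto simp: support_def)
    then show "x \<in> N" using x m(3) pointsD(2)[of x K] by (auto simp: N_def)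
  qed
  moreover have "open (\<Inter>v\<in>m. {x :: nat \<Rightarrow> real. 0 < x v})"
    by (intro open_INT fm ballI open_Collect_less continuous_intros)
  ultimately have oN: "openin (top_of_set (points K)) N" by (simp add: openin_open_Int)
  have "bary m \<in> N"
    using bary_cell[OF fm] support_bary[OF fm] cell_subset_points[OF K m(1)] by (auto simp: N_def)
  then obtain x where x: "x \<in> N" "x \<in> U" using dense_U[OF oN] by blast
  have cm: "card m \<ge> d" using card_support_U[OF x(2)] x(1) by (simp add: N_def)
  have "card m \<noteq> d"
  proof
    assume cd: "card m = d"
    define V where "V = h ` (N \<inter> U)"
    have "openin (top_of_set (ball_points d)) (h ` N)"
      by (rule homeomorphism_imp_open_map[OF hom oN])
    then obtain O' where O': "open O'" "h ` N = ball_points d \<inter> O'" by (auto simp: openin_open)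
    have "open_ball d \<inter> h ` N = open_ball d \<inter> O'" using O'(2) open_ball_subset by blast
    then have "openin (top_of_set (open_ball d)) (open_ball d \<inter> h ` N)"
      using O'(1) by (simp add: openin_open_Int)
    then have "openin (top_of_set (euclid d)) (open_ball d \<inter> h ` N)"
      using openin_open_ball openin_trans by blast
    moreover have "V = open_ball d \<inter> h ` N" unfolding V_def by (auto simp: U_def N_def)
    ultimately have oV: "openin (top_of_set (euclid d)) V" by simp
    obtain b where b: "bij_betw b {..<d} m"
      using ex_bij_betw_nat_finite[OF fm(1)] cd by (auto simp: lessThan_atLeast0)
    define f where "f y i = (if i < d then g y (b i) else 0)" for y i
    have Vb: "V \<subseteq> ball_points d" unfolding V_def U_def using open_ball_subset by auto
    have gV: "g y \<in> N" if "y \<in> V" for y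
      using that homD(5)[OF U_points] by (auto simp: V_def)
    have cg: "continuous_on V g" using homD(2) Vb continuous_on_subset by blast
    have cf: "continuous_on V f"
    proof (rule continuous_on_coordinatewise_then_product)
      fix i show "continuous_on V (\<lambda>y. f y i)"
        unfolding f_def using continuous_on_product_then_coordinatewise[OF cg] by (cases "i < d") auto
    qed
    have fi: "inj_on f V"
    proof (rule inj_onI)
      fix y y' assume y: "y \<in> V" "y' \<in> V" "f y = f y'"
      have "g y w = g y' w" for w
      proof (cases "w \<in> m")
        case True
        then obtain i where "i < d" "w = b i" using b by (auto simp: bij_betw_def)
        then show ?thesis using fun_cong[OF y(3), of i] by (simp add: f_def)
      next
        case False
        then have "w \<notin> support (g y)" "w \<notin> support (g y')" using gV y by (auto simp: N_def)
        then show ?thesis by (simp add: support_iff)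
      qed
      then have "g y = g y'" by auto
      then show "y = y'" using homD(6) y Vb by (metis subsetD)
    qed
    have fs: "(\<Sum>i<d. f y i) = 1" if "y \<in> V" for y
    proof -
      have "(\<Sum>i<d. f y i) = (\<Sum>i<d. g y (b i))" by (simp add: f_def)
      also have "\<dots> = sum (g y) m" using sum.reindex_bij_betw[OF b, of "g y"] by simp
      also have "\<dots> = 1" using gV[OF that] pointsD(3)[of "g y" K] by (auto simp: N_def)
      finally show ?thesis .
    qed
    have fe: "f ` V \<subseteq> euclid d" by (auto simp: f_def euclid_def)
    have o: "openin (top_of_set (euclid d)) (f ` V)"
      by (rule invariance_of_domain_euclid[OF oV cf fe fi])
    have xV: "h x \<in> V" using x by (auto simp: V_def)
    define y where "y = f (h x)"
    have sub: "(\<lambda>t. \<lambda>i. t * y i) ` UNIV \<subseteq> euclid d" by (auto simp: y_def f_def euclid_def)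
    have "(\<lambda>i. 1 * y i) \<in> f ` V" using xV by (simp add: y_def)
    then obtain e where e: "e > 0" "\<And>t'. t' \<in> UNIV \<Longrightarrow> \<bar>t' - 1\<bar> < e \<Longrightarrow> (\<lambda>i. t' * y i) \<in> f ` V"
      using curve_enters_open[OF o continuous_scale sub UNIV_I] by blast
    have "(\<lambda>i. (1 + e / 2) * y i) \<in> f ` V" using e by (intro e(2)) auto
    then obtain y' where y': "y' \<in> V" "(\<lambda>i. (1 + e / 2) * y i) = f y'" by blast
    have "(1 + e / 2) * y i = f y' i" for i using fun_cong[OF y'(2), of i] by simp
    then have "(\<Sum>i<d. (1 + e / 2) * y i) = 1" using fs[OF y'(1)] by simp
    moreover have "(\<Sum>i<d. (1 + e / 2) * y i) = (1 + e / 2) * (\<Sum>i<d. y i)" by (simp add: sum_distrib_left)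
    ultimately show False using fs[OF xV] e(1) by (simp add: y_def)
  qed
  then have "card m = d + 1" using cm dim[OF m(1)] by simp
  then show ?thesis using m by (auto simp: facets_def)
qed

section \<open>Ridges, dual paths and stars of vertices\<close>

lemma facetD:
  assumes "\<sigma> \<in> facets d K"
  shows "\<sigma> \<in> K" "card \<sigma> = Suc d" "finite \<sigma>" "\<sigma> \<noteq> {}"
  using assms finite_simplex simplex_nonempty by (auto simp: facets_def)

lemma facet_insert:
  assumes "\<sigma> \<in> facets d K" "e \<subseteq> \<sigma>" "card e = d"
  obtains u where "\<sigma> = insert u e" "u \<notin> e"
  by (rule insert_point[OF facetD(3)[OF assms(1)] assms(2)]) (use facetD(2) assms in auto)

lemma adjacent_facets:
  assumes "\<sigma> \<in> facets d K" "\<tau> \<in> facets d K" "\<sigma> \<noteq> \<tau>" "e \<subseteq> \<sigma>" "e \<subseteq> \<tau>" "card e = d"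
  obtains u v where "\<sigma> = insert u e" "u \<notin> e" "\<tau> = insert v e" "v \<notin> e" "u \<noteq> v"
    "bip e u v \<subseteq> U" "openin (top_of_set (points K)) (bip e u v)" "bary e \<in> bip e u v" "e \<in> K" "finite e" "e \<noteq> {}"
proof -
  obtain u where u: "\<sigma> = insert u e" "u \<notin> e" using facet_insert assms(1,4,6) by blast
  obtain v where v: "\<tau> = insert v e" "v \<notin> e" using facet_insert assms(2,5,6) by blast
  have uv: "u \<noteq> v" using u v assms(3) by auto
  have fe: "finite e" using facetD(3)[OF assms(1)] u by simp
  have ne: "e \<noteq> {}" using assms(6) d by auto
  have eK: "e \<in> K" using simplex_subset[OF facetD(1)[OF assms(1)] assms(4) ne] .
  have "insert u e \<in> K" "insert v e \<in> K" using facetD(1) assms(1,2) u v by auto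
  note bo = bip_open[OF this assms(6) u(2) v(2) uv]
  have "bary e \<in> bip e u v"
    using cell_subset_points[OF K eK] bary_cell[OF fe ne] support_bary[OF fe ne] by (auto simp: bip_def)
  then show ?thesis using that u v uv bo eK fe ne by blast
qed

text \<open>The segment from the barycentre of e to that of a third facet \<kappa> starts in the
  open bipyramid of the other two and must stay there for a while; but its points have support
  \<kappa> at once.\<close>

lemma two_facets:
  assumes "\<sigma> \<in> facets d K" "\<tau> \<in> facets d K" "\<kappa> \<in> facets d K" "card e = d" "e \<subseteq> \<sigma>" "e \<subseteq> \<tau>" "e \<subseteq> \<kappa>"
  shows "\<sigma> = \<tau> \<or> \<sigma> = \<kappa> \<or> \<tau> = \<kappa>"
proof (rule ccontr)
  assume "\<not> ?thesis"
  then have ne: "\<sigma> \<noteq> \<tau>" "\<kappa> \<noteq> \<sigma>" "\<kappa> \<noteq> \<tau>" by auto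
  obtain u v where uv: "\<sigma> = insert u e" "\<tau> = insert v e" 
    "openin (top_of_set (points K)) (bip e u v)" "bary e \<in> bip e u v" "e \<in> K" "finite e" "e \<noteq> {}"
    using adjacent_facets[OF assms(1,2) ne(1) assms(5,6,4)] by metis
  obtain w where w: "\<kappa> = insert w e" "w \<notin> e" using facet_insert assms(3,7,4) by blast
  have bk: "bary \<kappa> \<in> cell \<kappa>" "support (bary \<kappa>) = \<kappa>"
    using bary_cell support_bary facetD(3,4)[OF assms(3)] by auto
  have be: "bary e \<in> cell e" "support (bary e) = e" using bary_cell support_bary uv(6,7) by auto
  have "bary e \<in> cell \<kappa>" using be w uv(6) cellD[OF be(1)] by (intro cell_support) auto
  then have im: "segment (bary e) (bary \<kappa>) ` {0..1} \<subseteq> points K"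
    using segment_cell[OF _ bk(1)] cell_subset_points[OF K facetD(1)[OF assms(3)]] by auto
  obtain r where r: "r > 0" "\<And>t. t \<in> {0..1} \<Longrightarrow> \<bar>t - 0\<bar> < r \<Longrightarrow> segment (bary e) (bary \<kappa>) t \<in> bip e u v"
    using curve_enters_open[OF uv(3) continuous_segment im, of 0] uv(4) by auto
  define t where "t = min (1/2) (r / 2)"
  have t: "0 < t" "t < 1" "t < r" using r(1) by (auto simp: t_def min_def)
  have "support (segment (bary e) (bary \<kappa>) t) = support (bary e) \<union> support (bary \<kappa>)"
    by (rule support_segment) (use t in \<open>auto simp: bary_def\<close>)
  moreover have "segment (bary e) (bary \<kappa>) t \<in> bip e u v" using r(2)[of t] t by simp
  ultimately have "\<kappa> \<subseteq> insert u e \<or> \<kappa> \<subseteq> insert v e" using be bk by (auto simp: bip_def)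
  then show False using w ne uv by auto
qed

text \<open>Two different facets on e would make the barycentre of e an interior point.\<close>

lemma boundary_facet:
  assumes "\<sigma> \<in> facets d K" "\<tau> \<in> facets d K" "card e = d" "e \<subseteq> \<sigma>" "e \<subseteq> \<tau>" "in_boundary d K e"
  shows "\<sigma> = \<tau>"
proof (rule ccontr)
  assume "\<sigma> \<noteq> \<tau>"
  then obtain u v where "bip e u v \<subseteq> U" "bary e \<in> bip e u v" "finite e" "e \<noteq> {}"
    using adjacent_facets[OF assms(1,2) _ assms(4,5,3)] by metis
  then show False using boundary_not_interior[OF assms(6) bary_cell] by blast
qed

text \<open>The reachable and the unreachable facets give two closed sets covering V. A common point
  lies in two facets and, being interior, has at least d vertices in its support; so it lies in an
  open ridge met by V, across which reachability extends. Connectedness of V excludes such a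
  splitting.\<close>

lemma dual_path_through:
  assumes V: "connected V" "V \<subseteq> U" and \<sigma>: "\<sigma> \<in> facets d K" and \<tau>: "\<tau> \<in> facets d K"
    and x: "x \<in> V" "support x = \<sigma>" and y: "y \<in> V" "support y = \<tau>"
  shows "(\<sigma>, \<tau>) \<in> (dual_edges d (facets d K) (\<lambda>e. \<exists>z\<in>V. support z = e))\<^sup>*"
proof (rule ccontr)
  let ?R = "dual_edges d (facets d K) (\<lambda>e. \<exists>z\<in>V. support z = e)"
  assume no: "(\<sigma>, \<tau>) \<notin> ?R\<^sup>*"
  define C where "C = {\<kappa> \<in> facets d K. (\<sigma>, \<kappa>) \<in> ?R\<^sup>*}"
  define A where "A = (\<Union>\<kappa>\<in>C. cell \<kappa>)"
  define B where "B = (\<Union>\<kappa>\<in>facets d K - C. cell \<kappa>)"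
  have ff: "finite (facets d K)" using abstract_complexD(1)[OF K] by (simp add: facets_def)
  then have "closed A" "closed B"
    unfolding A_def B_def C_def by (intro closed_UN closed_cell ballI; simp)+
  moreover have "V \<subseteq> A \<union> B"
  proof
    fix z assume z: "z \<in> V"
    then have zp: "z \<in> points K" using V U_points by blast
    then obtain \<kappa> where k: "\<kappa> \<in> facets d K" "support z \<subseteq> \<kappa>" using pure[OF pointsD(2)] by blast
    then have "z \<in> cell \<kappa>" using points_in_cell[OF K zp k(2)] facetD(3) by blast
    then show "z \<in> A \<union> B" using k(1) by (auto simp: A_def B_def)
  qed
  moreover have "A \<inter> B \<inter> V = {}"
  proof (rule ccontr)
    assume "A \<inter> B \<inter> V \<noteq> {}"
    then obtain z \<kappa> \<kappa>' where z: "z \<in> V" and k: "\<kappa> \<in> C" "z \<in> cell \<kappa>" "\<kappa>' \<in> facets d K" "\<kappa>' \<notin> C" "z \<in> cell \<kappa>'"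
      by (auto simp: A_def B_def)
    have kf: "\<kappa> \<in> facets d K" "(\<sigma>, \<kappa>) \<in> ?R\<^sup>*" using k(1) by (auto simp: C_def)
    have sub: "support z \<subseteq> \<kappa> \<inter> \<kappa>'"
      using cellD(4)[OF k(2) facetD(3)[OF kf(1)]] cellD(4)[OF k(5) facetD(3)[OF k(3)]] by blast
    have cs: "card (support z) \<ge> d" using card_support_U z V by blast
    have fin: "finite (\<kappa> \<inter> \<kappa>')" using facetD(3)[OF kf(1)] by simp
    have "\<kappa> \<inter> \<kappa>' \<subset> \<kappa>"
    proof -
      have "\<not> \<kappa> \<subseteq> \<kappa>'"
      proof
        assume "\<kappa> \<subseteq> \<kappa>'"
        then have "\<kappa> = \<kappa>'" using facetD(2,3) kf(1) k(3) by (metis card_subset_eq)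
        then show False using k by simp
      qed
      then show ?thesis by blast
    qed
    from psubset_card_mono[OF facetD(3)[OF kf(1)] this]
    have "card (\<kappa> \<inter> \<kappa>') \<le> d" using facetD(2)[OF kf(1)] by simp
    moreover have "card (support z) \<le> card (\<kappa> \<inter> \<kappa>')" by (rule card_mono[OF fin sub])
    ultimately have "card (\<kappa> \<inter> \<kappa>') = d" "support z = \<kappa> \<inter> \<kappa>'"
      using cs card_subset_eq[OF fin sub] by auto
    then have "(\<kappa>, \<kappa>') \<in> ?R" using kf k z by (auto simp: dual_edges_def)
    then have "(\<sigma>, \<kappa>') \<in> ?R\<^sup>*" using kf(2) by simp
    then show False using k by (simp add: C_def)
  qed
  moreover have "x \<in> A"
  proof -
    have "x \<in> cell \<sigma>" using points_in_cell[OF K, of x \<sigma>] x V U_points facetD(3)[OF \<sigma>] by blast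
    then show ?thesis using \<sigma> by (auto simp: A_def C_def)
  qed
  moreover have "y \<in> B"
  proof -
    have "y \<in> cell \<tau>" using points_in_cell[OF K, of y \<tau>] y V U_points facetD(3)[OF \<tau>] by blast
    then show ?thesis using \<tau> no by (auto simp: B_def C_def)
  qed
  ultimately show False using V(1) x(1) y(1) unfolding connected_closed by blast
qed

lemma bary_facet:
  assumes "\<sigma> \<in> facets d K"
  shows "bary \<sigma> \<in> cell \<sigma>" "support (bary \<sigma>) = \<sigma>" "bary \<sigma> \<in> points K" "bary \<sigma> \<in> U"
proof -
  show 1: "bary \<sigma> \<in> cell \<sigma>" "support (bary \<sigma>) = \<sigma>"
    using bary_cell support_bary facetD(3,4)[OF assms] by auto
  then show "bary \<sigma> \<in> points K" using cell_subset_points[OF K facetD(1)[OF assms]] by blast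
  then show "bary \<sigma> \<in> U" using open_simplex_U[OF assms] 1 by blast
qed

lemma dual_connected:
  assumes "\<sigma> \<in> facets d K" "\<tau> \<in> facets d K"
  shows "(\<sigma>, \<tau>) \<in> (dual_edges d (facets d K) (\<lambda>_. True))\<^sup>*"
proof -
  have "connected U"
    unfolding U_image
    by (rule connected_continuous_image[OF continuous_on_subset[OF homD(2) open_ball_subset] connected_open_ball])
  then have "(\<sigma>, \<tau>) \<in> (dual_edges d (facets d K) (\<lambda>e. \<exists>z\<in>U. support z = e))\<^sup>*"
    using dual_path_through[OF _ order_refl assms] bary_facet assms by blast
  then show ?thesis using dual_edges_mono[of "\<lambda>e. \<exists>z\<in>U. support z = e" "\<lambda>_. True"] by blast
qed

text \<open>V comes from a small convex piece of the open ball near the image of v. It is connected,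
  it meets the open simplex of every facet at v, and it lies in the open star of v, so every ridge
  whose open simplex it meets contains v.\<close>

lemma star_connected:
  assumes \<sigma>: "\<sigma> \<in> facets d K" and \<tau>: "\<tau> \<in> facets d K" and v: "v \<in> \<sigma>" "v \<in> \<tau>"
  shows "(\<sigma>, \<tau>) \<in> (dual_edges d (facets d K) (\<lambda>e. v \<in> e))\<^sup>*"
proof -
  have vK: "{v} \<in> K" using simplex_subset[OF facetD(1)[OF \<sigma>], of "{v}"] v by simp
  define \<delta> where "\<delta> = bary {v}"
  have \<delta>: "\<delta> \<in> cell {v}" "support \<delta> = {v}" "\<delta> \<in> points K"
    using bary_cell[of "{v}"] support_bary[of "{v}"] cell_subset_points[OF K vK] by (auto simp: \<delta>_def)
  define p where "p = h \<delta>"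
  have p: "p \<in> ball_points d" using homD(3)[OF \<delta>(3)] by (simp add: p_def)
  define N where "N = points K \<inter> {x. 0 < x v}"
  have \<delta>N: "\<delta> \<in> N" using \<delta>(3) by (simp add: N_def \<delta>_def bary_def)
  have oN: "openin (top_of_set (points K)) N"
    unfolding N_def by (intro openin_open_Int open_Collect_less continuous_intros)
  have "openin (top_of_set (ball_points d)) (h ` N)" by (rule homeomorphism_imp_open_map[OF hom oN])
  then obtain O' where O': "open O'" "h ` N = ball_points d \<inter> O'" by (auto simp: openin_open)
  \<comment> \<open>Squared distance from the image of v. Compactness of the part of the ball
    outside O' turns openness in the product topology into a radius \<epsilon>.\<close>
  define D where "D y = (\<Sum>i<d. (y i - p i)\<^sup>2)" for y
  have cD: "continuous_on S D" for S unfolding D_def[abs_def] by (intro continuous_intros)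
  have D0: "0 \<le> D y" for y by (simp add: D_def sum_nonneg)
  have Dp: "y = p" if "y \<in> ball_points d" "D y = 0" for y
  proof (rule ext)
    fix i show "y i = p i"
      using that p by (cases "i < d") (auto simp: D_def ball_points_def sum_nonneg_eq_0_iff)
  qed
  have "\<exists>\<epsilon>>0. \<forall>y\<in>ball_points d. D y < \<epsilon> \<longrightarrow> y \<in> h ` N"
  proof (cases "ball_points d - O' = {}")
    case True
    then show ?thesis using O' by (intro exI[of _ 1]) auto
  next
    case False
    have "compact (ball_points d - O')" using compact_ball_points O'(1) by (rule compact_diff)
    then obtain y0 where y0: "y0 \<in> ball_points d - O'" "\<And>y. y \<in> ball_points d - O' \<Longrightarrow> D y0 \<le> D y"
      using continuous_attains_inf[OF _ False cD] by blast
    have "p \<in> O'" using O'(2) \<delta>N by (auto simp: p_def)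
    then have "D y0 \<noteq> 0" using Dp y0(1) by blast
    then have "D y0 > 0" using D0[of y0] by simp
    moreover have "y \<in> h ` N" if "y \<in> ball_points d" "D y < D y0" for y
      using y0(2)[of y] that O'(2) by fastforce
    ultimately show ?thesis by blast
  qed
  then obtain \<epsilon> where \<epsilon>: "\<epsilon> > 0" "\<And>y. y \<in> ball_points d \<Longrightarrow> D y < \<epsilon> \<Longrightarrow> y \<in> h ` N" by blast
  define B where "B = {y \<in> open_ball d. D y < \<epsilon>}"
  define V where "V = g ` B"
  have Bsub: "B \<subseteq> ball_points d" using open_ball_subset by (auto simp: B_def)
  have "connected B"
  proof (rule connected_segments)
    fix a b and t :: real assume *: "a \<in> B" "b \<in> B" "0 \<le> t" "t \<le> 1"
    have "(\<Sum>i<d. (segment a b t i - 0)\<^sup>2) < 1"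
      using * by (intro sum_square_segment) (auto simp: B_def open_ball_def)
    moreover have "D (segment a b t) < \<epsilon>"
      using * unfolding D_def by (intro sum_square_segment) (auto simp: B_def D_def)
    ultimately show "segment a b t \<in> B" using * by (auto simp: B_def open_ball_def euclid_def segment_def)
  qed
  then have conV: "connected V"
    unfolding V_def by (rule connected_continuous_image[OF continuous_on_subset[OF homD(2) Bsub]])
  have VU: "V \<subseteq> U" unfolding V_def U_image B_def by blast
  have VN: "V \<subseteq> N"
  proof
    fix z assume "z \<in> V"
    then obtain y where y: "y \<in> B" "z = g y" by (auto simp: V_def)
    then obtain n where n: "n \<in> N" "y = h n" using \<epsilon>(2)[of y] Bsub by (auto simp: B_def)
    then show "z \<in> N" using y homD(5)[of n] by (auto simp: N_def)
  qed
  have meets: "\<exists>x\<in>V. support x = \<kappa>" if \<kappa>: "\<kappa> \<in> facets d K" "v \<in> \<kappa>" for \<kappa>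
  proof -
    note bk = bary_facet[OF \<kappa>(1)]
    have "\<delta> \<in> cell \<kappa>"
      using \<delta> \<kappa>(2) cellD[OF \<delta>(1)] facetD(3)[OF \<kappa>(1)] by (intro cell_support) auto
    then have im: "segment \<delta> (bary \<kappa>) ` {0..1} \<subseteq> points K"
      using segment_cell[OF _ bk(1)] cell_subset_points[OF K facetD(1)[OF \<kappa>(1)]] by auto
    have "openin (top_of_set (points K)) (points K \<inter> (\<lambda>x. D (h x)) -` {..<\<epsilon>})"
      by (rule continuous_openin_preimage_gen[OF continuous_on_compose2[OF cD homD(1) subset_UNIV]]) simp
    moreover have "D (h \<delta>) = 0" by (simp add: D_def p_def)
    then have "segment \<delta> (bary \<kappa>) 0 \<in> points K \<inter> (\<lambda>x. D (h x)) -` {..<\<epsilon>}" using \<delta>(3) \<epsilon>(1) by simp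
    moreover have "0 \<in> {0..1::real}" by simp
    ultimately obtain r where r: "r > 0" "\<And>t. t \<in> {0..1} \<Longrightarrow> \<bar>t - 0\<bar> < r \<Longrightarrow>
        segment \<delta> (bary \<kappa>) t \<in> points K \<inter> (\<lambda>x. D (h x)) -` {..<\<epsilon>}"
      using curve_enters_open[OF _ continuous_segment im, of _ 0] by metis
    define t where "t = min (1/2) (r / 2)"
    have t: "0 < t" "t < 1" "t < r" using r(1) by (auto simp: t_def min_def)
    define x where "x = segment \<delta> (bary \<kappa>) t"
    have "support x = support \<delta> \<union> support (bary \<kappa>)"
      unfolding x_def by (rule support_segment) (use t in \<open>auto simp: bary_def \<delta>_def\<close>)
    then have sx: "support x = \<kappa>" unfolding \<delta>(2) bk(2) using \<kappa>(2) by auto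
    have xp: "x \<in> points K" "D (h x) < \<epsilon>" using r(2)[of t] t by (auto simp: x_def)
    have "x \<in> U" by (rule open_simplex_U[OF \<kappa>(1) xp(1) sx])
    then have "h x \<in> B" using xp by (simp add: B_def U_def)
    then have "x \<in> V" using homD(5)[OF xp(1)] unfolding V_def by (metis imageI)
    then show ?thesis using sx by blast
  qed
  obtain x where x: "x \<in> V" "support x = \<sigma>" using meets[OF \<sigma> v(1)] by blast
  obtain y where y: "y \<in> V" "support y = \<tau>" using meets[OF \<tau> v(2)] by blast
  from x y have "(\<sigma>, \<tau>) \<in> (dual_edges d (facets d K) (\<lambda>e. \<exists>z\<in>V. support z = e))\<^sup>*"
    by (rule dual_path_through[OF conV VU \<sigma> \<tau>])
  moreover have "v \<in> e" if "\<exists>z\<in>V. support z = e" for e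
    using that VN by (auto simp: N_def support_def)
  ultimately show ?thesis using dual_edges_mono[of "\<lambda>e. \<exists>z\<in>V. support z = e" "\<lambda>e. v \<in> e"] by blast
qed

end

section \<open>Facets of the interior separate\<close>

text \<open>The difference of two logarithms of the same function takes values in the integer
  multiples of 2 * pi * \<i>. This set is discrete, so the difference is constant on a connected
  set.\<close>

lemma exp_lift_diff:
  fixes S :: "real set" and f f' :: "real \<Rightarrow> complex"
  assumes S: "connected S" and f: "continuous_on S f" "continuous_on S f'"
    and eq: "\<And>x. x \<in> S \<Longrightarrow> exp (f x) = exp (f' x)" and xy: "x \<in> S" "y \<in> S"
  shows "f x - f' x = f y - f' y"
proof -
  have "(\<lambda>x. f x - f' x) constant_on S"
  proof (rule continuous_discrete_range_constant[OF S continuous_on_diff[OF f]])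
    fix x assume x: "x \<in> S"
    have "2 * pi \<le> norm ((f y - f' y) - (f x - f' x))" if y: "y \<in> S" "f y - f' y \<noteq> f x - f' x" for y
    proof -
      obtain m n :: int where mn: "f x = f' x + (of_int (2 * m) * pi) * \<i>" "f y = f' y + (of_int (2 * n) * pi) * \<i>"
        using eq[OF x] eq[OF y(1)] unfolding exp_eq by blast
      have d: "(f y - f' y) - (f x - f' x) = of_real (2 * pi * of_int (n - m)) * \<i>"
        unfolding mn by (simp add: algebra_simps)
      have "n \<noteq> m" using y(2) mn by auto
      then have "1 \<le> \<bar>real_of_int (n - m)\<bar>" by linarith
      then have "2 * pi * 1 \<le> 2 * pi * \<bar>real_of_int (n - m)\<bar>" by (intro mult_left_mono) auto
      then show ?thesis unfolding d norm_mult norm_of_real by (simp add: abs_mult)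
    qed
    then show "\<exists>e>0. \<forall>y. y \<in> S \<and> f y - f' y \<noteq> f x - f' x \<longrightarrow> e \<le> norm ((f y - f' y) - (f x - f' x))"
      by (intro exI[of _ "2 * pi"]) auto
  qed
  then show ?thesis using xy unfolding constant_on_def by metis
qed

context ball_complex
begin

text \<open>The interior is contractible, so a nowhere vanishing function has no monodromy along a loop.\<close>

lemma log_along_loop:
  fixes \<theta> :: "(nat \<Rightarrow> real) \<Rightarrow> complex"
  assumes \<theta>: "continuous_on U \<theta>" "\<And>x. x \<in> U \<Longrightarrow> \<theta> x \<noteq> 0"
    and \<gamma>: "path \<gamma>" "path_image \<gamma> \<subseteq> U" "\<gamma> 0 = \<gamma> 1"
  shows "\<exists>G. continuous_on {0..1} G \<and> (\<forall>t\<in>{0..1}. exp (G t) = \<theta> (\<gamma> t)) \<and> G 0 = G 1"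
proof -
  define Q where "Q = {0..1::real} \<times> {0..1::real}"
  define R where "R z = (\<lambda>i. fst z * h (\<gamma> (snd z)) i)" for z :: "real \<times> real"
  have \<gamma>U: "\<gamma> t \<in> U" if "t \<in> {0..1}" for t using \<gamma>(2) that by (auto simp: path_image_def)
  have c\<gamma>: "continuous_on {0..1} (\<lambda>t. h (\<gamma> t))"
    by (rule continuous_on_compose2[OF homD(1)]) (use \<gamma>(1) \<gamma>U U_points in \<open>auto simp: path_def\<close>)
  have cR: "continuous_on Q R"
    unfolding R_def
  proof (intro continuous_on_coordinatewise_then_product continuous_on_mult)
    fix i
    show "continuous_on Q fst" by (intro continuous_intros)
    have ci: "continuous_on {0..1} (\<lambda>t. h (\<gamma> t) i)"
      using continuous_on_product_then_coordinatewise[OF c\<gamma>] .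
    show "continuous_on Q (\<lambda>z. h (\<gamma> (snd z)) i)"
      by (rule continuous_on_compose2[OF ci]) (auto simp: Q_def intro!: continuous_intros)
  qed
  have Rb: "R z \<in> open_ball d" if z: "z \<in> Q" for z
  proof -
    obtain a b where ab: "z = (a, b)" by (cases z)
    then have "0 \<le> a" "a \<le> 1" "b \<in> {0..1}" using z by (auto simp: Q_def)
    then have o: "h (\<gamma> b) \<in> open_ball d" using \<gamma>U by (auto simp: U_def)
    have "a\<^sup>2 \<le> 1" using \<open>0 \<le> a\<close> \<open>a \<le> 1\<close> by (simp add: power_le_one)
    moreover have "0 \<le> (\<Sum>i<d. (h (\<gamma> b) i)\<^sup>2)" by (simp add: sum_nonneg)
    ultimately have "a\<^sup>2 * (\<Sum>i<d. (h (\<gamma> b) i)\<^sup>2) \<le> 1 * (\<Sum>i<d. (h (\<gamma> b) i)\<^sup>2)" by (rule mult_right_mono)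
    then have "(\<Sum>i<d. (a * h (\<gamma> b) i)\<^sup>2) < 1" using o by (simp add: sum_scale_square open_ball_def)
    then show ?thesis using o by (simp add: R_def ab open_ball_def euclid_def)
  qed
  define H where "H z = \<theta> (g (R z))" for z
  have "continuous_on Q (\<lambda>z. g (R z))"
    by (rule continuous_on_compose2[OF homD(2) cR]) (use Rb open_ball_subset in blast)
  moreover have gU: "g (R z) \<in> U" if "z \<in> Q" for z using Rb[OF that] unfolding U_image by blast
  ultimately have cH: "continuous_on Q H"
    unfolding H_def by (intro continuous_on_compose2[OF \<theta>(1)]) auto
  have H0: "H z \<noteq> 0" if "z \<in> Q" for z using \<theta>(2) gU[OF that] by (simp add: H_def)
  have "contractible Q" unfolding Q_def by (intro convex_imp_contractible convex_Times) auto
  then obtain L where L: "continuous_on Q L" "\<And>z. z \<in> Q \<Longrightarrow> H z = exp (L z)"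
    using continuous_logarithm_on_contractible[OF cH _ H0] by blast
  have cL1: "continuous_on {0..1} (\<lambda>t. L (a, t))" if "a \<in> {0..1}" for a
    by (rule continuous_on_compose2[OF L(1)]) (use that in \<open>auto simp: Q_def intro!: continuous_intros\<close>)
  have cL2: "continuous_on {0..1} (\<lambda>t. L (t, a))" if "a \<in> {0..1}" for a
    by (rule continuous_on_compose2[OF L(1)]) (use that in \<open>auto simp: Q_def intro!: continuous_intros\<close>)
  have con: "connected {0..1::real}" by simp
  \<comment> \<open>The loop shrunk by the factor a is closed for every a, so the change of L along
    it does not depend on a. At a = 0 the loop is constant and the change is 0.\<close>
  have "L (1, 1) - L (1, 0) = L (0, 1) - L (0, 0)"
  proof (rule exp_lift_diff[where f = "\<lambda>t. L (t, 1)" and f' = "\<lambda>t. L (t, 0)" and x = 1 and y = 0,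
        OF con cL2 cL2])
    fix t :: real assume "t \<in> {0..1}"
    then have "(t, 1) \<in> Q" "(t, 0) \<in> Q" by (auto simp: Q_def)
    then show "exp (L (t, 1)) = exp (L (t, 0))"
      using L(2)[of "(t, 1)"] L(2)[of "(t, 0)"] \<gamma>(3) by (simp add: H_def R_def)
  qed auto
  moreover have "L (0, 1) - L (0, 0) = L (0, 0) - L (0, 0)"
  proof (rule exp_lift_diff[where f = "\<lambda>t. L (0, t)" and f' = "\<lambda>_. L (0, 0)" and x = 1 and y = 0,
        OF con cL1 continuous_on_const])
    fix t :: real assume "t \<in> {0..1}"
    then have "(0, t) \<in> Q" "(0, 0) \<in> Q" by (auto simp: Q_def)
    then show "exp (L (0, t)) = exp (L (0, 0))"
      using L(2)[of "(0, t)"] L(2)[of "(0, 0)"] by (simp add: H_def R_def)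
  qed auto
  moreover have "exp (L (1, t)) = \<theta> (\<gamma> t)" if "t \<in> {0..1}" for t
  proof -
    have "(1, t) \<in> Q" using that by (auto simp: Q_def)
    then have "exp (L (1, t)) = \<theta> (g (h (\<gamma> t)))" using L(2)[of "(1, t)"] by (simp add: H_def R_def)
    then show ?thesis using homD(5)[OF U_points[OF \<gamma>U[OF that]]] by simp
  qed
  ultimately show ?thesis using cL1[of 1] by (intro exI[of _ "\<lambda>t. L (1, t)"]) auto
qed

end

text \<open>
  If the facets \<open>\<sigma>\<close> and \<open>\<tau>\<close> on both sides of \<open>e\<close> were also joined by a dual path avoiding \<open>e\<close>, the
  map to the circle that is constant away from \<open>e\<close> and turns once while crossing \<open>e\<close> would have
  nontrivial monodromy.
\<close>

locale crossing = ball_complex d K h g for d K h g +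
  fixes \<sigma> \<tau> e :: "nat set" and u v :: nat
  assumes \<sigma>: "\<sigma> \<in> facets d K" "\<sigma> = insert u e" "u \<notin> e" and \<tau>: "\<tau> \<in> facets d K" "\<tau> = insert v e" "v \<notin> e"
    and uv: "u \<noteq> v" and ce: "card e = d" and eU: "bary e \<in> U"
begin

definition low :: "(nat \<Rightarrow> real) \<Rightarrow> real" where "low x = Min (x ` e)"
definition A where "A = cell \<sigma> \<union> cell \<tau>"
text \<open>Measured in units of pi. It is 0 on the open ridge e, and it is saturated at 1 on
  \<sigma> where x u \<ge> low x and at -1 on \<tau> where x v \<ge> low x, thanks to the maximum in
  the denominator. The other ridges of \<sigma> and \<tau> miss a vertex of e, so \<open>low\<close>
  vanishes there and they belong to the saturated parts.\<close>

definition angle :: "(nat \<Rightarrow> real) \<Rightarrow> real" where "angle x = (x u - x v) / max (x u + x v) (low x)"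
definition turn :: "(nat \<Rightarrow> real) \<Rightarrow> complex" where "turn x = (if x \<in> A then cis (pi * angle x) else - 1)"

lemma fe: "finite e" "e \<noteq> {}"
  using facetD(3)[OF \<sigma>(1)] \<sigma>(2) ce d by auto

lemma low_le: "w \<in> e \<Longrightarrow> low x \<le> x w"
  using fe by (simp add: low_def)

lemma low_attained: "\<exists>w\<in>e. x w = low x"
proof -
  have "Min (x ` e) \<in> x ` e" by (rule Min_in) (use fe in auto)
  then show ?thesis unfolding low_def by fastforce
qed

lemma cell_sigma: "x \<in> cell \<sigma> \<Longrightarrow> x v = 0" and cell_tau: "x \<in> cell \<tau> \<Longrightarrow> x u = 0"
  using \<sigma> \<tau> uv by (auto simp: cell_def)

lemma A_nonneg: "x \<in> A \<Longrightarrow> 0 \<le> x w"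
  by (auto simp: A_def cell_def)

text \<open>A zero denominator would confine the support to e without one vertex, which is too small
  for an interior point.\<close>

lemma den_pos:
  assumes "x \<in> U" "x \<in> A"
  shows "0 < max (x u + x v) (low x)"
proof (rule ccontr)
  assume "\<not> ?thesis"
  then have a: "x u + x v \<le> 0" "low x \<le> 0" by auto
  then have z: "x u = 0" "x v = 0" using A_nonneg[OF assms(2), of u] A_nonneg[OF assms(2), of v] by auto
  obtain w where w: "w \<in> e" "x w = low x" using low_attained by blast
  then have "x w = 0" using a(2) A_nonneg[OF assms(2), of w] by simp
  then have "support x \<subseteq> e - {w}"
    using z assms(2) \<sigma>(2) \<tau>(2) unfolding A_def cell_def support_def by auto
  then have "card (support x) \<le> card (e - {w})" using fe by (intro card_mono) auto
  also have "\<dots> = d - 1" using w(1) ce by simp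
  finally show False using card_support_U[OF assms(1)] d by simp
qed

lemma angle_sigma:
  assumes "x \<in> U" "x \<in> cell \<sigma>" "low x \<le> x u"
  shows "angle x = 1"
  using den_pos[of x] assms cell_sigma[of x] by (auto simp: angle_def A_def max_def)

lemma angle_tau:
  assumes "x \<in> U" "x \<in> cell \<tau>" "low x \<le> x v"
  shows "angle x = - 1"
  using den_pos[of x] assms cell_tau[of x] by (auto simp: angle_def A_def max_def)

lemma turn_sigma: "x \<in> U \<Longrightarrow> x \<in> cell \<sigma> \<Longrightarrow> low x \<le> x u \<Longrightarrow> turn x = - 1"
  using angle_sigma by (simp add: turn_def A_def)

lemma turn_tau: "x \<in> U \<Longrightarrow> x \<in> cell \<tau> \<Longrightarrow> low x \<le> x v \<Longrightarrow> turn x = - 1"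
  using angle_tau by (simp add: turn_def A_def cis.ctr complex_eq_iff)

text \<open>No third facet contains e, so its common points with \<sigma> or \<tau> have low x \<le>
  0 and a saturated angle. This is what makes the gluing with the constant -1 continuous.\<close>

lemma turn_other:
  assumes "\<kappa> \<in> facets d K" "\<kappa> \<noteq> \<sigma>" "\<kappa> \<noteq> \<tau>" "x \<in> U" "x \<in> cell \<kappa>"
  shows "turn x = - 1"
proof (cases "x \<in> A")
  case True
  have "\<sigma> \<noteq> \<tau>" using \<sigma> \<tau> uv by auto
  then have "\<not> e \<subseteq> \<kappa>" using two_facets[OF \<sigma>(1) \<tau>(1) assms(1) ce] \<sigma>(2) \<tau>(2) assms(2,3) by blast
  then obtain w where w: "w \<in> e" "w \<notin> \<kappa>" by blast
  then have "x w = 0" using assms(5) by (simp add: cell_def)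
  then have l: "low x \<le> 0" using low_le[OF w(1), of x] by simp
  have "low x \<le> x u" "low x \<le> x v" using l A_nonneg[OF True, of u] A_nonneg[OF True, of v] by auto
  then show ?thesis using True turn_sigma turn_tau assms(4) by (auto simp: A_def)
qed (simp add: turn_def)

lemma continuous_angle: "continuous_on (U \<inter> A) angle"
  unfolding angle_def[abs_def]
proof (intro continuous_on_divide ballI)
  have "continuous_on (U \<inter> A) low"
    unfolding low_def[abs_def] by (rule continuous_on_Min_apply[OF fe])
  then show "continuous_on (U \<inter> A) (\<lambda>x. max (x u + x v) (low x))"
    by (intro continuous_on_max continuous_intros)
  show "max (x u + x v) (low x) \<noteq> 0" if "x \<in> U \<inter> A" for x using den_pos[of x] that by simp
qed (intro continuous_intros)

lemma continuous_turn: "continuous_on U turn"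
proof -
  define B where "B = (\<Union>\<kappa>\<in>facets d K - {\<sigma>, \<tau>}. cell \<kappa>)"
  have ff: "finite (facets d K)" using abstract_complexD(1)[OF K] by (simp add: facets_def)
  have cl: "closed A" "closed B" unfolding A_def B_def using ff by (auto intro!: closed_Un closed_cell closed_UN)
  have UAB: "U = (U \<inter> A) \<union> (U \<inter> B)"
  proof
    show "U \<subseteq> (U \<inter> A) \<union> (U \<inter> B)"
    proof
      fix z assume z: "z \<in> U"
      then obtain \<kappa> where k: "\<kappa> \<in> facets d K" "support z \<subseteq> \<kappa>" using pure[OF pointsD(2)[OF U_points]] by blast
      then have "z \<in> cell \<kappa>" using points_in_cell[OF K U_points[OF z] k(2)] facetD(3) by blast
      then show "z \<in> (U \<inter> A) \<union> (U \<inter> B)" using z k(1) by (auto simp: A_def B_def)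
    qed
  qed blast
  have "continuous_on ((U \<inter> A) \<union> (U \<inter> B)) (\<lambda>x. if x \<in> A then cis (pi * angle x) else - 1)"
  proof (rule continuous_on_cases_local)
    show "closedin (top_of_set ((U \<inter> A) \<union> (U \<inter> B))) (U \<inter> A)" "closedin (top_of_set ((U \<inter> A) \<union> (U \<inter> B))) (U \<inter> B)"
      unfolding UAB[symmetric] using cl by (auto intro: closedin_closed_Int)
    show "continuous_on (U \<inter> A) (\<lambda>x. cis (pi * angle x))"
      unfolding cis_conv_exp by (intro continuous_intros continuous_angle)
    show "cis (pi * angle x) = - 1" if "x \<in> U \<inter> A \<and> x \<notin> A \<or> x \<in> U \<inter> B \<and> x \<in> A" for x
    proof -
      have x: "x \<in> U" "x \<in> A" "x \<in> B" using that by auto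
      then obtain \<kappa> where "\<kappa> \<in> facets d K" "\<kappa> \<noteq> \<sigma>" "\<kappa> \<noteq> \<tau>" "x \<in> cell \<kappa>" by (auto simp: B_def)
      then have "turn x = - 1" using turn_other x(1) by blast
      then show ?thesis using x(2) by (simp add: turn_def)
    qed
  qed simp
  then show ?thesis unfolding UAB[symmetric] turn_def[abs_def] .
qed

lemma turn_nonzero: "turn x \<noteq> 0"
  by (simp add: turn_def)

lemma segment_in_U:
  assumes k: "\<kappa> \<in> facets d K" "f \<subseteq> \<kappa>" "f \<noteq> {}" "bary f \<in> U" and t: "0 \<le> t" "t \<le> 1"
  shows "segment (bary \<kappa>) (bary f) t \<in> U" "segment (bary \<kappa>) (bary f) t \<in> cell \<kappa>"
proof -
  have ff: "finite f" using facetD(3)[OF k(1)] k(2) finite_subset by blast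
  note bk = bary_facet[OF k(1)]
  have bf: "bary f \<in> cell f" "support (bary f) = f" using bary_cell support_bary ff k(3) by auto
  have "bary f \<in> cell \<kappa>" using bf k(2) cellD[OF bf(1) ff] facetD(3)[OF k(1)] by (intro cell_support) auto
  then show c: "segment (bary \<kappa>) (bary f) t \<in> cell \<kappa>" using segment_cell[OF bk(1)] t by blast
  show "segment (bary \<kappa>) (bary f) t \<in> U"
  proof (cases "t = 0 \<or> t = 1")
    case True
    then show ?thesis using bk(4) k(4) by auto
  next
    case False
    then have "support (segment (bary \<kappa>) (bary f) t) = support (bary \<kappa>) \<union> support (bary f)"
      using t by (intro support_segment) (auto simp: bary_def)
    then have "support (segment (bary \<kappa>) (bary f) t) = \<kappa>" unfolding bk(2) bf(2) using k(2) by auto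
    moreover have "segment (bary \<kappa>) (bary f) t \<in> points K"
      using c cell_subset_points[OF K facetD(1)[OF k(1)]] by blast
    ultimately show ?thesis by (intro open_simplex_U[OF k(1)])
  qed
qed

text \<open>Some vertex w of e is not in f. If \<kappa> is \<sigma> or \<tau>, the coordinate at w
  never exceeds the one at the apex over e, so the angle stays saturated along the segment.\<close>

lemma away_segment:
  assumes k: "\<kappa> \<in> facets d K" "f \<subseteq> \<kappa>" "card f = d" "f \<noteq> e" "bary f \<in> U"
  shows "path_component (U \<inter> {x. turn x = - 1}) (bary \<kappa>) (bary f)"
proof (rule path_component_segment)
  fix t :: real assume t: "0 \<le> t" "t \<le> 1"
  let ?x = "segment (bary \<kappa>) (bary f) t"
  have fne: "f \<noteq> {}" using k(3) d by auto
  note x = segment_in_U[OF k(1,2) fne k(5) t]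
  have lo: "\<exists>w\<in>e. ?x w \<le> ?x z" if z: "\<kappa> = insert z e" "z \<notin> e" for z
  proof -
    have fin: "finite f" using facetD(3)[OF k(1)] k(2) finite_subset by blast
    have "\<not> e \<subseteq> f" using card_subset_eq[OF fin, of e] ce k(3,4) by auto
    then obtain w where w: "w \<in> e" "w \<notin> f" by blast
    have "?x w = (1 - t) * (1 / real (card \<kappa>))" using w z by (simp add: segment_def bary_def)
    moreover have "?x z \<ge> (1 - t) * (1 / real (card \<kappa>))"
      using t z by (simp add: segment_def bary_def)
    ultimately show ?thesis using w(1) by (intro bexI[of _ w]) auto
  qed
  have "turn ?x = - 1"
  proof -
    consider "\<kappa> = \<sigma>" | "\<kappa> = \<tau>" | "\<kappa> \<noteq> \<sigma>" "\<kappa> \<noteq> \<tau>" by blast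
    then show ?thesis
    proof cases
      case 1
      then obtain w where "w \<in> e" "?x w \<le> ?x u" using lo[of u] \<sigma>(2,3) by blast
      then have "low ?x \<le> ?x u" using low_le[of w ?x] by simp
      then show ?thesis using turn_sigma x 1 by simp
    next
      case 2
      then obtain w where "w \<in> e" "?x w \<le> ?x v" using lo[of v] \<tau>(2,3) by blast
      then have "low ?x \<le> ?x v" using low_le[of w ?x] by simp
      then show ?thesis using turn_tau x 2 by simp
    next
      case 3
      then show ?thesis using turn_other[OF k(1)] x by simp
    qed
  qed
  then show "?x \<in> U \<inter> {x. turn x = - 1}" using x(1) by simp
qed

lemma away_path:
  assumes "(\<kappa>, \<kappa>') \<in> (dual_edges d (facets d K) (\<lambda>f. f \<noteq> e))\<^sup>*" "\<kappa> \<in> facets d K"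
  shows "path_component (U \<inter> {x. turn x = - 1}) (bary \<kappa>) (bary \<kappa>')"
  using assms
proof (induction rule: rtrancl_induct)
  case base
  have "\<exists>f. f \<subseteq> \<kappa> \<and> card f = d \<and> f \<noteq> e"
  proof -
    obtain a b where ab: "a \<in> \<kappa>" "b \<in> \<kappa>" "a \<noteq> b"
      using facetD(2,3)[OF base] d by (metis One_nat_def Suc_le_mono card_le_Suc0_iff_eq not_less_eq_eq numeral_2_eq_2 le_SucI)
    have "card (\<kappa> - {a}) = d" "card (\<kappa> - {b}) = d" using ab facetD(2,3)[OF base] by simp_all
    moreover have "\<kappa> - {a} \<noteq> \<kappa> - {b}" using ab by blast
    ultimately show ?thesis by (metis Diff_subset)
  qed
  have "turn (bary \<kappa>) = - 1"
  proof -
    have l: "low (bary \<kappa>) \<le> bary \<kappa> z" if "\<kappa> = insert z e" for z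
    proof -
      obtain w where "w \<in> e" using fe by blast
      then show ?thesis using low_le[of w "bary \<kappa>"] that by (simp add: bary_def)
    qed
    show ?thesis
      using turn_sigma[of "bary \<kappa>"] turn_tau[of "bary \<kappa>"] turn_other[OF base] bary_facet[OF base] l \<sigma>(2) \<tau>(2)
      by metis
  qed
  then show ?case using bary_facet(4)[OF base] by (simp add: path_component_refl)
next
  case (step y z)
  then have yz: "y \<in> facets d K" "z \<in> facets d K" "card (y \<inter> z) = d" "y \<inter> z \<noteq> e"
    by (auto simp: dual_edges_def)
  have ne: "y \<noteq> z" using yz(3) facetD(2)[OF yz(1)] by auto
  obtain a b where "bip (y \<inter> z) a b \<subseteq> U" "bary (y \<inter> z) \<in> bip (y \<inter> z) a b"
    by (rule adjacent_facets[OF yz(1,2) ne Int_lower1 Int_lower2 yz(3)])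
  then have bU: "bary (y \<inter> z) \<in> U" by blast
  have "path_component (U \<inter> {x. turn x = - 1}) (bary y) (bary (y \<inter> z))"
    by (rule away_segment[OF yz(1) Int_lower1 yz(3,4) bU])
  moreover have "path_component (U \<inter> {x. turn x = - 1}) (bary z) (bary (y \<inter> z))"
    by (rule away_segment[OF yz(2) Int_lower2 yz(3,4) bU])
  ultimately show ?case
    using step.IH[OF step.prems] by (meson path_component_sym path_component_trans)
qed

lemma across_path: "path_component (U \<inter> A) (bary \<tau>) (bary \<sigma>)"
proof -
  have "path_component (U \<inter> A) (bary \<tau>) (bary e)"
  proof (rule path_component_segment)
    fix t :: real assume t: "0 \<le> t" "t \<le> 1"
    have "e \<subseteq> \<tau>" using \<tau>(2) by blast
    from segment_in_U[OF \<tau>(1) this fe(2) eU t]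
    show "segment (bary \<tau>) (bary e) t \<in> U \<inter> A" unfolding A_def by blast
  qed
  moreover have "path_component (U \<inter> A) (bary \<sigma>) (bary e)"
  proof (rule path_component_segment)
    fix t :: real assume t: "0 \<le> t" "t \<le> 1"
    have "e \<subseteq> \<sigma>" using \<sigma>(2) by blast
    from segment_in_U[OF \<sigma>(1) this fe(2) eU t]
    show "segment (bary \<sigma>) (bary e) t \<in> U \<inter> A" unfolding A_def by blast
  qed
  ultimately show ?thesis by (meson path_component_sym path_component_trans)
qed

text \<open>Along the detour p the value of \<open>turn\<close> is constantly -1, so its logarithm G
  does not change. On the way back q, through e from \<tau> to \<sigma>, the angle goes from -1 to 1
  and G increases by 2 * pi * \<i>. But G has the same value at both ends of the loop.\<close>

lemma no_detour: "(\<sigma>, \<tau>) \<notin> (dual_edges d (facets d K) (\<lambda>f. f \<noteq> e))\<^sup>*"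
proof
  assume "(\<sigma>, \<tau>) \<in> (dual_edges d (facets d K) (\<lambda>f. f \<noteq> e))\<^sup>*"
  then obtain p where p: "path p" "path_image p \<subseteq> U \<inter> {x. turn x = - 1}" "pathstart p = bary \<sigma>" "pathfinish p = bary \<tau>"
    using away_path[OF _ \<sigma>(1)] unfolding path_component_def by blast
  obtain q where q: "path q" "path_image q \<subseteq> U \<inter> A" "pathstart q = bary \<tau>" "pathfinish q = bary \<sigma>"
    using across_path unfolding path_component_def by blast
  have "p t \<in> U \<inter> {x. turn x = - 1}" if "t \<in> {0..1}" for t using p(2) that unfolding path_image_def by blast
  then have pI: "p t \<in> U" "turn (p t) = - 1" if "t \<in> {0..1}" for t using that by simp_all
  have "q t \<in> U \<inter> A" if "t \<in> {0..1}" for t using q(2) that unfolding path_image_def by blast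
  then have qI: "q t \<in> U" "q t \<in> A" if "t \<in> {0..1}" for t using that by simp_all
  have j: "path (p +++ q)" using p q by simp
  have ji: "path_image (p +++ q) \<subseteq> U" using p q path_image_join_subset[of p q] by blast
  have jc: "(p +++ q) 0 = (p +++ q) 1" using p q by (simp add: joinpaths_def pathstart_def pathfinish_def)
  obtain G where G: "continuous_on {0..1} G" "\<And>t. t \<in> {0..1} \<Longrightarrow> exp (G t) = turn ((p +++ q) t)" "G 0 = G 1"
    using log_along_loop[OF continuous_turn turn_nonzero j ji jc] by blast
  have con: "connected {0..1::real}" by simp
  have G1: "continuous_on {0..1} (\<lambda>t. G (t / 2))" "continuous_on {0..1} (\<lambda>t. G ((1 + t) / 2))"
    by (rule continuous_on_compose2[OF G(1)]; auto intro!: continuous_intros)+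
  have "G (0 / 2) - \<i> * pi = G (1 / 2) - \<i> * pi"
  proof (rule exp_lift_diff[OF con G1(1) continuous_on_const])
    fix t :: real assume t: "t \<in> {0..1}"
    then have "exp (G (t / 2)) = turn (p t)" using G(2)[of "t / 2"] by (simp add: joinpaths_def)
    then show "exp (G (t / 2)) = exp (\<i> * pi)" using pI(2)[OF t] by (simp add: exp_pi_i mult.commute)
  qed auto
  then have 1: "G 0 = G (1 / 2)" by simp
  have bs: "low (bary \<sigma>) \<le> bary \<sigma> u" "low (bary \<tau>) \<le> bary \<tau> v"
  proof -
    obtain w where w: "w \<in> e" using fe by blast
    show "low (bary \<sigma>) \<le> bary \<sigma> u" "low (bary \<tau>) \<le> bary \<tau> v"
      using low_le[OF w, of "bary \<sigma>"] low_le[OF w, of "bary \<tau>"] w \<sigma>(2) \<tau>(2) by (auto simp: bary_def)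
  qed
  have a: "angle (q 0) = - 1" "angle (q 1) = 1"
    using angle_sigma[of "bary \<sigma>"] angle_tau[of "bary \<tau>"] bs bary_facet[OF \<sigma>(1)] bary_facet[OF \<tau>(1)] q(3,4)
    by (auto simp: pathstart_def pathfinish_def)
  have cq: "continuous_on {0..1} (\<lambda>t. angle (q t))"
    by (rule continuous_on_compose2[OF continuous_angle]) (use q(1) qI in \<open>auto simp: path_def\<close>)
  have "G ((1 + 0) / 2) - \<i> * of_real (pi * angle (q 0)) = G ((1 + 1) / 2) - \<i> * of_real (pi * angle (q 1))"
  proof (rule exp_lift_diff[OF con G1(2), of "\<lambda>t. \<i> * of_real (pi * angle (q t))"])
    show "continuous_on {0..1} (\<lambda>t. \<i> * complex_of_real (pi * angle (q t)))" by (intro continuous_intros cq)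
    fix t :: real assume t: "t \<in> {0..1}"
    have "(p +++ q) ((1 + t) / 2) = q t"
    proof (cases "t = 0")
      case True
      then show ?thesis using p(4) q(3) by (simp add: joinpaths_def pathstart_def pathfinish_def)
    next
      case False
      then have "(p +++ q) ((1 + t) / 2) = q (2 * ((1 + t) / 2) - 1)" using t by (simp add: joinpaths_def)
      also have "2 * ((1 + t) / 2) - 1 = t" by (simp add: field_simps)
      finally show ?thesis .
    qed
    then have "exp (G ((1 + t) / 2)) = turn (q t)" using G(2)[of "(1 + t) / 2"] t by simp
    then show "exp (G ((1 + t) / 2)) = exp (\<i> * of_real (pi * angle (q t)))"
      using qI[OF t] by (simp add: turn_def cis_conv_exp)
  qed auto
  then have "G (1 / 2) + \<i> * pi = G 1 - \<i> * pi" unfolding a by simp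
  then have "\<i> * complex_of_real pi = 0" using 1 G(3) by (simp add: algebra_simps)
  then show False by simp
qed

end

lemma (in ball_complex) bridge:
  assumes "\<sigma> \<in> facets d K" "\<tau> \<in> facets d K" "card (\<sigma> \<inter> \<tau>) = d"
  shows "(\<sigma>, \<tau>) \<notin> (dual_edges d (facets d K) (\<lambda>e. e \<noteq> \<sigma> \<inter> \<tau>))\<^sup>*"
proof -
  have ne: "\<sigma> \<noteq> \<tau>" using assms(3) facetD(2)[OF assms(1)] by auto
  obtain u v where *: "\<sigma> = insert u (\<sigma> \<inter> \<tau>)" "u \<notin> \<sigma> \<inter> \<tau>" "\<tau> = insert v (\<sigma> \<inter> \<tau>)" "v \<notin> \<sigma> \<inter> \<tau>" "u \<noteq> v"
    "bip (\<sigma> \<inter> \<tau>) u v \<subseteq> U" "bary (\<sigma> \<inter> \<tau>) \<in> bip (\<sigma> \<inter> \<tau>) u v"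
    by (rule adjacent_facets[OF assms(1,2) ne Int_lower1 Int_lower2 assms(3)])
  interpret crossing d K h g \<sigma> \<tau> "\<sigma> \<inter> \<tau>" u v
    by unfold_locales (use assms * in blast)+
  show ?thesis by (rule no_detour)
qed

lemma fuss_catalan_stacked:
  fixes K :: "nat set set"
  assumes d: "d \<ge> 2" and n: "n > 0" and fc: "rooted_fuss_catalan d n (K, r)"
  shows "stacked d K r" "card (facets d K) = n"
proof -
  from fc n have r: "distinct r" "length r = d" and F: "fuss_catalan_complex d n K" and rb: "in_boundary d K (set r)"
    by (auto simp: rooted_fuss_catalan_def)
  from F have K: "abstract_complex K" and dim: "\<forall>\<sigma>\<in>K. card \<sigma> \<le> d + 1"
    and hs: "realization K homeomorphic_space closed_ball d"
    and nn: "card {\<sigma>\<in>K. card \<sigma> = d + 1} = n"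
    and sk: "\<forall>\<sigma>\<in>K. card \<sigma> \<le> d - 1 \<longrightarrow> in_boundary d K \<sigma>"
    unfolding fuss_catalan_complex_def by - (elim conjE, assumption)+
  obtain h where "homeomorphic_map (realization K) (closed_ball d) h"
    using hs homeomorphic_space by blast
  then obtain g where hom: "homeomorphism (points K) (ball_points d) h g"
    unfolding realization_eq closed_ball_eq homeomorphic_map_top_of_set by blast
  interpret ball_complex d K h g by unfold_locales (use d K dim hom sk in auto)
  have cr: "card (set r) = d" using r by (simp add: distinct_card)
  show "card (facets d K) = n" using nn by (simp add: facets_def)
  show "stacked d K r"
  proof
    show "1 \<le> d" using d by simp
    show "set r \<in> K" using rb by (simp add: in_boundary_def)
    show "\<sigma> = \<tau>" if "\<sigma> \<in> facets d K" "\<tau> \<in> facets d K" "set r \<subseteq> \<sigma>" "set r \<subseteq> \<tau>" for \<sigma> \<tau>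
      using boundary_facet[OF that(1,2) cr that(3,4) rb] .
  qed (fact K r pure two_facets dual_connected star_connected bridge)+
qed

section \<open>Classification and count\<close>

text \<open>Index 0 is treated apart because the root simplex alone is not a d-ball; its tree is
  empty. In all other cases the reconstruction from the facets applies.\<close>

lemma rooted_fuss_catalan_classification:
  fixes K :: "nat set set"
  assumes d: "d \<ge> 2" and fc: "rooted_fuss_catalan d n (K, r)"
  shows "set r \<subseteq> vertices K"
    and "\<exists>T\<in>trees d 0. card T = n \<and> rooted_iso (K, r) (tree_complex d T, root_list d)"
proof -
  have r: "distinct r" "length r = d" using fc by (auto simp: rooted_fuss_catalan_def)
  have "set r \<subseteq> vertices K \<and>
    (\<exists>T\<in>trees d 0. card T = n \<and> rooted_iso (K, r) (tree_complex d T, root_list d))"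
  proof (cases "n = 0")
    case True
    then have K: "K = {\<sigma>. \<sigma> \<subseteq> set r \<and> \<sigma> \<noteq> {}}" using fc by (simp add: rooted_fuss_catalan_def)
    have "r \<noteq> []" using r d by auto
    then have V: "vertices K = set r" unfolding vertices_def K by auto
    have L: "tree_complex d {} = {\<sigma>. \<sigma> \<subseteq> set (root_list d) \<and> \<sigma> \<noteq> {}}" by (auto simp: tree_complex_def)
    have "root_list d \<noteq> []" using d by (metis length_root_list list.size(3) not_numeral_le_zero)
    then have VL: "vertices (tree_complex d {}) = set (root_list d)" unfolding vertices_def L by auto
    obtain g where g: "map g r = root_list d" using root_labelling[OF r] by blast
    have gi: "inj_on g (set r)" using g by (metis distinct_map distinct_root_list)
    have gr: "g ` set r = set (root_list d)" using g by (metis list.set_map)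
    have "(\<lambda>\<sigma>. g ` \<sigma>) ` K = tree_complex d {}"
      unfolding K L gr[symmetric] by (auto simp: subset_image_iff)
    then have "rooted_iso (K, r) (tree_complex d {}, root_list d)"
      unfolding rooted_iso_def using g gi gr V VL by (auto simp: bij_betw_def)
    then show ?thesis using True V by (intro conjI bexI[of _ "{}"]) auto
  next
    case False
    then have n: "n > 0" by simp
    interpret stacked d K r by (rule fuss_catalan_stacked(1)[OF d n fc])
    have "set r \<subseteq> vertices K" using root_simplex by (auto simp: vertices_def)
    then show ?thesis using stacked_iso_tree_complex fuss_catalan_stacked(2)[OF d n fc] by auto
  qed
  then show "set r \<subseteq> vertices K"
    and "\<exists>T\<in>trees d 0. card T = n \<and> rooted_iso (K, r) (tree_complex d T, root_list d)" by auto
qed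

text \<open>The summand 1 for i > 0 accounts for the root vertex of colour i.\<close>

definition coloured_trees :: "nat \<Rightarrow> (nat \<Rightarrow> nat) \<Rightarrow> nat list set set" where
  "coloured_trees d \<gamma> = {T \<in> trees d 0. \<forall>i\<le>d. type_count T i + (if i = 0 then 0 else 1) = \<gamma> i}"

lemma sum_type_count:
  assumes T: "T \<in> trees d 0"
  shows "(\<Sum>i\<le>d. type_count T i) = card T"
proof -
  have "card (\<Union>i\<in>{..d}. {w \<in> T. last w = i}) = (\<Sum>i\<le>d. card {w \<in> T. last w = i})"
    using tree_finite[OF T] by (intro card_UN_disjoint) auto
  moreover have "(\<Union>i\<in>{..d}. {w \<in> T. last w = i}) = T" using wordD(5)[OF T] by auto
  ultimately show ?thesis by (simp add: type_count_def)
qed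

lemma card_coloured_tree:
  assumes T: "T \<in> coloured_trees d \<gamma>" and \<gamma>: "(\<Sum>j=0..d. \<gamma> j) = n + d"
  shows "card T = n"
proof -
  have T0: "T \<in> trees d 0" using T by (simp add: coloured_trees_def)
  have "(\<Sum>j\<le>d. \<gamma> j) = (\<Sum>i\<le>d. type_count T i + (if i = 0 then 0 else 1))"
    using T by (intro sum.cong) (auto simp: coloured_trees_def)
  also have "\<dots> = card T + (\<Sum>i\<le>d. if i = 0 then 0 else 1)"
    by (simp add: sum.distrib sum_type_count[OF T0])
  also have "(\<Sum>i\<le>d. if i = 0 then 0 else 1) = d"
    by (induction d) auto
  finally show ?thesis using \<gamma> by (simp add: atMost_atLeast0)
qed

lemma finite_coloured_trees: "finite (coloured_trees d \<gamma>)"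
proof -
  have "coloured_trees d \<gamma> \<subseteq> {T \<in> trees d 0. \<forall>k\<le>d. type_count T k = \<gamma> k - (if k = 0 then 0 else 1)}"
    unfolding coloured_trees_def by (intro Collect_mono) (metis add_diff_cancel_right')
  then show ?thesis by (rule finite_subset[OF _ card_trees(1)[OF le0]])
qed

text \<open>A nonempty tree contains the word [0], which is a vertex of colour 0, so only the empty
  tree is left.\<close>

lemma coloured_trees_no_apex:
  assumes "\<gamma> 0 = 0"
  shows "card (coloured_trees d \<gamma>) = (if \<forall>j\<in>{1..d}. \<gamma> j = 1 then 1 else 0)"
proof -
  have empty: "T = {}" if T: "T \<in> coloured_trees d \<gamma>" for T
  proof (rule ccontr)
    assume "T \<noteq> {}"
    have T0: "T \<in> trees d 0" using T by (simp add: coloured_trees_def)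
    have "[0] \<in> {w \<in> T. last w = 0}" using tree_nonempty_root[OF T0 \<open>T \<noteq> {}\<close>] by simp
    moreover have "finite {w \<in> T. last w = 0}" using tree_finite[OF T0] by simp
    ultimately have "type_count T 0 \<noteq> 0" unfolding type_count_def using card_0_eq by blast
    moreover have "type_count T 0 = 0" using T assms by (force simp: coloured_trees_def)
    ultimately show False by simp
  qed
  have "{} \<in> coloured_trees d \<gamma> \<longleftrightarrow> (\<forall>i\<le>d. (if i = 0 then 0 else 1) = \<gamma> i)"
    by (simp add: coloured_trees_def)
  also have "\<dots> \<longleftrightarrow> (\<forall>j\<in>{1..d}. \<gamma> j = 1)"
  proof (intro iffI ballI allI impI)
    fix j assume "\<forall>i\<le>d. (if i = 0 then 0 else 1) = \<gamma> i" "j \<in> {1..d}"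
    then show "\<gamma> j = 1" by force
  next
    fix i assume "\<forall>j\<in>{1..d}. \<gamma> j = 1" "i \<le> d"
    then show "(if i = 0 then 0 else 1) = \<gamma> i" using assms by (cases "i = 0") auto
  qed
  finally have e: "{} \<in> coloured_trees d \<gamma> \<longleftrightarrow> (\<forall>j\<in>{1..d}. \<gamma> j = 1)" .
  then have "coloured_trees d \<gamma> = (if \<forall>j\<in>{1..d}. \<gamma> j = 1 then {{}} else {})"
    using empty e by (cases "{} \<in> coloured_trees d \<gamma>") auto
  then show ?thesis by simp
qed

context
  fixes d n :: nat and \<gamma> :: "nat \<Rightarrow> nat"
  assumes d: "d \<ge> 2" and \<gamma>: "(\<Sum>j=0..d. \<gamma> j) = n + d"
begin

lemma coloured_fuss_catalan_tree:
  assumes "P \<in> coloured_fuss_catalan d n \<gamma>"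
  shows "\<exists>T\<in>coloured_trees d \<gamma>. rooted_iso P (tree_complex d T, root_list d)"
proof -
  obtain K r where P: "P = (K, r)" by (cases P)
  have fc: "rooted_fuss_catalan d n (K, r)"
    and c: "\<forall>i\<in>{0..d}. card {v \<in> vertices K. root_colouring d (K, r) v = i} = \<gamma> i"
    using assms by (auto simp: P coloured_fuss_catalan_def)
  obtain T where T: "T \<in> trees d 0" "rooted_iso (K, r) (tree_complex d T, root_list d)"
    using rooted_fuss_catalan_classification(2)[OF d fc] by blast
  have "type_count T i + (if i = 0 then 0 else 1) = \<gamma> i" if "i \<le> d" for i
    using colour_count_iso[OF T(2,1) rooted_fuss_catalan_classification(1)[OF d fc] that] c that by auto
  then have "T \<in> coloured_trees d \<gamma>" using T(1) by (simp add: coloured_trees_def)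
  then show ?thesis using T(2) P by blast
qed

lemma tree_coloured_fuss_catalan:
  assumes T: "T \<in> coloured_trees d \<gamma>"
  shows "(tree_complex d T, root_list d) \<in> coloured_fuss_catalan d n \<gamma>"
proof -
  have T0: "T \<in> trees d 0" using T by (simp add: coloured_trees_def)
  have fc: "rooted_fuss_catalan d n (tree_complex d T, root_list d)"
    using rooted_fuss_catalan_tree_complex[OF d T0] card_coloured_tree[OF T \<gamma>] by simp
  have "card {v \<in> vertices (tree_complex d T). root_colouring d (tree_complex d T, root_list d) v = i} = \<gamma> i"
    if "i \<in> {0..d}" for i
    using colour_count_iso[OF rooted_iso_refl T0 rooted_fuss_catalan_classification(1)[OF d fc], of i] that T
    by (auto simp: coloured_trees_def)
  then show ?thesis using fc by (simp add: coloured_fuss_catalan_def)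
qed

lemma coloured_fuss_catalan_sym:
  assumes "P \<in> coloured_fuss_catalan d n \<gamma>" "rooted_iso P Q"
  shows "rooted_iso Q P"
proof -
  obtain K r where P: "P = (K, r)" by (cases P)
  have "rooted_fuss_catalan d n (K, r)" using assms(1) by (simp add: P coloured_fuss_catalan_def)
  then show ?thesis
    using rooted_iso_sym assms(2) rooted_fuss_catalan_classification(1)[OF d] unfolding P by blast
qed

text \<open>Every class contains the complex of a tree by the classification, and of only one tree
  by \<open>tree_iso_subset\<close> applied in both directions.\<close>

lemma bij_classes:
  "bij_betw (\<lambda>T. {Q \<in> coloured_fuss_catalan d n \<gamma>. rooted_iso (tree_complex d T, root_list d) Q})
     (coloured_trees d \<gamma>) (coloured_fuss_catalan_classes d n \<gamma>)"
proof -
  let ?C = "coloured_fuss_catalan d n \<gamma>"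
  define cls where "cls P = {Q \<in> ?C. rooted_iso P Q}" for P :: "nat set set \<times> nat list"
  let ?P = "\<lambda>T. (tree_complex d T, root_list d)"
  have "{(P, Q). P \<in> ?C \<and> Q \<in> ?C \<and> rooted_iso P Q} `` {P} = cls P" if "P \<in> ?C" for P
    using that by (auto simp: cls_def)
  then have q: "coloured_fuss_catalan_classes d n \<gamma> = cls ` ?C"
    unfolding coloured_fuss_catalan_classes_def quotient_def by auto
  have cls_eq: "cls P = cls Q" if "P \<in> ?C" "Q \<in> ?C" "rooted_iso P Q" for P Q
    using that coloured_fuss_catalan_sym rooted_iso_trans unfolding cls_def by blast
  have "inj_on (\<lambda>T. cls (?P T)) (coloured_trees d \<gamma>)"
  proof (rule inj_onI)
    fix T T' assume T: "T \<in> coloured_trees d \<gamma>" "T' \<in> coloured_trees d \<gamma>" and eq: "cls (?P T) = cls (?P T')"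
    have t: "T \<in> trees d 0" "T' \<in> trees d 0" using T by (auto simp: coloured_trees_def)
    have "?P T' \<in> cls (?P T')" using tree_coloured_fuss_catalan[OF T(2)] rooted_iso_refl by (simp add: cls_def)
    then have 1: "rooted_iso (?P T) (?P T')" unfolding eq[symmetric] by (simp add: cls_def)
    have 2: "rooted_iso (?P T') (?P T)"
      by (rule coloured_fuss_catalan_sym[OF tree_coloured_fuss_catalan[OF T(1)] 1])
    show "T = T'"
      using tree_iso_subset[OF t _ 1] tree_iso_subset[OF t(2,1) _ 2] d by simp
  qed
  moreover have "(\<lambda>T. cls (?P T)) ` coloured_trees d \<gamma> = cls ` ?C"
  proof (intro equalityI subsetI)
    fix X assume "X \<in> cls ` ?C"
    then obtain P where P: "P \<in> ?C" "X = cls P" by blast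
    then obtain T where "T \<in> coloured_trees d \<gamma>" "rooted_iso P (?P T)"
      using coloured_fuss_catalan_tree by blast
    then show "X \<in> (\<lambda>T. cls (?P T)) ` coloured_trees d \<gamma>"
      using cls_eq[OF P(1) tree_coloured_fuss_catalan] P(2) by blast
  qed (use tree_coloured_fuss_catalan in blast)
  ultimately show ?thesis unfolding q cls_def bij_betw_def by simp
qed

text \<open>With the root vertices removed, m j = \<gamma> j - 1 for j \<ge> 1, so n - \<gamma> j +
  1 is n - m j. Each of the d factors for j \<ge> 1 contributes one n, and one of these cancels
  against the denominator in \<open>forest_number_root\<close>; this explains the exponent d -
  1.\<close>

lemma coloured_trees_formula:
  assumes \<gamma>0: "\<gamma> 0 \<noteq> 0"
  shows "real (card (coloured_trees d \<gamma>)) = real n ^ (d - 1) *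
         (real (\<gamma> 0) / (real n - real (\<gamma> 0) + 1) * binom (real n - real (\<gamma> 0) + 1) (int (\<gamma> 0))) *
         (\<Prod>j=1..d. 1 / (real n - real (\<gamma> j) + 1) * binom (real n - real (\<gamma> j) + 1) (int (\<gamma> j) - 1))"
proof (cases "\<exists>j\<in>{1..d}. \<gamma> j = 0")
  \<comment> \<open>Both sides vanish: the root has a vertex of colour j, and the binomial
    coefficient with lower entry -1 is 0.\<close>
  case True
  then obtain j where j: "j \<in> {1..d}" "\<gamma> j = 0" by blast
  have "T \<notin> coloured_trees d \<gamma>" for T
  proof
    assume "T \<in> coloured_trees d \<gamma>"
    then have "\<forall>i\<le>d. type_count T i + (if i = 0 then 0 else 1) = \<gamma> i" unfolding coloured_trees_def by blast
    from this[rule_format, of j] show False using j by simp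
  qed
  then have "coloured_trees d \<gamma> = {}" by blast
  moreover have "binom x (int (\<gamma> j) - 1) = 0" for x using j(2) by (simp add: binom_def)
  then have "(\<Prod>j=1..d. 1 / (real n - real (\<gamma> j) + 1) * binom (real n - real (\<gamma> j) + 1) (int (\<gamma> j) - 1)) = 0"
    by (intro prod_zero bexI[of _ j]) (use j(1) in simp_all)
  ultimately show ?thesis by simp
next
  case False
  define m where "m k = (if k = 0 then \<gamma> 0 else \<gamma> k - 1)" for k
  have \<gamma>m: "\<gamma> k = m k + (if k = 0 then 0 else 1)" if "k \<le> d" for k
    using False that by (auto simp: m_def Suc_le_eq)
  have S: "coloured_trees d \<gamma> = {T \<in> trees d 0. \<forall>k\<le>d. type_count T k = m k}"
    unfolding coloured_trees_def using \<gamma>m by (intro Collect_cong) auto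
  have n: "n = sum m {..d}"
  proof -
    have "n + d = (\<Sum>j\<le>d. m j + (if j = 0 then 0 else 1))"
      unfolding \<gamma>[symmetric] atMost_atLeast0 using \<gamma>m by (intro sum.cong) auto
    moreover have "(\<Sum>i\<le>d. if i = 0 then 0 else 1) = d" by (induction d) auto
    ultimately show ?thesis by (simp add: sum.distrib)
  qed
  have m0: "m 0 = \<gamma> 0" "m 0 > 0" using \<gamma>0 by (auto simp: m_def)
  have split: "n = m 0 + sum m ({..d} - {0})" unfolding n by (intro sum.remove) auto
  then have n0: "n > 0" "m 0 \<le> n" using m0 by auto
  \<comment> \<open>The inequality is strict because m 0 > 0; it keeps the denominators n - m j away
    from 0.\<close>
  have mj: "m j < n" if "j \<in> {1..d}" for j
  proof -
    have "m j \<le> sum m ({..d} - {0})" using that by (intro member_le_sum) auto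
    then show ?thesis using split m0 by simp
  qed
  have g0: "gbin (real n + 1) (m 0) = (real n + 1) / (real n - real (m 0) + 1) * (real n - real (m 0) + 1 gchoose m 0)"
    using gbin_eq[of "real n + 1" "m 0"] n0 by (simp add: algebra_simps)
  have gj: "gbin (real n) (m j) = real n * (1 / (real n - real (\<gamma> j) + 1) * binom (real n - real (\<gamma> j) + 1) (int (\<gamma> j) - 1))"
    if "j \<in> {1..d}" for j
  proof -
    have "\<gamma> j = m j + 1" using \<gamma>m[of j] that by simp
    then show ?thesis using gbin_eq[of "real n" "m j"] mj[OF that] n0 by (simp add: binom_def)
  qed
  have "(\<Prod>j=1..d. gbin (real n) (m j)) =
    (\<Prod>j=1..d. real n * (1 / (real n - real (\<gamma> j) + 1) * binom (real n - real (\<gamma> j) + 1) (int (\<gamma> j) - 1)))"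
    by (rule prod.cong) (use gj in auto)
  also have "\<dots> = real n ^ d *
      (\<Prod>j=1..d. 1 / (real n - real (\<gamma> j) + 1) * binom (real n - real (\<gamma> j) + 1) (int (\<gamma> j) - 1))"
    (is "_ = _ * ?Q")
    unfolding prod.distrib[of "\<lambda>_. real n"] by simp
  finally have prod: "(\<Prod>j=1..d. gbin (real n) (m j)) = real n ^ d * ?Q" .
  have "real (card (coloured_trees d \<gamma>)) = real (m 0) / (real n * (real n + 1)) * gbin (real n + 1) (m 0) * (real n ^ d * ?Q)"
    unfolding S card_trees(2)[OF le0] forest_number_root[OF n n0(1)] prod ..
  also have "real n ^ d = real n * real n ^ (d - 1)" using d by (cases d) auto
  also have "real (m 0) / (real n * (real n + 1)) * gbin (real n + 1) (m 0) * (real n * real n ^ (d - 1) * ?Q) =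
      real n ^ (d - 1) * (real (m 0) / (real n - real (m 0) + 1) * (real n - real (m 0) + 1 gchoose m 0)) * ?Q"
  proof -
    have "a / (N * (N + 1)) * ((N + 1) / D * B) * (N * E * Q) = E * (a / D * B) * Q"
      if "N > 0" for N D B E Q a :: real
    proof -
      have "a / (N * (N + 1)) * ((N + 1) / D * B) * (N * E * Q) = (N * (N + 1)) / (N * (N + 1)) * (E * (a / D * B) * Q)"
        by (simp add: mult_ac)
      then show ?thesis using that by simp
    qed
    from this[of "real n"] show ?thesis unfolding g0 using n0 by simp
  qed
  finally show ?thesis unfolding m0(1) by (simp add: binom_def)
qed

end

theorem theorem3:
  fixes d n :: nat and \<gamma> :: "nat \<Rightarrow> nat" and s :: int
  assumes "d \<ge> 2"
    and "(\<Sum>j=0..d. \<gamma> j) = n + d"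
    and "s = - int d + (\<Sum>j=0..d. int (\<gamma> j))"
  shows "finite (coloured_fuss_catalan_classes d n \<gamma>) \<and>
    real (card (coloured_fuss_catalan_classes d n \<gamma>)) =
      (if \<gamma> 0 = 0 then (if \<forall>j\<in>{1..d}. \<gamma> j = 1 then 1 else 0)
       else real_of_int s ^ (d - 1) *
         (real (\<gamma> 0) / real_of_int (s - int (\<gamma> 0) + 1) *
            binom (real_of_int (s - int (\<gamma> 0) + 1)) (int (\<gamma> 0))) *
         (\<Prod>j=1..d. 1 / real_of_int (s - int (\<gamma> j) + 1) *
            binom (real_of_int (s - int (\<gamma> j) + 1)) (int (\<gamma> j) - 1)))"
proof
  note bij = bij_classes[OF assms(1,2)]
  show "finite (coloured_fuss_catalan_classes d n \<gamma>)"
    using bij_betw_finite[OF bij] finite_coloured_trees by blast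
  have card: "card (coloured_fuss_catalan_classes d n \<gamma>) = card (coloured_trees d \<gamma>)"
    using bij_betw_same_card[OF bij] by simp
  have "s = int n" using assms(2,3) by (simp flip: of_nat_sum)
  then have s: "real_of_int s = real n" "real_of_int (s - int k + 1) = real n - real k + 1" for k by simp_all
  show "real (card (coloured_fuss_catalan_classes d n \<gamma>)) =
      (if \<gamma> 0 = 0 then (if \<forall>j\<in>{1..d}. \<gamma> j = 1 then 1 else 0)
       else real_of_int s ^ (d - 1) *
         (real (\<gamma> 0) / real_of_int (s - int (\<gamma> 0) + 1) *
            binom (real_of_int (s - int (\<gamma> 0) + 1)) (int (\<gamma> 0))) *
         (\<Prod>j=1..d. 1 / real_of_int (s - int (\<gamma> j) + 1) *
            binom (real_of_int (s - int (\<gamma> j) + 1)) (int (\<gamma> j) - 1)))"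
  proof (cases "\<gamma> 0 = 0")
    case True
    then show ?thesis unfolding card using coloured_trees_no_apex by simp
  next
    case False
    then show ?thesis unfolding card s using coloured_trees_formula[OF assms(1,2)] by simp
  qed
qed

end
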